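(* For every $d\ge 2$, there exists a unique geodesically complete hybrid connection $\nabla$ on the Hessian manifold $(\mathcal{B}^d,D,g)$, where $\mathcal{B}^d\subset\mathbb{R}^d$ is the open $d$-dimensional unit ball, $D$ is the standard affine connection and $g=\sum_{i=1}^d dx_i^2$ is the standard Euclidean metric. Its hybrid potential is $\psi:(x_1,\dots,x_d)\mapsto \frac12\left(|x|^2-1\right)$.
   Context: A smooth manifold endowed with an affine connection is geodesically complete if every maximal geodesic of the connection is parameterized from $-\infty$ to $+\infty$. The Hessian $H(f)$ of a function $f$ is the $(0,2)$-tensor with matrix $\left(\frac{\partial^2 f}{\partial x_i\partial x_j}\right)$ in affine charts (charts in which the flat affine connection $D$ is the canonical connection of $\mathbb{R}^d$). A Hessian manifold $(M,D,g)$: $M$ connected of dimension $d\ge2$, $D$ a flat (torsion-free, zero curvature) affine connection, $g$ a pseudo-Riemannian metric locally of the form $H(\psi)$. A hybrid connection $\nabla$ on $(M,D,g)$ is a smooth symmetric (torsion-free) affine connection such that: (1) its unparameterized geodesics are those of $D$ (straight lines in affine charts); (2) it is incompressible: near every point there is a non-vanishing volume form locally preserved by its parallel transport; (3) it is infinitesimally conformal: in any affine chart its holonomy around an arbitrarily small planar rectangle of area $\mathcal{A}$ is $\mathrm{Id}+\mathcal{A}\mathcal{M}+o(\mathcal{A})$ with $\mathcal{M}$ an infinitesimal similarity of $g$, i.e. $g(\mathcal{M}v,w)+g(v,\mathcal{M}w)=c\,g(v,w)$ for some $c\in\mathbb{R}$ (for the rectangle directed by $e_i,e_j$, $\mathcal{M}=-R(e_i,e_j)$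 with $R$ the curvature tensor of $\nabla$); (4) its curvature tensor vanishes at no point. The hybrid potential of a hybrid connection $\nabla$ is the unique smooth function $\psi:M\to\mathbb{R}\setminus\{0\}$ such that $H(\psi)=g$ and $\nabla_u v = D_u v - \frac{d\psi(u)v+d\psi(v)u}{\psi}$ for all tangent vectors $u$ and local vector fields $v$. *)

theory Defs
  imports "HOL-Analysis.Analysis"
begin

text \<open>
  A Hessian manifold whose flat connection \<open>D\<close> is the restriction of the canonical connection of
  \<open>\<real>\<^sup>d\<close> is represented by an open set \<open>U\<close> of \<open>real ^ 'n\<close>, with \<open>d = CARD('n)\<close>. Tensors, functions
  and vector fields on \<open>U\<close> are total functions whose values outside \<open>U\<close> are irrelevant.
\<close>

section \<open>Smooth functions and vector fields\<close>

fun Ck_on :: "nat \<Rightarrow> 'a::real_normed_vector set \<Rightarrow> ('a \<Rightarrow> 'b::real_normed_vector) \<Rightarrow> bool" where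
  "Ck_on 0 U f \<longleftrightarrow> continuous_on U f"
| "Ck_on (Suc k) U f \<longleftrightarrow>
     (\<forall>x\<in>U. f differentiable (at x)) \<and> (\<forall>v. Ck_on k U (\<lambda>x. frechet_derivative f (at x) v))"

text \<open>Only used for open \<open>U\<close> and finite-dimensional domains.\<close>

definition smooth_on :: "'a::real_normed_vector set \<Rightarrow> ('a \<Rightarrow> 'b::real_normed_vector) \<Rightarrow> bool" where
  "smooth_on U f \<longleftrightarrow> (\<forall>k. Ck_on k U f)"

type_synonym 'n field = "real ^ 'n \<Rightarrow> real ^ 'n"

definition lie_bracket :: "('n::finite) field \<Rightarrow> 'n field \<Rightarrow> 'n field" where
  "lie_bracket X Y x =
     frechet_derivative Y (at x) (X x) - frechet_derivative X (at x) (Y x)"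

section \<open>Hessian metrics\<close>

type_synonym 'n metric = "real ^ 'n \<Rightarrow> real ^ 'n \<Rightarrow> real ^ 'n \<Rightarrow> real"

definition hessian :: "(real ^ 'n::finite \<Rightarrow> real) \<Rightarrow> 'n metric" where
  "hessian \<psi> x u v =
     frechet_derivative (\<lambda>y. frechet_derivative \<psi> (at y) v) (at x) u"

definition pseudo_riemannian :: "(real ^ 'n::finite) set \<Rightarrow> 'n metric \<Rightarrow> bool" where
  "pseudo_riemannian U g \<longleftrightarrow>
     (\<forall>u v. smooth_on U (\<lambda>x. g x u v)) \<and>
     (\<forall>x\<in>U. bilinear (g x) \<and> (\<forall>u v. g x u v = g x v u) \<and>
        (\<forall>u. (\<forall>v. g x u v = 0) \<longrightarrow> u = 0))"

definition hessian_manifold :: "(real ^ 'n::finite) set \<Rightarrow> 'n metric \<Rightarrow> bool" where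
  "hessian_manifold U g \<longleftrightarrow>
     open U \<and> connected U \<and> U \<noteq> {} \<and> CARD('n) \<ge> 2 \<and> pseudo_riemannian U g \<and>
     (\<forall>x\<in>U. \<exists>V \<psi>. open V \<and> x \<in> V \<and> V \<subseteq> U \<and> smooth_on V \<psi> \<and>
        (\<forall>y\<in>V. \<forall>u v. hessian \<psi> y u v = g y u v))"

definition standard_metric :: "('n::finite) metric" where
  "standard_metric x u v = (\<Sum>i\<in>UNIV. u $ i * v $ i)"

section \<open>Affine connections\<close>

type_synonym 'n connection = "'n field \<Rightarrow> 'n field \<Rightarrow> 'n field"

text \<open>
  Smooth affine connections as covariant derivatives \<open>(X, Y) \<mapsto> \<nabla>\<^sub>X Y\<close>. Since \<open>f\<close> may be the
  indicator function of \<open>- U\<close>, linearity and the Leibniz rule force the value of \<open>nabla X Y\<close> on \<open>U\<close>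
  to depend on the restrictions of \<open>X\<close> and \<open>Y\<close> to \<open>U\<close> only.
\<close>

definition affine_connection :: "(real ^ 'n::finite) set \<Rightarrow> 'n connection \<Rightarrow> bool" where
  "affine_connection U nabla \<longleftrightarrow>
     (\<forall>X Y. smooth_on U X \<longrightarrow> smooth_on U Y \<longrightarrow> smooth_on U (nabla X Y)) \<and>
     (\<forall>X X' Y. smooth_on U X \<longrightarrow> smooth_on U X' \<longrightarrow> smooth_on U Y \<longrightarrow>
        (\<forall>x\<in>U. nabla (\<lambda>y. X y + X' y) Y x = nabla X Y x + nabla X' Y x)) \<and>
     (\<forall>f X Y. smooth_on U (f :: real ^ 'n \<Rightarrow> real) \<longrightarrow> smooth_on U X \<longrightarrow> smooth_on U Y \<longrightarrow>
        (\<forall>x\<in>U. nabla (\<lambda>y. f y *\<^sub>R X y) Y x = f x *\<^sub>R nabla X Y x)) \<and>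
     (\<forall>X Y Y'. smooth_on U X \<longrightarrow> smooth_on U Y \<longrightarrow> smooth_on U Y' \<longrightarrow>
        (\<forall>x\<in>U. nabla X (\<lambda>y. Y y + Y' y) x = nabla X Y x + nabla X Y' x)) \<and>
     (\<forall>f X Y. smooth_on U (f :: real ^ 'n \<Rightarrow> real) \<longrightarrow> smooth_on U X \<longrightarrow> smooth_on U Y \<longrightarrow>
        (\<forall>x\<in>U. nabla X (\<lambda>y. f y *\<^sub>R Y y) x =
           frechet_derivative f (at x) (X x) *\<^sub>R Y x + f x *\<^sub>R nabla X Y x))"

definition connection_eq_on ::
    "(real ^ 'n::finite) set \<Rightarrow> 'n connection \<Rightarrow> 'n connection \<Rightarrow> bool" where
  "connection_eq_on U nabla nabla' \<longleftrightarrow>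
     (\<forall>X Y. smooth_on U X \<longrightarrow> smooth_on U Y \<longrightarrow> (\<forall>x\<in>U. nabla X Y x = nabla' X Y x))"

definition standard_connection :: "('n::finite) connection" where
  "standard_connection X Y x = frechet_derivative Y (at x) (X x)"

definition torsion_free :: "(real ^ 'n::finite) set \<Rightarrow> 'n connection \<Rightarrow> bool" where
  "torsion_free U nabla \<longleftrightarrow>
     (\<forall>X Y. smooth_on U X \<longrightarrow> smooth_on U Y \<longrightarrow>
        (\<forall>x\<in>U. nabla X Y x - nabla Y X x = lie_bracket X Y x))"

definition curvature :: "('n::finite) connection \<Rightarrow> 'n field \<Rightarrow> 'n field \<Rightarrow> 'n field \<Rightarrow> 'n field" where
  "curvature nabla X Y Z x =
     nabla X (nabla Y Z) x - nabla Y (nabla X Z) x - nabla (lie_bracket X Y) Z x"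

text \<open>The tensors at \<open>x\<close> are obtained by extending tangent vectors to constant vector fields.\<close>

definition curvature_tensor ::
    "('n::finite) connection \<Rightarrow> real ^ 'n \<Rightarrow> real ^ 'n \<Rightarrow> real ^ 'n \<Rightarrow> real ^ 'n \<Rightarrow> real ^ 'n" where
  "curvature_tensor nabla x u v w = curvature nabla (\<lambda>_. u) (\<lambda>_. v) (\<lambda>_. w) x"

definition christoffel ::
    "('n::finite) connection \<Rightarrow> real ^ 'n \<Rightarrow> real ^ 'n \<Rightarrow> real ^ 'n \<Rightarrow> real ^ 'n" where
  "christoffel nabla x u v = nabla (\<lambda>_. u) (\<lambda>_. v) x"

section \<open>Parallel transport and geodesics\<close>

text \<open>
  The field \<open>V\<close> along the curve \<open>c\<close> has vanishing covariant derivative at time \<open>t\<close>: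
  \<open>V' + \<Gamma>\<^sub>c(c', V) = 0\<close>.
\<close>

definition parallel_at ::
    "('n::finite) connection \<Rightarrow> (real \<Rightarrow> real ^ 'n) \<Rightarrow> (real \<Rightarrow> real ^ 'n) \<Rightarrow> real \<Rightarrow> bool" where
  "parallel_at nabla c V t \<longleftrightarrow>
     (V has_vector_derivative - christoffel nabla (c t) (vector_derivative c (at t)) (V t)) (at t)"

text \<open>
  Paths are piecewise continuously differentiable (\<open>valid_path\<close>), hence the finite exceptional set.
\<close>

definition parallel_transport ::
    "('n::finite) connection \<Rightarrow> (real \<Rightarrow> real ^ 'n) \<Rightarrow> real ^ 'n \<Rightarrow> real ^ 'n \<Rightarrow> bool" where
  "parallel_transport nabla c v w \<longleftrightarrow>
     (\<exists>V. continuous_on {0..1} V \<and> (\<exists>S. finite S \<and> (\<forall>t\<in>{0..1} - S. parallel_at nabla c V t)) \<and>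
        V 0 = v \<and> V 1 = w)"

definition holonomy :: "('n::finite) connection \<Rightarrow> (real \<Rightarrow> real ^ 'n) \<Rightarrow> real ^ 'n \<Rightarrow> real ^ 'n" where
  "holonomy nabla c v = (THE w. parallel_transport nabla c v w)"

definition geodesic_on ::
    "(real ^ 'n::finite) set \<Rightarrow> 'n connection \<Rightarrow> real set \<Rightarrow> (real \<Rightarrow> real ^ 'n) \<Rightarrow> bool" where
  "geodesic_on U nabla I c \<longleftrightarrow>
     open I \<and> is_interval I \<and> I \<noteq> {} \<and> c ` I \<subseteq> U \<and>
     (\<forall>t\<in>I. c differentiable (at t) \<and> parallel_at nabla c (\<lambda>s. vector_derivative c (at s)) t)"

definition maximal_geodesic ::
    "(real ^ 'n::finite) set \<Rightarrow> 'n connection \<Rightarrow> real set \<Rightarrow> (real \<Rightarrow> real ^ 'n) \<Rightarrow> bool" where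
  "maximal_geodesic U nabla I c \<longleftrightarrow>
     geodesic_on U nabla I c \<and>
     (\<forall>J k. geodesic_on U nabla J k \<longrightarrow> I \<subseteq> J \<longrightarrow> (\<forall>t\<in>I. k t = c t) \<longrightarrow> J = I)"

definition geodesically_complete :: "(real ^ 'n::finite) set \<Rightarrow> 'n connection \<Rightarrow> bool" where
  "geodesically_complete U nabla \<longleftrightarrow> (\<forall>I c. maximal_geodesic U nabla I c \<longrightarrow> I = UNIV)"

text \<open>The curve \<open>k\<close> on \<open>J\<close> is the composition of \<open>c\<close> on \<open>I\<close> with a diffeomorphism from \<open>J\<close> to \<open>I\<close>.\<close>

definition reparametrization ::
    "real set \<Rightarrow> (real \<Rightarrow> 'a) \<Rightarrow> real set \<Rightarrow> (real \<Rightarrow> 'a) \<Rightarrow> bool" where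
  "reparametrization I c J k \<longleftrightarrow>
     (\<exists>\<phi>. bij_betw \<phi> J I \<and> smooth_on J \<phi> \<and> (\<forall>t\<in>J. deriv \<phi> t \<noteq> 0 \<and> k t = c (\<phi> t)))"

definition same_unparameterized_geodesics ::
    "(real ^ 'n::finite) set \<Rightarrow> 'n connection \<Rightarrow> 'n connection \<Rightarrow> bool" where
  "same_unparameterized_geodesics U nabla nabla' \<longleftrightarrow>
     (\<forall>I c. geodesic_on U nabla I c \<longrightarrow>
        (\<exists>J k. geodesic_on U nabla' J k \<and> reparametrization I c J k)) \<and>
     (\<forall>I c. geodesic_on U nabla' I c \<longrightarrow>
        (\<exists>J k. geodesic_on U nabla J k \<and> reparametrization I c J k))"

section \<open>Hybrid connections\<close>

text \<open>The volume form at \<open>x\<close> is \<open>\<rho> x\<close> times the determinant; frames are given by the rows of matrices.\<close>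

definition incompressible :: "(real ^ 'n::finite) set \<Rightarrow> 'n connection \<Rightarrow> bool" where
  "incompressible U nabla \<longleftrightarrow>
     (\<forall>x\<in>U. \<exists>V \<rho>. open V \<and> x \<in> V \<and> V \<subseteq> U \<and>
        smooth_on V (\<rho> :: real ^ 'n \<Rightarrow> real) \<and> (\<forall>y\<in>V. \<rho> y \<noteq> 0) \<and>
        (\<forall>c (E :: real ^ 'n ^ 'n) F. valid_path c \<longrightarrow> path_image c \<subseteq> V \<longrightarrow>
           (\<forall>i. parallel_transport nabla c (E $ i) (F $ i)) \<longrightarrow>
           \<rho> (pathfinish c) * det F = \<rho> (pathstart c) * det E))"

definition infinitesimal_similarity ::
    "(real ^ 'n::finite \<Rightarrow> real ^ 'n \<Rightarrow> real) \<Rightarrow> (real ^ 'n \<Rightarrow> real ^ 'n) \<Rightarrow> bool" where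
  "infinitesimal_similarity h M \<longleftrightarrow>
     linear M \<and> (\<exists>c. \<forall>v w. h (M v) w + h v (M w) = c * h v w)"

definition rectangle_loop :: "real ^ 'n::finite \<Rightarrow> real ^ 'n \<Rightarrow> real ^ 'n \<Rightarrow> real \<Rightarrow> real ^ 'n" where
  "rectangle_loop x a b =
     linepath x (x + a) +++ linepath (x + a) (x + a + b) +++
     linepath (x + a + b) (x + b) +++ linepath (x + b) x"

text \<open>
  The affine charts are the affine bijections, so the rectangles of all affine charts are the
  parallelograms. In a chart with first basis vectors \<open>u\<close>, \<open>v\<close>, the one with sides \<open>\<epsilon> u\<close>, \<open>\<epsilon> v\<close>
  has area \<open>\<epsilon>\<^sup>2\<close>; rescaling \<open>u\<close> and \<open>v\<close> gives arbitrary side ratios. As the holonomy is linear in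
  \<open>w\<close> and the dimension is finite, the pointwise limit says \<open>Id + \<epsilon>\<^sup>2 M + o(\<epsilon>\<^sup>2)\<close>.
\<close>

definition infinitesimally_conformal ::
    "(real ^ 'n::finite) set \<Rightarrow> 'n metric \<Rightarrow> 'n connection \<Rightarrow> bool" where
  "infinitesimally_conformal U g nabla \<longleftrightarrow>
     (\<forall>x\<in>U. \<forall>u v. u \<noteq> v \<longrightarrow> independent {u, v} \<longrightarrow>
        (\<exists>M. infinitesimal_similarity (g x) M \<and>
           (\<forall>w. ((\<lambda>\<epsilon>. (holonomy nabla (rectangle_loop x (\<epsilon> *\<^sub>R u) (\<epsilon> *\<^sub>R v)) w - w) /\<^sub>R \<epsilon>\<^sup>2)
                   \<longlongrightarrow> M w) (at_right 0))))"

definition hybrid_connection ::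
    "(real ^ 'n::finite) set \<Rightarrow> 'n metric \<Rightarrow> 'n connection \<Rightarrow> bool" where
  "hybrid_connection U g nabla \<longleftrightarrow>
     hessian_manifold U g \<and> affine_connection U nabla \<and> torsion_free U nabla \<and>
     same_unparameterized_geodesics U nabla standard_connection \<and>
     incompressible U nabla \<and>
     infinitesimally_conformal U g nabla \<and>
     (\<forall>x\<in>U. \<exists>u v w. curvature_tensor nabla x u v w \<noteq> 0)"

definition potential_for ::
    "(real ^ 'n::finite) set \<Rightarrow> 'n metric \<Rightarrow> 'n connection \<Rightarrow> (real ^ 'n \<Rightarrow> real) \<Rightarrow> bool" where
  "potential_for U g nabla \<psi> \<longleftrightarrow>
     smooth_on U \<psi> \<and> (\<forall>x\<in>U. \<psi> x \<noteq> 0) \<and>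
     (\<forall>x\<in>U. \<forall>u v. hessian \<psi> x u v = g x u v) \<and>
     (\<forall>X Y. smooth_on U X \<longrightarrow> smooth_on U Y \<longrightarrow>
        (\<forall>x\<in>U. nabla X Y x = standard_connection X Y x -
           (frechet_derivative \<psi> (at x) (X x) *\<^sub>R Y x +
            frechet_derivative \<psi> (at x) (Y x) *\<^sub>R X x) /\<^sub>R \<psi> x))"

definition is_hybrid_potential ::
    "(real ^ 'n::finite) set \<Rightarrow> 'n metric \<Rightarrow> 'n connection \<Rightarrow> (real ^ 'n \<Rightarrow> real) \<Rightarrow> bool" where
  "is_hybrid_potential U g nabla \<psi> \<longleftrightarrow>
     potential_for U g nabla \<psi> \<and>
     (\<forall>\<phi>. potential_for U g nabla \<phi> \<longrightarrow> (\<forall>x\<in>U. \<phi> x = \<psi> x))"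

end

theory Submission
  imports Defs
begin

text \<open>
  A connection with the same unparameterized geodesics as \<open>D\<close> has Christoffel symbols
  \<open>\<Gamma>(u, v) = \<langle>A, u\<rangle> v + \<langle>A, v\<rangle> u\<close> for a field \<open>A\<close>. Incompressibility makes \<open>A\<close> closed, and
  infinitesimal conformality, read off from the holonomy \<open>Id - \<epsilon>\<^sup>2 R(u, v) + o(\<epsilon>\<^sup>2)\<close> of small
  parallelograms, amounts to \<open>D\<^sub>u A = \<langle>A, u\<rangle> A + \<lambda> u\<close> for a function \<open>\<lambda>\<close>, which does not vanish because
  the curvature does not. The symmetry of the second derivatives of \<open>A\<close> then gives \<open>d\<lambda> = \<lambda> A\<close>, so that
  \<open>\<psi> = - 1 / \<lambda>\<close> satisfies \<open>A = - d\<psi> / \<psi>\<close> and has Hessian \<open>g\<close>, that is,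
  \<open>\<psi>(x) = \<bar>x\<bar>\<^sup>2 / 2 + \<langle>b, x\<rangle> + c\<close>.

  The velocity of a geodesic is \<open>\<psi>\<^sup>2\<close> times a constant vector, so the time needed to run along a chord
  is the integral of \<open>1 / \<psi>\<^sup>2\<close>. It diverges at a boundary point exactly if \<open>\<psi>\<close> vanishes there. Hence
  completeness means that \<open>\<psi>\<close> vanishes on the unit sphere, which forces \<open>b = 0\<close> and \<open>c = - 1 / 2\<close>.
\<close>

section \<open>Calculus of smooth functions\<close>

text \<open>The special shape of \<Gamma> replaces the theory of differential equations by explicit
  formulas. Along a segment the direction is constant, so parallel transport is given by integrals;
  geodesics reduce to inverting one scalar function, the elapsed time. The holonomy expansion serves
  twice: to verify conformality of the connection of the ball, and to extract the equation for
  \<open>A\<close> from an unknown connection. Since \<open>holonomy\<close> is a definite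
  description, the expansion also requires existence and uniqueness of the transport around small
  loops. The equation for \<open>A\<close> comes from linear algebra. With
  \<open>L u = D_u A - <A, u> A\<close>, symmetric because \<open>A\<close> is closed, the generator
  for orthonormal \<open>a\<close>, \<open>b\<close> is
  \<open>w \<mapsto> <L b, w> a - <L a, w> b\<close>; it is a similarity for all such pairs only if
  \<open>L\<close> is scalar. The metric fixes the quadratic part of \<psi> and leaves only
  \<open>b\<close> and \<open>c\<close> free. Completeness acts on them because the zeros of the
  ball potential at the ends of a chord are simple: \<open>1 / \<psi>^2\<close> then has a double
  pole, which is not integrable.\<close>

lemma frechet_derivative_eqI: "(f has_derivative f') (at x) \<Longrightarrow> frechet_derivative f (at x) = f'"
  using frechet_derivative_at by metis

lemma Ck_on_cong:
  assumes "open U" "\<And>x. x \<in> U \<Longrightarrow> f x = g x" "Ck_on k U f"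
  shows "Ck_on k U g"
  using assms(2,3)
proof (induction k arbitrary: f g)
  case 0
  then show ?case using continuous_on_eq by fastforce
next
  case (Suc k)
  have d: "f differentiable at x" if "x \<in> U" for x using Suc.prems that by simp
  have e: "frechet_derivative f (at x) = frechet_derivative g (at x)" if "x \<in> U" for x
    using frechet_derivative_transform_within_open[OF d assms(1)] Suc.prems(1) that by metis
  have "g differentiable at x" if "x \<in> U" for x
    using d[OF that] Suc.prems(1) that assms(1)
    by (meson differentiable_def has_derivative_transform_within_open)
  moreover have "Ck_on k U (\<lambda>x. frechet_derivative g (at x) v)" for v
    by (rule Suc.IH[of "\<lambda>x. frechet_derivative f (at x) v"]) (use e Suc.prems in auto)
  ultimately show ?case by simp
qed

lemma Ck_on_SucD: "Ck_on (Suc k) U f \<Longrightarrow> Ck_on k U f"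
proof (induction k arbitrary: f)
  case 0
  then show ?case
    by (auto intro!: differentiable_imp_continuous_on
        simp: differentiable_on_def differentiable_at_withinI)
qed auto

lemma Ck_on_Suc_I:
  assumes "open U" "\<And>x. x \<in> U \<Longrightarrow> (f has_derivative f' x) (at x)" "\<And>v. Ck_on k U (\<lambda>x. f' x v)"
  shows "Ck_on (Suc k) U f"
proof -
  have "Ck_on k U (\<lambda>x. frechet_derivative f (at x) v)" for v
    by (rule Ck_on_cong[OF assms(1) _ assms(3)[of v]])
       (simp add: frechet_derivative_eqI[OF assms(2)])
  then show ?thesis using assms(2) by (auto simp: differentiable_def)
qed

lemma Ck_on_Suc_has_derivative:
  "Ck_on (Suc k) U f \<Longrightarrow> x \<in> U \<Longrightarrow> (f has_derivative frechet_derivative f (at x)) (at x)"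
  by (simp add: frechet_derivative_works)

lemma Ck_on_const: "open U \<Longrightarrow> Ck_on k U (\<lambda>_. c)"
  by (induction k arbitrary: c) auto

lemma Ck_on_add:
  assumes "open U"
  shows "Ck_on k U f \<Longrightarrow> Ck_on k U g \<Longrightarrow> Ck_on k U (\<lambda>x. f x + g x)"
proof (induction k arbitrary: f g)
  case 0
  then show ?case by (auto intro: continuous_on_add)
next
  case (Suc k)
  show ?case
    by (rule Ck_on_Suc_I[OF assms has_derivative_add[OF
          Ck_on_Suc_has_derivative[OF Suc.prems(1)] Ck_on_Suc_has_derivative[OF Suc.prems(2)]]])
       (use Suc in auto)
qed

text \<open>The product rule yields two terms of the same form \<open>h (f x) (g x)\<close> with one
  factor differentiated, so a single induction covers products, scalings and inner products.\<close>

lemma Ck_on_bounded_bilinear: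
  assumes "open U" "bounded_bilinear h"
  shows "Ck_on k U f \<Longrightarrow> Ck_on k U g \<Longrightarrow> Ck_on k U (\<lambda>x. h (f x) (g x))"
proof (induction k arbitrary: f g)
  case 0
  then show ?case by (auto intro: bounded_bilinear.continuous_on[OF assms(2)])
next
  case (Suc k)
  show ?case
    by (rule Ck_on_Suc_I[OF assms(1) bounded_bilinear.FDERIV[OF assms(2)
          Ck_on_Suc_has_derivative[OF Suc.prems(1)] Ck_on_Suc_has_derivative[OF Suc.prems(2)]]])
       (use Suc.prems Suc.IH Ck_on_SucD[OF Suc.prems(1)] Ck_on_SucD[OF Suc.prems(2)] in
         \<open>auto intro!: Ck_on_add[OF assms(1)]\<close>)
qed

lemma Ck_on_linear:
  assumes "open U" "bounded_linear h" shows "Ck_on k U h"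
proof (cases k)
  case 0
  then show ?thesis using assms(2) by (simp add: linear_continuous_on)
next
  case (Suc n)
  show ?thesis unfolding Suc
    by (rule Ck_on_Suc_I[OF assms(1) bounded_linear_imp_has_derivative[OF assms(2)] Ck_on_const[OF assms(1)]])
qed

lemma Ck_on_inverse:
  fixes f :: "'a::real_normed_vector \<Rightarrow> real"
  assumes "open U" "\<And>x. x \<in> U \<Longrightarrow> f x \<noteq> 0"
  shows "Ck_on k U f \<Longrightarrow> Ck_on k U (\<lambda>x. inverse (f x))"
proof (induction k)
  case 0
  then show ?case using assms(2) by (auto intro: continuous_on_inverse)
next
  case (Suc k)
  \<comment> \<open>The derivative of \<open>inverse f\<close> contains \<open>inverse f\<close>
    itself, at one order less; the induction hypothesis for the same \<open>f\<close> supplies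
    it.\<close>
  have "Ck_on k U (\<lambda>x. - 1 * (inverse (f x) * frechet_derivative f (at x) v * inverse (f x)))" for v
    using Suc.prems Suc.IH[OF Ck_on_SucD[OF Suc.prems]]
    by (intro Ck_on_bounded_bilinear[OF assms(1) bounded_bilinear_mult] Ck_on_const[OF assms(1)]) auto
  then show ?case
    by (intro Ck_on_Suc_I[OF assms(1) Deriv.has_derivative_inverse[OF assms(2) Ck_on_Suc_has_derivative[OF Suc.prems]]])
       simp_all
qed

lemma Ck_on_frechet:
  "Ck_on (Suc k) U f \<Longrightarrow> Ck_on k U (\<lambda>x. frechet_derivative f (at x) v)"
  by simp

lemma smooth_on_cong:
  "open U \<Longrightarrow> smooth_on U f \<Longrightarrow> (\<And>x. x \<in> U \<Longrightarrow> f x = g x) \<Longrightarrow> smooth_on U g"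
  unfolding smooth_on_def using Ck_on_cong[of U f g] by auto

lemma smooth_on_const: "open U \<Longrightarrow> smooth_on U (\<lambda>_. c)"
  unfolding smooth_on_def by (intro allI Ck_on_const) auto

lemma smooth_on_linear: "open U \<Longrightarrow> bounded_linear h \<Longrightarrow> smooth_on U h"
  unfolding smooth_on_def by (intro allI Ck_on_linear) auto

lemma smooth_on_ident: "open U \<Longrightarrow> smooth_on U (\<lambda>x. x)"
  by (rule smooth_on_linear) auto

lemma smooth_on_add: "open U \<Longrightarrow> smooth_on U f \<Longrightarrow> smooth_on U g \<Longrightarrow> smooth_on U (\<lambda>x. f x + g x)"
  unfolding smooth_on_def by (intro allI Ck_on_add) auto

lemma smooth_on_scaleR:
  "open U \<Longrightarrow> smooth_on U f \<Longrightarrow> smooth_on U g \<Longrightarrow> smooth_on U (\<lambda>x. f x *\<^sub>R g x)"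
  unfolding smooth_on_def by (intro allI Ck_on_bounded_bilinear[OF _ bounded_bilinear_scaleR]) auto

lemma smooth_on_mult:
  fixes f g :: "'a::real_normed_vector \<Rightarrow> 'b::real_normed_algebra"
  shows "open U \<Longrightarrow> smooth_on U f \<Longrightarrow> smooth_on U g \<Longrightarrow> smooth_on U (\<lambda>x. f x * g x)"
  unfolding smooth_on_def by (intro allI Ck_on_bounded_bilinear[OF _ bounded_bilinear_mult]) auto

lemma smooth_on_inner:
  fixes f g :: "'a::real_normed_vector \<Rightarrow> 'b::real_inner"
  shows "open U \<Longrightarrow> smooth_on U f \<Longrightarrow> smooth_on U g \<Longrightarrow> smooth_on U (\<lambda>x. f x \<bullet> g x)"
  unfolding smooth_on_def by (intro allI Ck_on_bounded_bilinear[OF _ bounded_bilinear_inner]) auto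

lemma smooth_on_minus: "open U \<Longrightarrow> smooth_on U f \<Longrightarrow> smooth_on U (\<lambda>x. - f x)"
  using smooth_on_scaleR[OF _ smooth_on_const[of U "- 1 :: real"], of f] by simp

lemma smooth_on_diff: "open U \<Longrightarrow> smooth_on U f \<Longrightarrow> smooth_on U g \<Longrightarrow> smooth_on U (\<lambda>x. f x - g x)"
  using smooth_on_add[OF _ _ smooth_on_minus, of U f g] by simp

lemma smooth_on_sum:
  assumes "open U" "\<And>i. i \<in> I \<Longrightarrow> smooth_on U (f i)"
  shows "smooth_on U (\<lambda>x. \<Sum>i\<in>I. f i x)"
  using assms(2)
  by (induction I rule: infinite_finite_induct)
     (auto intro!: smooth_on_const smooth_on_add assms(1))

lemma smooth_on_power:
  fixes f :: "'a::real_normed_vector \<Rightarrow> real"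
  shows "open U \<Longrightarrow> smooth_on U f \<Longrightarrow> smooth_on U (\<lambda>x. f x ^ n)"
  by (induction n) (auto intro!: smooth_on_const smooth_on_mult)

lemma smooth_on_inverse:
  fixes f :: "'a::real_normed_vector \<Rightarrow> real"
  shows "open U \<Longrightarrow> smooth_on U f \<Longrightarrow> (\<And>x. x \<in> U \<Longrightarrow> f x \<noteq> 0) \<Longrightarrow> smooth_on U (\<lambda>x. inverse (f x))"
  unfolding smooth_on_def by (intro allI Ck_on_inverse) auto

lemma smooth_on_has_derivative:
  "smooth_on U f \<Longrightarrow> x \<in> U \<Longrightarrow> (f has_derivative frechet_derivative f (at x)) (at x)"
  unfolding smooth_on_def using Ck_on_Suc_has_derivative[of 0 U f x] by blast

lemma smooth_on_differentiable: "smooth_on U f \<Longrightarrow> x \<in> U \<Longrightarrow> f differentiable at x"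
  using smooth_on_has_derivative unfolding differentiable_def by auto

lemma smooth_on_continuous: "smooth_on U f \<Longrightarrow> continuous_on U f"
  using Ck_on.simps(1)[of U f] unfolding smooth_on_def by auto

lemma smooth_on_frechet: "smooth_on U f \<Longrightarrow> smooth_on U (\<lambda>x. frechet_derivative f (at x) v)"
  unfolding smooth_on_def using Ck_on_frechet[of _ U f v] by auto

lemma frechet_linear:
  assumes "smooth_on U f" "x \<in> U" shows "linear (frechet_derivative f (at x))"
  using linear_frechet_derivative[OF smooth_on_differentiable[OF assms]] .

lemma linear_componentwise_sum:
  fixes f :: "'a::euclidean_space \<Rightarrow> 'b::real_vector"
  assumes "linear f"
  shows "f x = (\<Sum>b\<in>Basis. (x \<bullet> b) *\<^sub>R f b)"
proof -
  have "f x = f (\<Sum>b\<in>Basis. (x \<bullet> b) *\<^sub>R b)"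
    by (simp only: euclidean_representation)
  also have "\<dots> = (\<Sum>b\<in>Basis. (x \<bullet> b) *\<^sub>R f b)"
    by (simp only: linear_sum[OF assms] linear_cmul[OF assms])
  finally show ?thesis .
qed

text \<open>\<open>Ck_on\<close> differentiates in constant directions only; a variable direction
  \<open>X x\<close> is expanded in the basis, where its coordinates become smooth
  coefficients.\<close>

lemma smooth_on_frechet_field:
  fixes Y :: "real ^ 'n::finite \<Rightarrow> 'b::real_normed_vector"
  assumes "open U" "smooth_on U X" "smooth_on U Y"
  shows "smooth_on U (\<lambda>x. frechet_derivative Y (at x) (X x))"
proof -
  have 1: "smooth_on U (\<lambda>x. (X x \<bullet> b) *\<^sub>R frechet_derivative Y (at x) b)" for b
    by (rule smooth_on_scaleR[OF assms(1) smooth_on_inner[OF assms(1,2) smooth_on_const[OF assms(1)]]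
          smooth_on_frechet[OF assms(3)]])
  have 2: "(\<Sum>b\<in>Basis. (X x \<bullet> b) *\<^sub>R frechet_derivative Y (at x) b) = frechet_derivative Y (at x) (X x)"
    if "x \<in> U" for x
    using linear_componentwise_sum[OF frechet_linear[OF assms(3) that], of "X x"] by simp
  show ?thesis
    by (rule smooth_on_cong[OF assms(1) smooth_on_sum[OF assms(1) 1] 2])
qed

text \<open>One half of Young's theorem. The mean value theorem in direction \<open>u\<close> turns
  the second difference into a first difference, in direction \<open>v\<close>, of the derivative
  along \<open>u\<close>, and differentiability of that derivative at \<open>x\<close> gives the
  limit. No second derivative away from \<open>x\<close> enters.\<close>

lemma second_difference_tendsto:
  fixes f :: "'a::real_normed_vector \<Rightarrow> real"
  assumes "open U" "x \<in> U" "\<And>y. y \<in> U \<Longrightarrow> f differentiable at y"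
    and L: "((\<lambda>y. frechet_derivative f (at y) u) has_derivative L) (at x)"
  shows "((\<lambda>h. (f (x + h *\<^sub>R u + h *\<^sub>R v) - f (x + h *\<^sub>R u) - f (x + h *\<^sub>R v) + f x) / h\<^sup>2) \<longlongrightarrow> L v) (at_right 0)"
proof (rule tendstoI)
  fix e :: real assume e: "e > 0"
  define D where "D = (\<lambda>y. frechet_derivative f (at y) u)"
  \<comment> \<open>\<open>h * K\<close> strictly bounds the norm of every displacement
    \<open>s u + t v\<close> with \<open>s\<close>, \<open>t\<close> in \<open>[0, h]\<close>; the
    summand 1 keeps \<open>K\<close> positive and the bound strict.\<close>
  define K where "K = 2 * norm u + norm v + 1"
  have K: "K > 0" unfolding K_def by (simp add: add_nonneg_pos)
  interpret L: bounded_linear L using L has_derivative_bounded_linear by blast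
  obtain d where d: "d > 0" "\<And>y. norm (y - x) < d \<Longrightarrow> norm (D y - D x - L (y - x)) \<le> e / (2*K) * norm (y - x)"
    using L[unfolded has_derivative_at_alt] e K unfolding D_def by (auto dest!: spec[of _ "e / (2*K)"])
  obtain d' where d': "d' > 0" "ball x d' \<subseteq> U" using assms(1,2) open_contains_ball by blast
  define d0 where "d0 = min d d' / K"
  have d0: "d0 > 0" using d d' K by (simp add: d0_def)
  have "dist ((f (x + h *\<^sub>R u + h *\<^sub>R v) - f (x + h *\<^sub>R u) - f (x + h *\<^sub>R v) + f x) / h\<^sup>2) (L v) < e"
    if h: "0 < h" "h < d0" for h
  proof -
    have hK: "h * K < d" "h * K < d'" using h K by (auto simp: d0_def field_simps)
    have nb: "norm (s *\<^sub>R u + t *\<^sub>R v) \<le> h * (norm u + norm v)" "h * (norm u + norm v) < h * K"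
      if "0 \<le> s" "s \<le> h" "0 \<le> t" "t \<le> h" for s t
    proof -
      have "norm (s *\<^sub>R u + t *\<^sub>R v) \<le> s * norm u + t * norm v"
        using norm_triangle_ineq[of "s *\<^sub>R u" "t *\<^sub>R v"] that by simp
      also have "\<dots> \<le> h * norm u + h * norm v" using that by (intro add_mono mult_right_mono) auto
      finally show "norm (s *\<^sub>R u + t *\<^sub>R v) \<le> h * (norm u + norm v)" by (simp add: algebra_simps)
      show "h * (norm u + norm v) < h * K"
        using h by (intro mult_strict_left_mono) (auto simp: K_def add_pos_nonneg add_nonneg_pos)
    qed
    have inU: "x + s *\<^sub>R u + t *\<^sub>R v \<in> U" if "0 \<le> s" "s \<le> h" "0 \<le> t" "t \<le> h" for s t
    proof -
      have "dist x (x + s *\<^sub>R u + t *\<^sub>R v) = norm (s *\<^sub>R u + t *\<^sub>R v)"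
        by (metis add.assoc add_diff_cancel_left' dist_commute dist_norm)
      then show ?thesis using nb[OF that] hK d'(2) by (auto simp: subset_iff)
    qed
    define p where "p s = f (x + s *\<^sub>R u + h *\<^sub>R v) - f (x + s *\<^sub>R u)" for s
    have fd: "((\<lambda>s. f (y + s *\<^sub>R u)) has_real_derivative D (y + s *\<^sub>R u)) (at s)" if "y + s *\<^sub>R u \<in> U" for y s
    proof -
      have 1: "(f has_derivative frechet_derivative f (at (y + s *\<^sub>R u))) (at (y + s *\<^sub>R u))"
        using assms(3)[OF that] frechet_derivative_works by blast
      have "((\<lambda>s. f (y + s *\<^sub>R u)) has_derivative (\<lambda>r. frechet_derivative f (at (y + s *\<^sub>R u)) (r *\<^sub>R u))) (at s)"
        by (rule has_derivative_compose[where f="\<lambda>s. y + s *\<^sub>R u" and g=f, OF _ 1]) (auto intro!: derivative_eq_intros)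
      then show ?thesis unfolding has_field_derivative_def D_def
        by (rule has_derivative_eq_rhs)
           (simp add: fun_eq_iff linear_cmul[OF linear_frechet_derivative[OF assms(3)[OF that]]])
    qed
    have "(p has_real_derivative D (x + s *\<^sub>R u + h *\<^sub>R v) - D (x + s *\<^sub>R u)) (at s)" if "0 \<le> s" "s \<le> h" for s
      unfolding p_def
      using DERIV_diff[OF fd[of "x + h *\<^sub>R v" s] fd[of x s]] inU[OF that, of h] inU[OF that, of 0] h
      by (simp add: algebra_simps)
    then obtain s where s: "0 < s" "s < h" "p h - p 0 = (h - 0) * (D (x + s *\<^sub>R u + h *\<^sub>R v) - D (x + s *\<^sub>R u))"
      using MVT2[of 0 h p "\<lambda>s. D (x + s *\<^sub>R u + h *\<^sub>R v) - D (x + s *\<^sub>R u)"] h by auto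
    \<comment> \<open>The difference of \<open>D\<close> needed here is between two points near
      \<open>x\<close>, hence involves two remainders; each is below \<open>e * h / 2\<close>, which
      is why the tolerance was \<open>e / (2*K)\<close>.\<close>
    define R where "R z = D (x + z) - D x - L z" for z
    have R: "\<bar>R z\<bar> \<le> e / (2*K) * (h * (norm u + norm v))" if "norm z \<le> h * (norm u + norm v)" for z
    proof -
      have "norm z < d" using that nb(2)[of 0 0] h hK(1) by linarith
      then have "\<bar>R z\<bar> \<le> e / (2*K) * norm z" using d(2)[of "x + z"] by (simp add: R_def)
      also have "\<dots> \<le> e / (2*K) * (h * (norm u + norm v))" using that e K by (intro mult_left_mono) auto
      finally show ?thesis .
    qed
    have eq: "D (x + s *\<^sub>R u + h *\<^sub>R v) - D (x + s *\<^sub>R u) = h * L v + R (s *\<^sub>R u + h *\<^sub>R v) - R (s *\<^sub>R u)"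
      by (simp add: R_def L.add L.scaleR algebra_simps)
    have "\<bar>R (s *\<^sub>R u + h *\<^sub>R v) - R (s *\<^sub>R u)\<bar> \<le> 2 * (e / (2*K) * (h * (norm u + norm v)))"
    proof -
      have "\<bar>R (s *\<^sub>R u + h *\<^sub>R v)\<bar> \<le> e / (2*K) * (h * (norm u + norm v))"
        by (rule R[OF nb(1)]) (use s h in auto)
      moreover have "\<bar>R (s *\<^sub>R u)\<bar> \<le> e / (2*K) * (h * (norm u + norm v))"
        by (rule R) (use nb(1)[of s 0] s h in auto)
      ultimately show ?thesis by linarith
    qed
    also have "\<dots> < 2 * (e / (2*K) * (h * K))"
      using nb(2)[of 0 0] h e K by (intro mult_strict_left_mono) (auto simp: divide_pos_pos)
    also have "\<dots> = e * h" using K by simp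
    finally have "\<bar>D (x + s *\<^sub>R u + h *\<^sub>R v) - D (x + s *\<^sub>R u) - h * L v\<bar> < e * h" using eq by simp
    then have *: "\<bar>(p h - p 0) / h - h * L v\<bar> < e * h" using s(3) h by simp
    have "(p h - p 0) / h\<^sup>2 - L v = ((p h - p 0) / h - h * L v) / h"
      using h by (simp add: field_simps power2_eq_square)
    then have "\<bar>(p h - p 0) / h\<^sup>2 - L v\<bar> < e" using * h by (simp add: abs_divide pos_divide_less_eq)
    moreover have "p h - p 0 = f (x + h *\<^sub>R u + h *\<^sub>R v) - f (x + h *\<^sub>R u) - f (x + h *\<^sub>R v) + f x"
      by (simp add: p_def)
    ultimately show ?thesis by (simp add: dist_real_def)
  qed
  then show "\<forall>\<^sub>F h in at_right 0. dist ((f (x + h *\<^sub>R u + h *\<^sub>R v) - f (x + h *\<^sub>R u) - f (x + h *\<^sub>R v) + f x) / h\<^sup>2) (L v) < e"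
    using d0 by (auto simp: eventually_at_right_field)
qed

text \<open>The second difference is symmetric in \<open>u\<close> and \<open>v\<close>, while its
  limit can be computed through either mixed derivative.\<close>

lemma frechet_derivative_commute:
  fixes f :: "'a::real_normed_vector \<Rightarrow> real"
  assumes "open U" "smooth_on U f" "x \<in> U"
  shows "frechet_derivative (\<lambda>y. frechet_derivative f (at y) u) (at x) v =
         frechet_derivative (\<lambda>y. frechet_derivative f (at y) v) (at x) u"
proof -
  have d: "f differentiable at y" if "y \<in> U" for y using smooth_on_differentiable[OF assms(2) that] .
  have L: "((\<lambda>y. frechet_derivative f (at y) w) has_derivative
     frechet_derivative (\<lambda>y. frechet_derivative f (at y) w) (at x)) (at x)" for w
    by (rule smooth_on_has_derivative[OF smooth_on_frechet[OF assms(2)] assms(3)])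
  have eq: "f (x + h *\<^sub>R u + h *\<^sub>R v) - f (x + h *\<^sub>R u) - f (x + h *\<^sub>R v) + f x =
      f (x + h *\<^sub>R v + h *\<^sub>R u) - f (x + h *\<^sub>R v) - f (x + h *\<^sub>R u) + f x" for h
    by (simp add: algebra_simps)
  show ?thesis
    by (rule tendsto_unique[OF _ second_difference_tendsto[OF assms(1,3) d L, of u v]
          second_difference_tendsto[OF assms(1,3) d L, of v u, folded eq]]) simp_all
qed

section \<open>Connections and their Christoffel symbols\<close>

text \<open>The general torsion-free connection projectively equivalent to \<open>D\<close>, in
  Weyl's form: \<open>D\<close> plus the symmetric tensor built from a one-form. The one-form is
  represented by the vector field \<open>A\<close> through the inner product.\<close>

definition projective_connection :: "('n::finite) field \<Rightarrow> 'n connection" where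
  "projective_connection A X Y x =
     frechet_derivative Y (at x) (X x) + (A x \<bullet> X x) *\<^sub>R Y x + (A x \<bullet> Y x) *\<^sub>R X x"

lemma frechet_derivative_add:
  "f differentiable at x \<Longrightarrow> g differentiable at x \<Longrightarrow>
   frechet_derivative (\<lambda>y. f y + g y) (at x) v = frechet_derivative f (at x) v + frechet_derivative g (at x) v"
  by (simp add: frechet_derivative_eqI[OF has_derivative_add[OF frechet_derivative_works[THEN iffD1] frechet_derivative_works[THEN iffD1]]])

lemma frechet_derivative_scaleR:
  "f differentiable at x \<Longrightarrow> g differentiable at x \<Longrightarrow>
   frechet_derivative (\<lambda>y. f y *\<^sub>R g y) (at x) v =
     f x *\<^sub>R frechet_derivative g (at x) v + frechet_derivative f (at x) v *\<^sub>R g x"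
  by (simp add: frechet_derivative_eqI[OF has_derivative_scaleR[OF frechet_derivative_works[THEN iffD1] frechet_derivative_works[THEN iffD1]]])

lemma frechet_derivative_inner:
  "f differentiable at x \<Longrightarrow> g differentiable at x \<Longrightarrow>
   frechet_derivative (\<lambda>y. f y \<bullet> g y) (at x) v =
     f x \<bullet> frechet_derivative g (at x) v + frechet_derivative f (at x) v \<bullet> g x"
  by (simp add: frechet_derivative_eqI[OF has_derivative_inner[OF frechet_derivative_works[THEN iffD1] frechet_derivative_works[THEN iffD1]]])

lemma affine_connection_projective:
  assumes U: "open U" and A: "smooth_on U A"
  shows "affine_connection U (projective_connection A)"
  unfolding affine_connection_def
proof (intro conjI allI impI ballI)
  fix X Y :: "'a field" assume "smooth_on U X" "smooth_on U Y"
  then have "smooth_on U (\<lambda>x. frechet_derivative Y (at x) (X x) + (A x \<bullet> X x) *\<^sub>R Y x + (A x \<bullet> Y x) *\<^sub>R X x)"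
    by (auto intro!: smooth_on_add[OF U] smooth_on_frechet_field[OF U] smooth_on_scaleR[OF U]
        smooth_on_inner[OF U A])
  then show "smooth_on U (projective_connection A X Y)"
    unfolding projective_connection_def[abs_def] .
next
  fix X X' Y :: "'a field" and x
  assume "smooth_on U Y" "x \<in> U"
  then show "projective_connection A (\<lambda>y. X y + X' y) Y x = projective_connection A X Y x + projective_connection A X' Y x"
    using linear_add[OF frechet_linear[of U Y x]]
    by (simp add: projective_connection_def inner_add_right algebra_simps)
next
  fix f :: "real ^ 'a \<Rightarrow> real" and X Y :: "'a field" and x
  assume "smooth_on U Y" "x \<in> U"
  then show "projective_connection A (\<lambda>y. f y *\<^sub>R X y) Y x = f x *\<^sub>R projective_connection A X Y x"
    using linear_cmul[OF frechet_linear[of U Y x]]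
    by (simp add: projective_connection_def algebra_simps)
next
  fix X Y Y' :: "'a field" and x
  assume "smooth_on U Y" "smooth_on U Y'" "x \<in> U"
  then show "projective_connection A X (\<lambda>y. Y y + Y' y) x = projective_connection A X Y x + projective_connection A X Y' x"
    by (simp add: projective_connection_def frechet_derivative_add smooth_on_differentiable inner_add_right algebra_simps)
next
  fix f :: "real ^ 'a \<Rightarrow> real" and X Y :: "'a field" and x
  assume "smooth_on U f" "smooth_on U Y" "x \<in> U"
  then show "projective_connection A X (\<lambda>y. f y *\<^sub>R Y y) x =
      frechet_derivative f (at x) (X x) *\<^sub>R Y x + f x *\<^sub>R projective_connection A X Y x"
    by (simp add: projective_connection_def frechet_derivative_scaleR smooth_on_differentiable algebra_simps)
qed

lemma torsion_free_projective: "torsion_free U (projective_connection A)"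
  unfolding torsion_free_def lie_bracket_def projective_connection_def by simp

lemma christoffel_projective:
  "christoffel (projective_connection A) x u v = (A x \<bullet> u) *\<^sub>R v + (A x \<bullet> v) *\<^sub>R u"
  by (simp add: christoffel_def projective_connection_def)

section \<open>Recovering a connection from its Christoffel symbols\<close>

lemma affine_connectionD:
  assumes "affine_connection U nabla" "x \<in> U" "smooth_on U X" "smooth_on U Y"
  shows "smooth_on U X' \<Longrightarrow> nabla (\<lambda>y. X y + X' y) Y x = nabla X Y x + nabla X' Y x"
    and "smooth_on U Y' \<Longrightarrow> nabla X (\<lambda>y. Y y + Y' y) x = nabla X Y x + nabla X Y' x"
    and "smooth_on U f \<Longrightarrow> nabla (\<lambda>y. f y *\<^sub>R X y) Y x = f x *\<^sub>R nabla X Y x"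
    and "smooth_on U f \<Longrightarrow> nabla X (\<lambda>y. f y *\<^sub>R Y y) x =
           frechet_derivative f (at x) (X x) *\<^sub>R Y x + f x *\<^sub>R nabla X Y x"
  using assms unfolding affine_connection_def by auto

lemma affine_connection_sum_left:
  assumes "affine_connection U nabla" "open U" "smooth_on U Y" "x \<in> U" "finite I"
    and "\<And>i. i \<in> I \<Longrightarrow> smooth_on U (f i :: _ \<Rightarrow> real)" "\<And>i. i \<in> I \<Longrightarrow> smooth_on U (X i)"
  shows "nabla (\<lambda>y. \<Sum>i\<in>I. f i y *\<^sub>R X i y) Y x = (\<Sum>i\<in>I. f i x *\<^sub>R nabla (X i) Y x)"
  using assms(5,6,7)
proof (induction I)
  case empty
  \<comment> \<open>Vanishing on the zero field follows from linearity over functions, applied to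
    the zero function.\<close>
  have "nabla (\<lambda>y. 0 *\<^sub>R 0) Y x = 0 *\<^sub>R nabla (\<lambda>_. 0) Y x"
    by (rule affine_connectionD(3)[OF assms(1,4) smooth_on_const[OF assms(2)] assms(3)
          smooth_on_const[OF assms(2)]])
  then show ?case by simp
next
  case (insert j I)
  have 1: "smooth_on U (\<lambda>y. f j y *\<^sub>R X j y)" "smooth_on U (\<lambda>y. \<Sum>i\<in>I. f i y *\<^sub>R X i y)"
    using insert by (auto intro!: smooth_on_sum smooth_on_scaleR assms(2))
  have "nabla (\<lambda>y. f j y *\<^sub>R X j y + (\<Sum>i\<in>I. f i y *\<^sub>R X i y)) Y x =
      nabla (\<lambda>y. f j y *\<^sub>R X j y) Y x + nabla (\<lambda>y. \<Sum>i\<in>I. f i y *\<^sub>R X i y) Y x"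
    by (rule affine_connectionD(1)[OF assms(1,4) 1(1) assms(3) 1(2)])
  also have "nabla (\<lambda>y. f j y *\<^sub>R X j y) Y x = f j x *\<^sub>R nabla (X j) Y x"
    by (rule affine_connectionD(3)[OF assms(1,4) _ assms(3)]) (use insert.prems in auto)
  finally show ?case using insert by simp
qed

lemma affine_connection_sum_right:
  assumes "affine_connection U nabla" "open U" "smooth_on U X" "x \<in> U" "finite I"
    and "\<And>i. i \<in> I \<Longrightarrow> smooth_on U (f i :: _ \<Rightarrow> real)" "\<And>i. i \<in> I \<Longrightarrow> smooth_on U (Y i)"
  shows "nabla X (\<lambda>y. \<Sum>i\<in>I. f i y *\<^sub>R Y i y) x =
     (\<Sum>i\<in>I. frechet_derivative (f i) (at x) (X x) *\<^sub>R Y i x + f i x *\<^sub>R nabla X (Y i) x)"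
  using assms(5,6,7)
proof (induction I)
  case empty
  have z: "smooth_on U (\<lambda>_. 0 :: real)" "smooth_on U (\<lambda>_. 0 :: real ^ 'a)"
    using smooth_on_const[OF assms(2)] by auto
  have "nabla X (\<lambda>y. 0 *\<^sub>R 0) x =
      frechet_derivative (\<lambda>_. 0::real) (at x) (X x) *\<^sub>R 0 + 0 *\<^sub>R nabla X (\<lambda>_. 0) x"
    by (rule affine_connectionD(4)[OF assms(1,4,3) z(2,1)])
  then show ?case by simp
next
  case (insert j I)
  have 1: "smooth_on U (\<lambda>y. f j y *\<^sub>R Y j y)" "smooth_on U (\<lambda>y. \<Sum>i\<in>I. f i y *\<^sub>R Y i y)"
    using insert by (auto intro!: smooth_on_sum smooth_on_scaleR assms(2))
  have "nabla X (\<lambda>y. f j y *\<^sub>R Y j y + (\<Sum>i\<in>I. f i y *\<^sub>R Y i y)) x =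
      nabla X (\<lambda>y. f j y *\<^sub>R Y j y) x + nabla X (\<lambda>y. \<Sum>i\<in>I. f i y *\<^sub>R Y i y) x"
    by (rule affine_connectionD(2)[OF assms(1,4,3) 1])
  also have "nabla X (\<lambda>y. f j y *\<^sub>R Y j y) x =
      frechet_derivative (f j) (at x) (X x) *\<^sub>R Y j x + f j x *\<^sub>R nabla X (Y j) x"
    by (rule affine_connectionD(4)[OF assms(1,4,3)]) (use insert.prems in auto)
  finally show ?case using insert by simp
qed

text \<open>An affine connection is given as an abstract operator on fields. Writing both fields in
  the constant basis fields leaves, besides the derivative of the coordinates of \<open>Y\<close>,
  only values of \<open>nabla\<close> on constant fields; so the value at \<open>x\<close> depends
  on \<open>X\<close> only through \<open>X x\<close>.\<close>

lemma affine_connection_expand: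
  assumes "affine_connection U nabla" "open U" "smooth_on U X" "smooth_on U Y" "x \<in> U"
  shows "nabla X Y x = frechet_derivative Y (at x) (X x) +
     (\<Sum>b\<in>Basis. (Y x \<bullet> b) *\<^sub>R (\<Sum>c\<in>Basis. (X x \<bullet> c) *\<^sub>R christoffel nabla x c b))"
proof -
  have sm: "smooth_on U (\<lambda>y. Z y \<bullet> b)" if "smooth_on U Z" for Z :: "'a field" and b
    by (rule smooth_on_inner[OF assms(2) that smooth_on_const[OF assms(2)]])
  have 1: "nabla X (\<lambda>y. \<Sum>b\<in>Basis. (Y y \<bullet> b) *\<^sub>R b) x =
    (\<Sum>b\<in>Basis. frechet_derivative (\<lambda>y. Y y \<bullet> b) (at x) (X x) *\<^sub>R b + (Y x \<bullet> b) *\<^sub>R nabla X (\<lambda>_. b) x)"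
    by (rule affine_connection_sum_right[OF assms(1,2,3,5) finite_Basis sm[OF assms(4)] smooth_on_const[OF assms(2)]])
  have Y: "(\<lambda>y. \<Sum>b\<in>Basis. (Y y \<bullet> b) *\<^sub>R b) = Y" and X: "(\<lambda>y. \<Sum>b\<in>Basis. (X y \<bullet> b) *\<^sub>R b) = X"
    by (simp_all add: euclidean_representation)
  have 2: "frechet_derivative (\<lambda>y. Y y \<bullet> b) (at x) (X x) = frechet_derivative Y (at x) (X x) \<bullet> b" for b
    using smooth_on_differentiable[OF assms(4,5)] by (simp add: frechet_derivative_inner)
  have 3: "nabla (\<lambda>y. \<Sum>c\<in>Basis. (X y \<bullet> c) *\<^sub>R c) (\<lambda>_. b) x =
      (\<Sum>c\<in>Basis. (X x \<bullet> c) *\<^sub>R nabla (\<lambda>_. c) (\<lambda>_. b) x)" for b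
    by (rule affine_connection_sum_left[OF assms(1,2) smooth_on_const[OF assms(2)] assms(5) finite_Basis
          sm[OF assms(3)] smooth_on_const[OF assms(2)]])
  have 4: "nabla X (\<lambda>_. b) x = (\<Sum>c\<in>Basis. (X x \<bullet> c) *\<^sub>R christoffel nabla x c b)" for b
    using 3[of b] unfolding X christoffel_def .
  show ?thesis
    using 1 unfolding Y 2 4 sum.distrib euclidean_representation .
qed

lemma christoffel_expand:
  assumes "affine_connection U nabla" "open U" "x \<in> U"
  shows "christoffel nabla x u v = (\<Sum>b\<in>Basis. (v \<bullet> b) *\<^sub>R (\<Sum>c\<in>Basis. (u \<bullet> c) *\<^sub>R christoffel nabla x c b))"
  unfolding christoffel_def[of nabla x u v]
  using affine_connection_expand[OF assms(1,2) smooth_on_const[OF assms(2)] smooth_on_const[OF assms(2)] assms(3), of u v]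
  by simp

lemma affine_connection_christoffel:
  assumes "affine_connection U nabla" "open U" "smooth_on U X" "smooth_on U Y" "x \<in> U"
  shows "nabla X Y x = frechet_derivative Y (at x) (X x) + christoffel nabla x (X x) (Y x)"
  using affine_connection_expand[OF assms] christoffel_expand[OF assms(1,2,5)] by metis

lemma bilinear_christoffel:
  assumes "affine_connection U nabla" "open U" "x \<in> U"
  shows "bilinear (christoffel nabla x)"
proof -
  define B where "B u v = (\<Sum>b\<in>Basis. (v \<bullet> b) *\<^sub>R (\<Sum>c\<in>Basis. (u \<bullet> c) *\<^sub>R christoffel nabla x c b))" for u v
  have "bilinear B"
    unfolding bilinear_def
    by (intro conjI allI linearI; simp only: B_def inner_add_left scaleR_add_left scaleR_add_right
        sum.distrib inner_scaleR_left scaleR_sum_right distrib_left distrib_right scaleR_scaleR mult.left_commute mult.assoc mult.commute)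
  also have "B = christoffel nabla x"
    by (intro ext) (simp only: B_def christoffel_expand[OF assms, symmetric])
  finally show ?thesis .
qed

lemma smooth_on_christoffel:
  assumes "affine_connection U nabla" "open U"
  shows "smooth_on U (\<lambda>x. christoffel nabla x u v)"
proof -
  have "smooth_on U (nabla (\<lambda>_. u) (\<lambda>_. v))"
    using conjunct1[OF assms(1)[unfolded affine_connection_def]]
      smooth_on_const[OF assms(2), of u] smooth_on_const[OF assms(2), of v] by blast
  then show ?thesis unfolding christoffel_def by simp
qed

lemma christoffel_commute:
  assumes "torsion_free U nabla" "open U" "x \<in> U"
  shows "christoffel nabla x u v = christoffel nabla x v u"
  using assms(1)[unfolded torsion_free_def] assms(3) smooth_on_const[OF assms(2)]
  by (fastforce simp: christoffel_def lie_bracket_def)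

text \<open>If every vector is an eigenvector of the quadratic map, the eigenvalue
  \<open>2 * l b\<close> is linear in \<open>b\<close>. For independent \<open>u\<close>,
  \<open>v\<close> this comes from comparing coefficients in the values at \<open>u + v\<close> and
  \<open>u - v\<close>; for dependent ones, from homogeneity. At \<open>b = 0\<close> the quotient
  defining \<open>l\<close> is 0 by the convention on division, as homogeneity demands.\<close>

lemma symmetric_bilinear_diagonal:
  fixes S :: "'a::euclidean_space \<Rightarrow> 'a \<Rightarrow> 'a"
  assumes S: "bilinear S" and sym: "\<And>u v. S u v = S v u" and diag: "\<And>b. \<exists>l. S b b = l *\<^sub>R b"
  defines "l \<equiv> \<lambda>b. (S b b \<bullet> b) / (2 * (b \<bullet> b))"
  shows "linear l" "S u v = l u *\<^sub>R v + l v *\<^sub>R u"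
proof -
  have d: "S b b = (2 * l b) *\<^sub>R b" for b
    using diag[of b] bilinear_lzero[OF S, of 0] by (auto simp: l_def)
  have hom: "l (r *\<^sub>R b) = r * l b" for r b
    by (simp add: l_def bilinear_lmul[OF S] bilinear_rmul[OF S])
  have indep: "l (u + v) = l u + l v \<and> S u v = l u *\<^sub>R v + l v *\<^sub>R u"
    if ind: "\<And>a b. a *\<^sub>R u + b *\<^sub>R v = 0 \<Longrightarrow> a = 0 \<and> b = 0" for u v
  proof -
    have p: "(2 * l (u + v)) *\<^sub>R (u + v) = (2 * l u) *\<^sub>R u + (2 * l v) *\<^sub>R v + 2 *\<^sub>R S u v"
      unfolding d[symmetric] using sym[of v u]
      by (simp add: bilinear_ladd[OF S] bilinear_radd[OF S] scaleR_2)
    have m: "(2 * l (u - v)) *\<^sub>R (u - v) = (2 * l u) *\<^sub>R u + (2 * l v) *\<^sub>R v - 2 *\<^sub>R S u v"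
      unfolding d[symmetric] using sym[of v u]
      by (simp add: bilinear_lsub[OF S] bilinear_rsub[OF S] scaleR_2)
    \<comment> \<open>Adding the two values eliminates \<open>S u v\<close>. Independence then gives
      two scalar equations, whose sum is the additivity of \<open>l\<close>.\<close>
    have "(2 * l (u + v)) *\<^sub>R (u + v) + (2 * l (u - v)) *\<^sub>R (u - v) = (4 * l u) *\<^sub>R u + (4 * l v) *\<^sub>R v"
      unfolding p m by (simp add: algebra_simps flip: scaleR_add_left)
    then have "(2 * l (u + v) + 2 * l (u - v) - 4 * l u) *\<^sub>R u + (2 * l (u + v) - 2 * l (u - v) - 4 * l v) *\<^sub>R v = 0"
      by (simp add: algebra_simps)
    from ind[OF this] have e: "l (u + v) = l u + l v" by simp
    moreover have "2 *\<^sub>R S u v = 2 *\<^sub>R (l u *\<^sub>R v + l v *\<^sub>R u)"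
      using p unfolding e by (simp add: algebra_simps)
    then have "S u v = l u *\<^sub>R v + l v *\<^sub>R u" by simp
    ultimately show ?thesis by simp
  qed
  have both: "l (u + v) = l u + l v \<and> S u v = l u *\<^sub>R v + l v *\<^sub>R u" for u v
  proof (cases "\<forall>a b. a *\<^sub>R u + b *\<^sub>R v = 0 \<longrightarrow> a = 0 \<and> b = 0")
    case True
    then show ?thesis using indep by blast
  next
    case False
    then obtain a b where ab: "a *\<^sub>R u + b *\<^sub>R v = 0" "a \<noteq> 0 \<or> b \<noteq> 0" by blast
    have "\<exists>w r s. u = r *\<^sub>R w \<and> v = s *\<^sub>R w"
    proof (cases "a = 0")
      case True
      then have "v = 0" using ab by simp
      then show ?thesis by (intro exI[of _ u] exI[of _ 1] exI[of _ 0]) simp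
    next
      case False
      have "u = (- b / a) *\<^sub>R v"
      proof -
        have "a *\<^sub>R u = - (b *\<^sub>R v)" using ab(1) by (simp add: eq_neg_iff_add_eq_0)
        then have "(1 / a) *\<^sub>R (a *\<^sub>R u) = (1 / a) *\<^sub>R (- (b *\<^sub>R v))" by simp
        then show ?thesis using False by simp
      qed
      then show ?thesis by (intro exI[of _ v] exI[of _ "- b / a"] exI[of _ 1]) simp
    qed
    then obtain w r s where w: "u = r *\<^sub>R w" "v = s *\<^sub>R w" by blast
    have "l (u + v) = l u + l v"
      unfolding w using hom[of "r + s" w] hom by (simp add: algebra_simps)
    moreover have "S u v = l u *\<^sub>R v + l v *\<^sub>R u"
      unfolding w by (simp add: hom bilinear_lmul[OF S] bilinear_rmul[OF S] d algebra_simps flip: scaleR_add_left)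
    ultimately show ?thesis by blast
  qed
  show "linear l" using both hom by (auto intro: linearI)
  show "S u v = l u *\<^sub>R v + l v *\<^sub>R u" using both by blast
qed

section \<open>Connections sharing the straight lines\<close>

lemma geodesic_on_standard_line:
  assumes "open I" "is_interval I" "I \<noteq> {}" "\<And>s. s \<in> I \<Longrightarrow> x + s *\<^sub>R b \<in> U"
  shows "geodesic_on U standard_connection I (\<lambda>s. x + s *\<^sub>R b)"
proof -
  have vd: "((\<lambda>s. x + s *\<^sub>R b) has_vector_derivative b) (at t)" for t
    by (auto intro!: derivative_eq_intros)
  have eq: "(\<lambda>s. vector_derivative (\<lambda>s. x + s *\<^sub>R b) (at s)) = (\<lambda>s. b)"
    using vector_derivative_at[OF vd] by blast
  show ?thesis
    unfolding geodesic_on_def parallel_at_def eq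
    using assms vd by (auto simp: christoffel_def standard_connection_def differentiableI_vector)
qed

text \<open>The line through \<open>x\<close> in direction \<open>b\<close> becomes a geodesic of
  \<open>nabla\<close> after a change of time \<phi>. Its velocity stays on the line spanned by
  \<open>b\<close>, hence so does its acceleration, which the geodesic equation identifies with
  \<open>- (deriv \<phi>)^2\<close> times \<Gamma>(b, b).\<close>

lemma christoffel_diagonal:
  assumes "affine_connection U nabla" "open U" "x \<in> U"
    and "same_unparameterized_geodesics U nabla standard_connection"
  shows "\<exists>l. christoffel nabla x b b = l *\<^sub>R b"
proof (cases "b = 0")
  case True
  then show ?thesis using bilinear_lzero[OF bilinear_christoffel[OF assms(1-3)]] by simp
next
  case False
  obtain d where d: "d > 0" "ball x d \<subseteq> U" using assms(2,3) open_contains_ball by blast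
  define I where "I = {- (d / norm b) <..< d / norm b}"
  have inU: "x + s *\<^sub>R b \<in> U" if "s \<in> I" for s
  proof -
    have "\<bar>s\<bar> * norm b < d" using that False by (auto simp: I_def field_simps abs_if)
    then show ?thesis using d(2) by (auto simp: subset_iff dist_norm)
  qed
  have "geodesic_on U standard_connection I (\<lambda>s. x + s *\<^sub>R b)"
    using inU d(1) False
    by (intro geodesic_on_standard_line) (auto simp: I_def is_interval_oo not_le zero_less_divide_iff)
  then obtain J k \<phi> where J: "geodesic_on U nabla J k" and
    \<phi>: "bij_betw \<phi> J I" "smooth_on J \<phi>" "\<And>t. t \<in> J \<Longrightarrow> deriv \<phi> t \<noteq> 0 \<and> k t = x + \<phi> t *\<^sub>R b"
    using assms(4) unfolding same_unparameterized_geodesics_def reparametrization_def by blast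
  have oJ: "open J" using J by (simp add: geodesic_on_def)
  have "0 \<in> I" using d False by (simp add: I_def)
  then obtain t where t: "t \<in> J" "\<phi> t = 0" using \<phi>(1) by (metis bij_betw_iff_bijections)
  have vk: "vector_derivative k (at s) = deriv \<phi> s *\<^sub>R b" if "s \<in> J" for s
  proof -
    have "(\<phi> has_real_derivative deriv \<phi> s) (at s)"
      using smooth_on_differentiable[OF \<phi>(2) that] by (simp add: DERIV_deriv_iff_real_differentiable)
    then have "((\<lambda>s. x + \<phi> s *\<^sub>R b) has_vector_derivative deriv \<phi> s *\<^sub>R b) (at s)"
      by (auto intro!: derivative_eq_intros)
    then have "(k has_vector_derivative deriv \<phi> s *\<^sub>R b) (at s)"
      by (rule has_vector_derivative_transform_within_open[OF _ oJ that]) (use \<phi>(3) in auto)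
    then show ?thesis by (rule vector_derivative_at)
  qed
  define G where "G = christoffel nabla x b b"
  define p where "p = deriv \<phi> t"
  have "p \<noteq> 0" using \<phi>(3)[OF t(1)] p_def by simp
  have "parallel_at nabla k (\<lambda>s. vector_derivative k (at s)) t" using J t by (simp add: geodesic_on_def)
  then have D: "((\<lambda>s. vector_derivative k (at s)) has_vector_derivative - (p\<^sup>2 *\<^sub>R G)) (at t)"
    unfolding parallel_at_def using \<phi>(3)[OF t(1)] t(2) vk[OF t(1)]
    by (simp add: G_def p_def bilinear_lmul[OF bilinear_christoffel[OF assms(1-3)]]
        bilinear_rmul[OF bilinear_christoffel[OF assms(1-3)]] power2_eq_square)
  \<comment> \<open>Pairing with \<open>w\<close> orthogonal to \<open>b\<close> makes the velocity
    vanish identically, so its derivative is 0 and the second derivative of \<phi> never has to be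
    computed.\<close>
  have orth: "G \<bullet> w = 0" if "b \<bullet> w = 0" for w
  proof -
    have "((\<lambda>s. vector_derivative k (at s) \<bullet> w) has_vector_derivative - (p\<^sup>2 *\<^sub>R G) \<bullet> w) (at t)"
      using bounded_linear.has_vector_derivative[OF bounded_linear_inner_left D] .
    moreover have "((\<lambda>s. vector_derivative k (at s) \<bullet> w) has_vector_derivative 0) (at t)"
      by (rule has_vector_derivative_transform_within_open[OF has_vector_derivative_const oJ t(1)])
         (simp add: vk that)
    ultimately have "- (p\<^sup>2 *\<^sub>R G) \<bullet> w = 0" using vector_derivative_unique_at by blast
    then show ?thesis using \<open>p \<noteq> 0\<close> by simp
  qed
  define w where "w = G - ((G \<bullet> b) / (b \<bullet> b)) *\<^sub>R b"
  have "b \<bullet> w = 0" using False by (simp add: w_def inner_diff_right inner_commute)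
  then have "w \<bullet> w = 0" using orth[of w] by (simp add: w_def inner_diff_left inner_commute)
  then have "G = ((G \<bullet> b) / (b \<bullet> b)) *\<^sub>R b" by (simp add: w_def)
  then show ?thesis unfolding G_def by blast
qed

text \<open>Only the Christoffel symbols are prescribed, since transport and geodesics see nothing
  else. The same lemmas then serve the constructed connection, an unknown hybrid connection, and
  \<open>D\<close> itself with \<open>A = 0\<close>.\<close>

definition projective_on :: "(real ^ 'n::finite) set \<Rightarrow> 'n field \<Rightarrow> 'n connection \<Rightarrow> bool" where
  "projective_on U A nabla \<longleftrightarrow>
     (\<forall>x\<in>U. \<forall>u v. christoffel nabla x u v = (A x \<bullet> u) *\<^sub>R v + (A x \<bullet> v) *\<^sub>R u)"

lemma projective_on_projective_connection: "projective_on U A (projective_connection A)"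
  by (simp add: projective_on_def christoffel_projective)

text \<open>Sharing the straight lines forces \<open>\<Gamma>(b, b)\<close> to be parallel to \<open>b\<close>, which determines the shape of \<open>\<Gamma>\<close>.\<close>

lemma projective_on_exists:
  assumes "affine_connection U nabla" "open U" "torsion_free U nabla"
    and "same_unparameterized_geodesics U nabla standard_connection"
  shows "\<exists>A. smooth_on U A \<and> projective_on U A nabla"
proof -
  define l where "l x b = (christoffel nabla x b b \<bullet> b) / (2 * (b \<bullet> b))" for x b
  \<comment> \<open>The vector that represents the linear form \<open>l x\<close>, once linearity is
    known.\<close>
  define A where "A x = (\<Sum>b\<in>Basis. l x b *\<^sub>R b)" for x
  have "smooth_on U (\<lambda>x. l x b *\<^sub>R b)" for b
  proof -
    have "smooth_on U (\<lambda>x. (inverse (2 * (b \<bullet> b)) * (christoffel nabla x b b \<bullet> b)) *\<^sub>R b)"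
      by (rule smooth_on_scaleR[OF assms(2)], rule smooth_on_mult[OF assms(2)], rule smooth_on_const[OF assms(2)],
          rule smooth_on_inner[OF assms(2)], rule smooth_on_christoffel[OF assms(1,2)])
         (rule smooth_on_const[OF assms(2)])+
    then show ?thesis unfolding l_def divide_inverse by (simp only: mult.commute)
  qed
  then have "smooth_on U A" unfolding A_def by (rule smooth_on_sum[OF assms(2)])
  moreover have "projective_on U A nabla"
    unfolding projective_on_def
  proof (intro ballI allI)
    fix x u v assume x: "x \<in> U"
    note s = symmetric_bilinear_diagonal[OF bilinear_christoffel[OF assms(1,2) x]
        christoffel_commute[OF assms(3,2) x] christoffel_diagonal[OF assms(1,2) x assms(4)], folded l_def]
    have "A x \<bullet> w = l x w" for w
      using linear_componentwise_sum[OF s(1), of w] unfolding A_def inner_sum_left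
      by (simp add: inner_commute mult.commute)
    then show "christoffel nabla x u v = (A x \<bullet> u) *\<^sub>R v + (A x \<bullet> v) *\<^sub>R u" using s(2) by simp
  qed
  ultimately show ?thesis by blast
qed

section \<open>Parallel transport\<close>

lemma projective_onD:
  "projective_on U A nabla \<Longrightarrow> x \<in> U \<Longrightarrow>
     christoffel nabla x u v = (A x \<bullet> u) *\<^sub>R v + (A x \<bullet> v) *\<^sub>R u"
  by (simp add: projective_on_def)

lemma vector_derivative_linepath_at: "vector_derivative (linepath p q) (at t) = q - p"
  by (rule vector_derivative_at) (auto simp: linepath_def algebra_simps intro!: derivative_eq_intros)

lemma differentiable_linepath: "linepath p q differentiable at t"
  unfolding linepath_def by (intro derivative_intros)

text \<open>The equation of parallel transport is linear in the velocity of the curve, so both of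
  its sides scale by \<open>m\<close>.\<close>

lemma parallel_at_affine:
  assumes "projective_on U A nabla" "c (m * t + n) \<in> U"
    and "c differentiable at (m * t + n)" "parallel_at nabla c V (m * t + n)"
  shows "parallel_at nabla (\<lambda>s. c (m * s + n)) (\<lambda>s. V (m * s + n)) t"
proof -
  have aff: "((\<lambda>s. m * s + n) has_vector_derivative m) (at t)"
    by (auto intro!: derivative_eq_intros)
  have "((\<lambda>s. c (m * s + n)) has_vector_derivative m *\<^sub>R vector_derivative c (at (m * t + n))) (at t)"
    using vector_diff_chain_at[OF aff, of c] assms(3) unfolding vector_derivative_works o_def .
  moreover have "((\<lambda>s. V (m * s + n)) has_vector_derivative
      m *\<^sub>R (- christoffel nabla (c (m * t + n)) (vector_derivative c (at (m * t + n))) (V (m * t + n)))) (at t)"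
    using vector_diff_chain_at[OF aff, of V] assms(4) unfolding parallel_at_def o_def .
  moreover have "m *\<^sub>R (- christoffel nabla (c (m * t + n)) a b) = - christoffel nabla (c (m * t + n)) (m *\<^sub>R a) b" for a b
    unfolding projective_onD[OF assms(1,2)] by (simp add: algebra_simps)
  ultimately show ?thesis
    unfolding parallel_at_def by (simp only: vector_derivative_at)
qed

lemma parallel_at_cong:
  assumes "open T" "t \<in> T" "\<And>s. s \<in> T \<Longrightarrow> c s = c' s" "\<And>s. s \<in> T \<Longrightarrow> V s = V' s"
    and "parallel_at nabla c V t"
  shows "parallel_at nabla c' V' t"
proof -
  have "(c has_vector_derivative d) (at t) \<longleftrightarrow> (c' has_vector_derivative d) (at t)" for d
    using has_vector_derivative_transform_within_open[OF _ assms(1,2)] assms(3) by metis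
  then have "vector_derivative c (at t) = vector_derivative c' (at t)"
    unfolding vector_derivative_def by simp
  then have "(V has_vector_derivative - christoffel nabla (c' t) (vector_derivative c' (at t)) (V' t)) (at t)"
    using assms by (simp add: parallel_at_def)
  then show ?thesis
    unfolding parallel_at_def
    by (rule has_vector_derivative_transform_within_open[OF _ assms(1,2)]) (rule assms(4))
qed

text \<open>Each half of a joined path is one piece run at double speed, so slowing time by a factor
  2 restores the piece. The finite exceptional set of \<open>parallel_transport\<close> absorbs the
  end points and the times where a piece is not differentiable.\<close>

lemma parallel_transport_joinD:
  assumes "projective_on U A nabla" "path_image c1 \<subseteq> U" "path_image c2 \<subseteq> U"
    and "finite S1" "\<And>t. t \<in> {0..1} - S1 \<Longrightarrow> c1 differentiable at t"
    and "finite S2" "\<And>t. t \<in> {0..1} - S2 \<Longrightarrow> c2 differentiable at t"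
    and "parallel_transport nabla (c1 +++ c2) v z"
  shows "\<exists>w. parallel_transport nabla c1 v w \<and> parallel_transport nabla c2 w z"
proof -
  obtain V S where V: "continuous_on {0..1} V" "finite S" "V 0 = v" "V 1 = z"
    and par: "\<And>t. t \<in> {0..1} - S \<Longrightarrow> parallel_at nabla (c1 +++ c2) V t"
    using assms(8) unfolding parallel_transport_def by blast
  define V1 where "V1 t = V (1/2 * t + 0)" for t
  define V2 where "V2 t = V (1/2 * t + 1/2)" for t
  have "parallel_at nabla c1 V1 t" if t: "t \<in> {0..1} - (S1 \<union> {0,1} \<union> (\<lambda>s. 2 * s) ` S)" for t
  proof -
    have "1/2 * t + 0 \<in> {0..1} - S" using t by (auto simp: image_iff dest: bspec[of S _ "1/2 * t"])
    from par[OF this] have "parallel_at nabla (\<lambda>s. c1 (2 * s)) V (1/2 * t + 0)"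
      by (rule parallel_at_cong[of "{..<1/2}", rotated -1]) (use t in \<open>auto simp: joinpaths_def\<close>)
    then have "parallel_at nabla (\<lambda>s. (\<lambda>s. c1 (2 * s)) (1/2 * s + 0)) (\<lambda>s. V (1/2 * s + 0)) t"
    proof (rule parallel_at_affine[OF assms(1), rotated -1])
      show "c1 (2 * (1 / 2 * t + 0)) \<in> U" using t assms(2) by (auto simp: path_image_def)
      have "c1 differentiable at (2 * (1 / 2 * t + 0))" using assms(5)[of t] t by simp
      then show "(\<lambda>s. c1 (2 * s)) differentiable at (1 / 2 * t + 0)"
        by (rule differentiable_compose[of c1]) (intro derivative_intros)
    qed
    then show ?thesis by (simp add: V1_def[abs_def])
  qed
  then have 1: "parallel_transport nabla c1 v (V (1/2))"
    unfolding parallel_transport_def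
    using V assms(4) by (intro exI[of _ V1] conjI exI[of _ "S1 \<union> {0,1} \<union> (\<lambda>s. 2 * s) ` S"])
      (auto simp: V1_def[abs_def] intro!: continuous_on_compose2[OF V(1)] continuous_intros)
  have "parallel_at nabla c2 V2 t" if t: "t \<in> {0..1} - (S2 \<union> {0,1} \<union> (\<lambda>s. 2 * s - 1) ` S)" for t
  proof -
    have "1/2 * t + 1/2 \<in> {0..1} - S" using t by (auto simp: image_iff field_simps dest: bspec[of S _ "1/2 * t + 1/2"])
    from par[OF this] have "parallel_at nabla (\<lambda>s. c2 (2 * s - 1)) V (1/2 * t + 1/2)"
      by (rule parallel_at_cong[of "{1/2<..}", rotated -1]) (use t in \<open>auto simp: joinpaths_def\<close>)
    then have "parallel_at nabla (\<lambda>s. (\<lambda>s. c2 (2 * s - 1)) (1/2 * s + 1/2)) (\<lambda>s. V (1/2 * s + 1/2)) t"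
    proof (rule parallel_at_affine[OF assms(1), rotated -1])
      show "c2 (2 * (1 / 2 * t + 1/2) - 1) \<in> U" using t assms(3) by (auto simp: path_image_def)
      have "c2 differentiable at (2 * (1 / 2 * t + 1/2) - 1)" using assms(7)[of t] t by simp
      then show "(\<lambda>s. c2 (2 * s - 1)) differentiable at (1 / 2 * t + 1/2)"
        by (rule differentiable_compose[of c2]) (intro derivative_intros)
    qed
    then show ?thesis by (simp add: V2_def[abs_def])
  qed
  then have "parallel_transport nabla c2 (V (1/2)) z"
    unfolding parallel_transport_def
    using V assms(6) by (intro exI[of _ V2] conjI exI[of _ "S2 \<union> {0,1} \<union> (\<lambda>s. 2 * s - 1) ` S"])
      (auto simp: V2_def[abs_def] intro!: continuous_on_compose2[OF V(1)] continuous_intros)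
  with 1 show ?thesis by blast
qed

lemma parallel_transport_joinI:
  assumes "projective_on U A nabla" "path_image c1 \<subseteq> U" "path_image c2 \<subseteq> U"
    and "finite S1" "\<And>t. t \<in> {0..1} - S1 \<Longrightarrow> c1 differentiable at t"
    and "finite S2" "\<And>t. t \<in> {0..1} - S2 \<Longrightarrow> c2 differentiable at t"
    and "parallel_transport nabla c1 v w" "parallel_transport nabla c2 w z"
  shows "parallel_transport nabla (c1 +++ c2) v z"
proof -
  obtain V1 T1 where V1: "continuous_on {0..1} V1" "finite T1" "V1 0 = v" "V1 1 = w"
    and par1: "\<And>t. t \<in> {0..1} - T1 \<Longrightarrow> parallel_at nabla c1 V1 t"
    using assms(8) unfolding parallel_transport_def by blast
  obtain V2 T2 where V2: "continuous_on {0..1} V2" "finite T2" "V2 0 = w" "V2 1 = z"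
    and par2: "\<And>t. t \<in> {0..1} - T2 \<Longrightarrow> parallel_at nabla c2 V2 t"
    using assms(9) unfolding parallel_transport_def by blast
  define R1 where "R1 = (\<lambda>s::real. s / 2) ` (S1 \<union> T1)"
  define R2 where "R2 = (\<lambda>s::real. (s + 1) / 2) ` (S2 \<union> T2)"
  have "path (V1 +++ V2)"
    using V1 V2 by (intro path_join_imp) (auto simp: path_def pathfinish_def pathstart_def)
  then have cont: "continuous_on {0..1} (V1 +++ V2)" by (simp add: path_def)
  have "parallel_at nabla (c1 +++ c2) (V1 +++ V2) t" if t: "t \<in> {0..1} - ({1/2} \<union> R1 \<union> R2)" for t
  proof (cases "t < 1/2")
    case True
    have "2 * t + 0 \<notin> S1 \<union> T1"
    proof
      assume "2 * t + 0 \<in> S1 \<union> T1"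
      then have "(2 * t + 0) / 2 \<in> R1" unfolding R1_def by blast
      then show False using t by simp
    qed
    then have *: "2 * t + 0 \<in> {0..1} - S1" "2 * t + 0 \<in> {0..1} - T1" using t True by auto
    have "parallel_at nabla (\<lambda>s. c1 (2 * s + 0)) (\<lambda>s. V1 (2 * s + 0)) t"
      by (rule parallel_at_affine[OF assms(1) _ assms(5)[OF *(1)] par1[OF *(2)]])
         (use * assms(2) in \<open>auto simp: path_image_def\<close>)
    then show ?thesis
      by (rule parallel_at_cong[of "{..<1/2}", rotated -1]) (use True in \<open>auto simp: joinpaths_def\<close>)
  next
    case False
    then have t': "t > 1/2" using t by auto
    have "2 * t + - 1 \<notin> S2 \<union> T2"
    proof
      assume "2 * t + - 1 \<in> S2 \<union> T2"
      then have "(2 * t + - 1 + 1) / 2 \<in> R2" unfolding R2_def by blast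
      then show False using t by simp
    qed
    then have *: "2 * t + - 1 \<in> {0..1} - S2" "2 * t + - 1 \<in> {0..1} - T2" using t t' by auto
    have "parallel_at nabla (\<lambda>s. c2 (2 * s + - 1)) (\<lambda>s. V2 (2 * s + - 1)) t"
      by (rule parallel_at_affine[OF assms(1) _ assms(7)[OF *(1)] par2[OF *(2)]])
         (use * assms(3) in \<open>auto simp: path_image_def\<close>)
    then show ?thesis
      by (rule parallel_at_cong[of "{1/2<..}", rotated -1]) (use t' in \<open>auto simp: joinpaths_def\<close>)
  qed
  moreover have "finite ({1/2} \<union> R1 \<union> R2)"
    using V1 V2 assms(4,6) by (simp add: R1_def R2_def)
  ultimately show ?thesis
    unfolding parallel_transport_def
    using cont V1 V2
    by (intro exI[of _ "V1 +++ V2"] conjI exI[of _ "{1/2} \<union> R1 \<union> R2"]) (auto simp: joinpaths_def)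
qed

text \<open>With constant direction \<open>e\<close> the equation is
  \<open>V' = - (B \<bullet> e) V - (B \<bullet> V) e\<close>. The integrating factor
  \<open>exp (- I)\<close> disposes of the first term, and the second moves \<open>V\<close> only
  along \<open>e\<close>, so that a scalar linear equation for the coefficient \<open>y\<close>
  remains.\<close>

lemma parallel_transport_segment_exists:
  assumes "projective_on U A nabla" "continuous_on U A" "closed_segment p q \<subseteq> U"
  obtains V where "continuous_on {0..1} V" "V 0 = v"
    "\<And>t. t \<in> {0<..<1} \<Longrightarrow> parallel_at nabla (linepath p q) V t"
proof -
  define e where "e = q - p"
  define B where "B t = A (linepath p q t)" for t
  have inU: "linepath p q t \<in> U" if "t \<in> {0..1}" for t
    using assms(3) that by (auto simp: linepath_in_path)
  have cB: "continuous_on {0..1} B"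
    unfolding B_def by (intro continuous_on_compose2[OF assms(2)] continuous_intros) (use inU in auto)
  define I where "I t = integral {0..t} (\<lambda>s. B s \<bullet> e)" for t
  have cBe: "continuous_on {0..1} (\<lambda>s. B s \<bullet> e)" by (intro continuous_intros cB)
  have I: "(I has_vector_derivative B t \<bullet> e) (at t within {0..1})" if "t \<in> {0..1}" for t
    unfolding I_def by (rule integral_has_vector_derivative[OF cBe that])
  have cI: "continuous_on {0..1} I"
    using I by (meson continuous_on_eq_continuous_within has_vector_derivative_continuous)
  define K where "K t = integral {0..t} (\<lambda>s. (B s \<bullet> v) * exp (I s))" for t
  have cBv: "continuous_on {0..1} (\<lambda>s. (B s \<bullet> v) * exp (I s))" by (intro continuous_intros cB cI)
  have K: "(K has_vector_derivative (B t \<bullet> v) * exp (I t)) (at t within {0..1})" if "t \<in> {0..1}" for t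
    unfolding K_def by (rule integral_has_vector_derivative[OF cBv that])
  have cK: "continuous_on {0..1} K"
    using K by (meson continuous_on_eq_continuous_within has_vector_derivative_continuous)
  \<comment> \<open>Variation of constants for
    \<open>y' = - (B \<bullet> v) - (B \<bullet> e) * y\<close> with \<open>y 0 = 0\<close>.\<close>
  define y where "y t = - (exp (- I t) * K t)" for t
  define V where "V t = exp (- I t) *\<^sub>R (v + y t *\<^sub>R e)" for t
  have "continuous_on {0..1} V" unfolding V_def y_def by (intro continuous_intros cI cK)
  moreover have "V 0 = v" by (simp add: V_def y_def I_def K_def)
  moreover have "parallel_at nabla (linepath p q) V t" if t: "t \<in> {0<..<1}" for t
  proof -
    have at: "at t within {0..1} = at t" using t by (intro at_within_interior) auto
    have t01: "t \<in> {0..1}" using t by auto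
    have dI: "(I has_real_derivative B t \<bullet> e) (at t)" and dK: "(K has_real_derivative (B t \<bullet> v) * exp (I t)) (at t)"
      using I[OF t01] K[OF t01] unfolding at by (simp_all add: has_real_derivative_iff_has_vector_derivative)
    have dE: "((\<lambda>t. exp (- I t)) has_real_derivative - (B t \<bullet> e) * exp (- I t)) (at t)"
      by (rule DERIV_cong[OF DERIV_fun_exp[OF DERIV_minus[OF dI]]]) simp
    have "exp (- I t) * ((B t \<bullet> v) * exp (I t)) = B t \<bullet> v"
      by (simp add: exp_minus)
    then have dy: "(y has_real_derivative - (B t \<bullet> v) - (B t \<bullet> e) * y t) (at t)"
      unfolding y_def
      by (intro DERIV_cong[OF DERIV_minus[OF DERIV_mult[OF dE dK]]]) (simp add: algebra_simps)
    have "((\<lambda>t. v + y t *\<^sub>R e) has_vector_derivative (- (B t \<bullet> v) - (B t \<bullet> e) * y t) *\<^sub>R e) (at t)"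
      using has_vector_derivative_add[OF has_vector_derivative_const
          has_vector_derivative_scaleR[OF dy has_vector_derivative_const], of v e] by simp
    from has_vector_derivative_scaleR[OF dE this]
    have "(V has_vector_derivative (- (B t \<bullet> e) * exp (- I t)) *\<^sub>R (v + y t *\<^sub>R e) +
        exp (- I t) *\<^sub>R ((- (B t \<bullet> v) - (B t \<bullet> e) * y t) *\<^sub>R e)) (at t)"
      unfolding V_def by (simp add: add.commute)
    also have "(- (B t \<bullet> e) * exp (- I t)) *\<^sub>R (v + y t *\<^sub>R e) + exp (- I t) *\<^sub>R ((- (B t \<bullet> v) - (B t \<bullet> e) * y t) *\<^sub>R e)
       = - ((B t \<bullet> e) *\<^sub>R V t + (B t \<bullet> V t) *\<^sub>R e)"
      by (simp add: V_def algebra_simps inner_add_right)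
    finally show ?thesis
      unfolding parallel_at_def vector_derivative_linepath_at projective_onD[OF assms(1) inU[OF t01]]
      by (simp add: B_def e_def)
  qed
  ultimately show ?thesis using that by blast
qed

lemma parallel_transport_segment:
  assumes "projective_on U A nabla" "continuous_on U A" "closed_segment p q \<subseteq> U"
  shows "\<exists>w. parallel_transport nabla (linepath p q) v w"
proof -
  obtain V where V: "continuous_on {0..1} V" "V 0 = v" "\<And>t. t \<in> {0<..<1} \<Longrightarrow> parallel_at nabla (linepath p q) V t"
    using parallel_transport_segment_exists[OF assms] by blast
  show ?thesis
    unfolding parallel_transport_def
    by (intro exI[of _ "V 1"] exI[of _ V] conjI exI[of _ "{0,1}"]) (use V in auto)
qed

text \<open>A mean value inequality that tolerates finitely many bad times, obtained by integrating
  the derivative.\<close>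

lemma norm_diff_le_of_derivative_bound:
  fixes f :: "real \<Rightarrow> 'a::euclidean_space"
  assumes "continuous_on {0..1} f" "finite S" "0 \<le> t" "t \<le> 1" "0 \<le> B"
    and "\<And>s. s \<in> {0..1} - S \<Longrightarrow> (f has_vector_derivative f' s) (at s)"
    and "\<And>s. s \<in> {0..1} - S \<Longrightarrow> norm (f' s) \<le> B"
  shows "norm (f t - f 0) \<le> B"
proof -
  have "(f' has_integral f t - f 0) {0..t}"
  proof (rule fundamental_theorem_of_calculus_interior_strong[OF assms(2,3)])
    show "continuous_on {0..t} f" using assms(1,4) by (auto intro: continuous_on_subset)
  qed (use assms in auto)
  then have "norm (f t - f 0) \<le> B * measure lborel (cbox 0 t)"
    by (intro has_integral_bound_spike_finite[OF assms(5,2), of f']) (use assms in auto)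
  also have "\<dots> \<le> B" using assms(3,4,5) mult_left_le[of t B] by simp
  finally show ?thesis .
qed

text \<open>Replaces Gronwall's inequality: on short segments the maximum of the error is absorbed.\<close>

lemma parallel_transport_segment_estimate:
  assumes "projective_on U A nabla" "closed_segment p q \<subseteq> U"
    and \<kappa>: "\<And>t v. t \<in> {0..1} \<Longrightarrow> norm (christoffel nabla (linepath p q t) (q - p) v) \<le> \<kappa> * norm v"
      "0 \<le> \<kappa>" "\<kappa> \<le> 1/2"
    and W: "continuous_on {0..1} W" "finite T"
      "\<And>t. t \<in> {0..1} - T \<Longrightarrow> (W has_vector_derivative W' t) (at t)"
      "\<And>t. t \<in> {0..1} - T \<Longrightarrow> norm (W' t + christoffel nabla (linepath p q t) (q - p) (W t) - r) \<le> \<eta>"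
    and "0 \<le> \<eta>" and w: "parallel_transport nabla (linepath p q) v w"
  shows "norm ((w - W 1) - (v - W 0) + r) \<le> \<eta> + 2 * \<kappa> * (norm (v - W 0) + norm r + \<eta>)"
proof -
  obtain V S where V: "continuous_on {0..1} V" "finite S" "V 0 = v" "V 1 = w"
    and par: "\<And>t. t \<in> {0..1} - S \<Longrightarrow> parallel_at nabla (linepath p q) V t"
    using w unfolding parallel_transport_def by blast
  define E where "E t = V t - W t" for t
  have cE: "continuous_on {0..1} E" unfolding E_def by (intro continuous_intros V W)
  define G where "G t = christoffel nabla (linepath p q t) (q - p)" for t
  have inU: "linepath p q t \<in> U" if "t \<in> {0..1}" for t
    using assms(2) that by (auto simp: linepath_in_path)
  have Gdiff: "G t (a - b) = G t a - G t b" if "t \<in> {0..1}" for t a b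
    by (simp add: G_def projective_onD[OF assms(1) inU[OF that]] inner_diff_right algebra_simps)
  define E' where "E' t = - G t (V t) - W' t" for t
  have dE: "(E has_vector_derivative E' t) (at t)" if "t \<in> {0..1} - (S \<union> T)" for t
    unfolding E_def E'_def using W(3)[of t] par[of t] that
    by (auto simp: parallel_at_def vector_derivative_linepath_at G_def intro!: derivative_eq_intros)
  obtain tm where tm: "tm \<in> {0..1}" "\<And>t. t \<in> {0..1} \<Longrightarrow> norm (E t) \<le> norm (E tm)"
    using continuous_attains_sup[of "{0..1::real}" "\<lambda>t. norm (E t)"] continuous_on_norm[OF cE] by auto
  define m where "m = norm (E tm)"
  have b: "norm (E' t + r) \<le> \<kappa> * m + \<eta>" if t: "t \<in> {0..1} - (S \<union> T)" for t
  proof -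
    have "E' t + r = - G t (E t) - (W' t + G t (W t) - r)"
      using Gdiff[of t "V t" "W t"] t by (simp add: E'_def E_def)
    also have "norm \<dots> \<le> norm (G t (E t)) + norm (W' t + G t (W t) - r)"
      using norm_triangle_ineq4[of "- G t (E t)"] by simp
    also have "\<dots> \<le> \<kappa> * norm (E t) + \<eta>"
      using \<kappa>(1)[of t "E t"] W(4)[of t] t unfolding G_def by (intro add_mono) auto
    also have "\<dots> \<le> \<kappa> * m + \<eta>"
      using tm(2)[of t] t \<kappa>(2) unfolding m_def by (intro add_right_mono mult_left_mono) auto
    finally show ?thesis .
  qed
  have nn: "0 \<le> \<kappa> * m + \<eta>" using \<kappa>(2) assms(10) by (simp add: m_def)
  have "norm (E' t) \<le> \<kappa> * m + \<eta> + norm r" if t: "t \<in> {0..1} - (S \<union> T)" for t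
    using b[OF t] norm_triangle_ineq4[of "E' t + r" r] by simp
  then have "norm (E tm - E 0) \<le> \<kappa> * m + \<eta> + norm r"
    using norm_diff_le_of_derivative_bound[OF cE, of "S \<union> T" tm "\<kappa> * m + \<eta> + norm r" E'] V(2) W(2) tm(1) nn dE
    by auto
  then have "m \<le> norm (E 0) + \<kappa> * m + \<eta> + norm r"
    using norm_triangle_ineq2[of "E tm" "E 0"] by (simp add: m_def)
  \<comment> \<open>This is where \<open>\<kappa> \<le> 1/2\<close> enters: half of the maximal
    error moves to the left-hand side.\<close>
  moreover have "\<kappa> * m \<le> 1/2 * m" using \<kappa>(3) by (intro mult_right_mono) (auto simp: m_def)
  ultimately have m: "m \<le> 2 * (norm (E 0) + norm r + \<eta>)" by simp
  \<comment> \<open>A second pass, with \<open>m\<close> now under control: adding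
    \<open>t *\<^sub>R r\<close> cancels the expected drift \<open>- r\<close> of the error, and
    only terms of size \<open>\<kappa> * m + \<eta>\<close> remain.\<close>
  have "norm ((E 1 + 1 *\<^sub>R r) - (E 0 + 0 *\<^sub>R r)) \<le> \<kappa> * m + \<eta>"
  proof (rule norm_diff_le_of_derivative_bound[where f' = "\<lambda>t. E' t + r" and S = "S \<union> T"])
    show "continuous_on {0..1} (\<lambda>t. E t + t *\<^sub>R r)" by (intro continuous_intros cE)
    show "((\<lambda>t. E t + t *\<^sub>R r) has_vector_derivative E' s + r) (at s)" if "s \<in> {0..1} - (S \<union> T)" for s
      using dE[OF that] by (auto intro!: derivative_eq_intros)
  qed (use V(2) W(2) b nn in auto)
  also have "\<kappa> * m + \<eta> \<le> \<kappa> * (2 * (norm (E 0) + norm r + \<eta>)) + \<eta>"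
    using m \<kappa>(2) by (intro add_right_mono mult_left_mono)
  finally show ?thesis using V by (simp add: E_def algebra_simps)
qed

text \<open>One transport serves as comparison field for the other: with equal initial values,
  \<open>r = 0\<close> and \<open>\<eta> = 0\<close> the estimate has right-hand side 0.\<close>

lemma parallel_transport_segment_unique:
  assumes "projective_on U A nabla" "closed_segment p q \<subseteq> U"
    and "\<And>t v. t \<in> {0..1} \<Longrightarrow> norm (christoffel nabla (linepath p q t) (q - p) v) \<le> \<kappa> * norm v"
      "0 \<le> \<kappa>" "\<kappa> \<le> 1/2"
    and "parallel_transport nabla (linepath p q) v w" "parallel_transport nabla (linepath p q) v w'"
  shows "w = w'"
proof -
  obtain W T where W: "continuous_on {0..1} W" "finite T" "W 0 = v" "W 1 = w'"
    and par: "\<And>t. t \<in> {0..1} - T \<Longrightarrow> parallel_at nabla (linepath p q) W t"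
    using assms(7) unfolding parallel_transport_def by blast
  have "norm ((w - W 1) - (v - W 0) + 0) \<le> 0 + 2 * \<kappa> * (norm (v - W 0) + norm (0 :: real ^ 'a) + 0)"
    by (rule parallel_transport_segment_estimate[OF assms(1,2,3,4,5) W(1,2) par[unfolded parallel_at_def] _ _ assms(6)])
       (auto simp: vector_derivative_linepath_at)
  then show ?thesis using W by simp
qed

section \<open>Holonomy of small parallelograms\<close>

text \<open>The curvature \<open>R(u, v) w\<close> of the connection with field \<open>A\<close>:
  the first term is the exterior derivative of the one-form of \<open>A\<close>, the others are
  built from the tensor \<open>DA - A \<otimes> A\<close>.\<close>

definition projective_curvature ::
    "('n::finite) field \<Rightarrow> real ^ 'n \<Rightarrow> real ^ 'n \<Rightarrow> real ^ 'n \<Rightarrow> real ^ 'n \<Rightarrow> real ^ 'n" where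
  "projective_curvature A x u v w =
     (frechet_derivative A (at x) u \<bullet> v - frechet_derivative A (at x) v \<bullet> u) *\<^sub>R w +
     (frechet_derivative A (at x) u \<bullet> w - (A x \<bullet> u) * (A x \<bullet> w)) *\<^sub>R v -
     (frechet_derivative A (at x) v \<bullet> w - (A x \<bullet> v) * (A x \<bullet> w)) *\<^sub>R u"

text \<open>As \<open>real ^ 'n\<close> is a ring, the arithmetic simprocs turn \<open>y + y\<close> into \<open>y * 2\<close>.\<close>

lemma vec_mult_2: "y * 2 = 2 *\<^sub>R y" for y :: "real ^ 'n::finite"
  by (simp add: vec_eq_iff)

text \<open>The field \<open>W\<close> along the plane through \<open>x\<close> spanned by \<open>u\<close>, \<open>v\<close> is parallel in the direction
  \<open>v\<close> up to second order, while at \<open>x + s u + t v\<close> its covariant derivative along \<open>u\<close> is \<open>- t R\<close> to first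
  order; here \<open>R\<close> is the curvature applied to \<open>w\<close>. Comparing the parallel transport around a small
  parallelogram with \<open>W\<close> gives the expansion of the holonomy.\<close>

lemma comparison_field:
  fixes B :: "real \<times> real \<Rightarrow> real ^ 'n::finite" and u v w :: "real ^ 'n"
  assumes B: "(B has_derivative (\<lambda>h. fst h *\<^sub>R p + snd h *\<^sub>R q)) (at 0)"
  and G_def: "G = (\<lambda>\<alpha> a b. (\<alpha> \<bullet> a) *\<^sub>R b + (\<alpha> \<bullet> b) *\<^sub>R a)"
  and a_def: "a = (1/2) *\<^sub>R (G (B 0) u (G (B 0) u w) - G p u w)"
  and b_def: "b = G (B 0) v (G (B 0) u w) - G p v w"
  and c_def: "c = (1/2) *\<^sub>R (G (B 0) v (G (B 0) v w) - G q v w)"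
  and W_def: "W = (\<lambda>z. w - fst z *\<^sub>R G (B 0) u w - snd z *\<^sub>R G (B 0) v w +
     (fst z)\<^sup>2 *\<^sub>R a + (fst z * snd z) *\<^sub>R b + (snd z)\<^sup>2 *\<^sub>R c)"
  and R_def: "R = (p \<bullet> v - q \<bullet> u) *\<^sub>R w + (p \<bullet> w - (B 0 \<bullet> u) * (B 0 \<bullet> w)) *\<^sub>R v -
     (q \<bullet> w - (B 0 \<bullet> v) * (B 0 \<bullet> w)) *\<^sub>R u"
  shows "((\<lambda>z. - G (B 0) u w + (2 * fst z) *\<^sub>R a + snd z *\<^sub>R b + G (B z) u (W z))
            has_derivative (\<lambda>h. - snd h *\<^sub>R R)) (at 0)" (is ?A)
    and "((\<lambda>z. - G (B 0) v w + fst z *\<^sub>R b + (2 * snd z) *\<^sub>R c + G (B z) v (W z))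
            has_derivative (\<lambda>h. 0)) (at 0)" (is ?B)
    and "(\<And>t. ((\<lambda>t. W (z + t *\<^sub>R \<zeta>)) has_vector_derivative
          fst \<zeta> *\<^sub>R (- G (B 0) u w + (2 * fst (z + t *\<^sub>R \<zeta>)) *\<^sub>R a + snd (z + t *\<^sub>R \<zeta>) *\<^sub>R b) +
          snd \<zeta> *\<^sub>R (- G (B 0) v w + fst (z + t *\<^sub>R \<zeta>) *\<^sub>R b + (2 * snd (z + t *\<^sub>R \<zeta>)) *\<^sub>R c)) (at t))"
      (is "\<And>t. ?C t")
proof -
  have W: "(W has_derivative (\<lambda>h. - fst h *\<^sub>R G (B 0) u w - snd h *\<^sub>R G (B 0) v w)) (at 0)"
    unfolding W_def by (auto intro!: derivative_eq_intros)
  have W0: "W 0 = w" by (simp add: W_def)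
  have GW: "((\<lambda>z. G (B z) e (W z)) has_derivative
      (\<lambda>h. ((B 0 \<bullet> e) *\<^sub>R (- fst h *\<^sub>R G (B 0) u w - snd h *\<^sub>R G (B 0) v w) +
        ((fst h *\<^sub>R p + snd h *\<^sub>R q) \<bullet> e) *\<^sub>R w) +
        (B 0 \<bullet> (- fst h *\<^sub>R G (B 0) u w - snd h *\<^sub>R G (B 0) v w) +
         (fst h *\<^sub>R p + snd h *\<^sub>R q) \<bullet> w) *\<^sub>R e)) (at 0)" for e
    using has_derivative_add[OF has_derivative_scaleR[OF has_derivative_inner_left[OF B, of e] W]
        has_derivative_scaleR[OF has_derivative_inner[OF B W] has_derivative_const[of e]]]
    unfolding G_def W0 by simp
  show ?A
  proof (rule has_derivative_eq_rhs)
    show "((\<lambda>z. - G (B 0) u w + (2 * fst z) *\<^sub>R a + snd z *\<^sub>R b + G (B z) u (W z)) has_derivative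
       (\<lambda>h. (2 * fst h) *\<^sub>R a + snd h *\<^sub>R b + (((B 0 \<bullet> u) *\<^sub>R (- fst h *\<^sub>R G (B 0) u w - snd h *\<^sub>R G (B 0) v w) +
        ((fst h *\<^sub>R p + snd h *\<^sub>R q) \<bullet> u) *\<^sub>R w) +
        (B 0 \<bullet> (- fst h *\<^sub>R G (B 0) u w - snd h *\<^sub>R G (B 0) v w) +
         (fst h *\<^sub>R p + snd h *\<^sub>R q) \<bullet> w) *\<^sub>R u))) (at 0)"
      by (rule has_derivative_add[OF _ GW]) (auto intro!: derivative_eq_intros)
  qed (simp add: fun_eq_iff vec_mult_2 a_def b_def R_def G_def inner_add_right inner_add_left inner_diff_right algebra_simps)
  show ?B
  proof (rule has_derivative_eq_rhs)
    show "((\<lambda>z. - G (B 0) v w + fst z *\<^sub>R b + (2 * snd z) *\<^sub>R c + G (B z) v (W z)) has_derivative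
       (\<lambda>h. fst h *\<^sub>R b + (2 * snd h) *\<^sub>R c + (((B 0 \<bullet> v) *\<^sub>R (- fst h *\<^sub>R G (B 0) u w - snd h *\<^sub>R G (B 0) v w) +
        ((fst h *\<^sub>R p + snd h *\<^sub>R q) \<bullet> v) *\<^sub>R w) +
        (B 0 \<bullet> (- fst h *\<^sub>R G (B 0) u w - snd h *\<^sub>R G (B 0) v w) +
         (fst h *\<^sub>R p + snd h *\<^sub>R q) \<bullet> w) *\<^sub>R v))) (at 0)"
      by (rule has_derivative_add[OF _ GW]) (auto intro!: derivative_eq_intros)
  qed (simp add: fun_eq_iff c_def b_def G_def inner_add_right inner_add_left inner_diff_right algebra_simps)
  show "?C t" for t
    unfolding W_def
    by (auto intro!: derivative_eq_intros simp: power2_eq_square vec_mult_2 algebra_simps)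
qed

text \<open>The loop is unfolded from its first edge on. The remaining tail is itself a joined path,
  hence differentiable only off a finite set, which \<open>dj\<close> keeps track of.\<close>

lemma parallel_transport_rectangle:
  assumes "projective_on U A nabla"
    and "closed_segment x (x + a) \<subseteq> U" "closed_segment (x + a) (x + a + b) \<subseteq> U"
      "closed_segment (x + a + b) (x + b) \<subseteq> U" "closed_segment (x + b) x \<subseteq> U"
  shows "parallel_transport nabla (rectangle_loop x a b) v z \<longleftrightarrow>
    (\<exists>w1 w2 w3. parallel_transport nabla (linepath x (x + a)) v w1 \<and>
       parallel_transport nabla (linepath (x + a) (x + a + b)) w1 w2 \<and>
       parallel_transport nabla (linepath (x + a + b) (x + b)) w2 w3 \<and>
       parallel_transport nabla (linepath (x + b) x) w3 z)"
proof -
  define l1 l2 l3 l4 where l: "l1 = linepath x (x + a)" "l2 = linepath (x + a) (x + a + b)"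
    "l3 = linepath (x + a + b) (x + b)" "l4 = linepath (x + b) x"
  have dj: "\<exists>S. finite S \<and> (\<forall>t\<in>{0..1} - S. (c +++ d) differentiable at t)"
    if "\<And>t. c differentiable at t" "finite S" "\<And>t. t \<in> {0..1} - S \<Longrightarrow> d differentiable at t"
    for c d :: "real \<Rightarrow> real ^ 'a" and S
  proof (intro exI[of _ "insert (1/2) ((\<lambda>s. (s + 1) / 2) ` S)"] conjI ballI)
    fix t assume t: "t \<in> {0..1} - insert (1/2) ((\<lambda>s::real. (s + 1) / 2) ` S)"
    show "(c +++ d) differentiable at t"
    proof (cases "t < 1/2")
      case True
      have "(\<lambda>s. c (2 * s)) differentiable at t"
        by (rule differentiable_compose[of c, OF that(1)]) (intro derivative_intros)
      then show ?thesis
        unfolding differentiable_def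
        using has_derivative_transform_within_open[of "\<lambda>s. c (2 * s)" _ t UNIV "{..<1/2}" "c +++ d"] True
        by (auto simp: joinpaths_def)
    next
      case False
      have "2 * t - 1 \<notin> S"
      proof
        assume "2 * t - 1 \<in> S"
        then have "(2 * t - 1 + 1) / 2 \<in> (\<lambda>s. (s + 1) / 2) ` S" by blast
        then show False using t by simp
      qed
      then have "d differentiable at (2 * t - 1)" using that(3)[of "2 * t - 1"] t False by auto
      then have "(\<lambda>s. d (2 * s - 1)) differentiable at t"
        by (rule differentiable_compose[of d]) (intro derivative_intros)
      then show ?thesis
        unfolding differentiable_def
        using has_derivative_transform_within_open[of "\<lambda>s. d (2 * s - 1)" _ t UNIV "{1/2<..}" "c +++ d"] t False
        by (auto simp: joinpaths_def)
    qed
  qed (use that in auto)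
  have dl: "l1 differentiable at t" "l2 differentiable at t" "l3 differentiable at t" "l4 differentiable at t" for t
    by (simp_all add: l differentiable_linepath)
  have U: "path_image l1 \<subseteq> U" "path_image l2 \<subseteq> U" "path_image l3 \<subseteq> U" "path_image l4 \<subseteq> U"
    using assms by (simp_all add: l)
  obtain S3 where S3: "finite S3" "\<And>t. t \<in> {0..1} - S3 \<Longrightarrow> (l3 +++ l4) differentiable at t"
    using dj[OF dl(3) finite.emptyI dl(4)] by blast
  obtain S2 where S2: "finite S2" "\<And>t. t \<in> {0..1} - S2 \<Longrightarrow> (l2 +++ l3 +++ l4) differentiable at t"
    using dj[OF dl(2) S3] by blast
  have j3: "pathfinish l1 = pathstart l2" "pathfinish l2 = pathstart l3" "pathfinish l3 = pathstart l4" by (simp_all add: l)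
  have U3: "path_image (l3 +++ l4) \<subseteq> U" "path_image (l2 +++ l3 +++ l4) \<subseteq> U"
    using U by (auto dest!: subsetD[OF path_image_join_subset])
  note D = parallel_transport_joinD[OF assms(1)] and I = parallel_transport_joinI[OF assms(1)]
  have "parallel_transport nabla (rectangle_loop x a b) v z \<longleftrightarrow> parallel_transport nabla (l1 +++ l2 +++ l3 +++ l4) v z"
    by (simp add: rectangle_loop_def l)
  also have "\<dots> \<longleftrightarrow> (\<exists>w1. parallel_transport nabla l1 v w1 \<and> parallel_transport nabla (l2 +++ l3 +++ l4) w1 z)"
    using D[OF U(1) U3(2) finite.emptyI dl(1) S2, of v z] I[OF U(1) U3(2) finite.emptyI dl(1) S2, of v _ z] by blast
  also have "\<dots> \<longleftrightarrow> (\<exists>w1 w2. parallel_transport nabla l1 v w1 \<and> parallel_transport nabla l2 w1 w2 \<and>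
      parallel_transport nabla (l3 +++ l4) w2 z)"
    using D[OF U(2) U3(1) finite.emptyI dl(2) S3, of _ z] I[OF U(2) U3(1) finite.emptyI dl(2) S3, of _ _ z] by blast
  also have "\<dots> \<longleftrightarrow> (\<exists>w1 w2 w3. parallel_transport nabla l1 v w1 \<and> parallel_transport nabla l2 w1 w2 \<and>
      parallel_transport nabla l3 w2 w3 \<and> parallel_transport nabla l4 w3 z)"
    using D[OF U(3) U(4) finite.emptyI dl(3) finite.emptyI dl(4), of _ z]
      I[OF U(3) U(4) finite.emptyI dl(3) finite.emptyI dl(4), of _ _ z] by blast
  finally show ?thesis unfolding l .
qed

text \<open>Along each edge the deviation of the transported vector from \<open>W\<close> changes by
  \<open>fst \<zeta> * snd z\<close> times \<open>R\<close>, up to higher order. This product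
  vanishes except on the third edge, run backwards along \<open>u\<close> at height \<epsilon>,
  where it is \<open>- \<epsilon>^2\<close>.\<close>

lemma holonomy_rectangle_limit:
  assumes U: "open U" and A: "smooth_on U A" and pr: "projective_on U A nabla" and x: "x \<in> U"
  shows "((\<lambda>\<epsilon>. (holonomy nabla (rectangle_loop x (\<epsilon> *\<^sub>R u) (\<epsilon> *\<^sub>R v)) w - w) /\<^sub>R \<epsilon>\<^sup>2)
     \<longlongrightarrow> - projective_curvature A x u v w) (at_right 0)"
proof -
  define P where "P z = x + fst z *\<^sub>R u + snd z *\<^sub>R v" for z :: "real \<times> real"
  define B where "B z = A (P z)" for z
  have P0: "P 0 = x" by (simp add: P_def)
  have dP: "(P has_derivative (\<lambda>h. fst h *\<^sub>R u + snd h *\<^sub>R v)) (at 0)"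
    unfolding P_def by (auto intro!: derivative_eq_intros)
  define p where "p = frechet_derivative A (at x) u"
  define q where "q = frechet_derivative A (at x) v"
  have "(B has_derivative (\<lambda>h. frechet_derivative A (at x) (fst h *\<^sub>R u + snd h *\<^sub>R v))) (at 0)"
    unfolding B_def
    by (rule has_derivative_compose[OF dP, where g = A]) (simp add: P0 smooth_on_has_derivative[OF A x])
  then have dB: "(B has_derivative (\<lambda>h. fst h *\<^sub>R p + snd h *\<^sub>R q)) (at 0)"
    by (simp add: p_def q_def linear_add[OF frechet_linear[OF A x]] linear_cmul[OF frechet_linear[OF A x]])
  define G where "G = (\<lambda>(\<alpha> :: real ^ 'a) (a :: real ^ 'a) b. (\<alpha> \<bullet> a) *\<^sub>R b + (\<alpha> \<bullet> b) *\<^sub>R a)"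
  \<comment> \<open>Choice of the second-order coefficients: \<open>a\<close> cancels the derivative
    along \<open>u\<close> of the covariant derivative of \<open>W\<close> along \<open>u\<close>;
    \<open>b\<close> and \<open>c\<close> cancel both first derivatives of its covariant derivative
    along \<open>v\<close>. The one remaining derivative can no longer be adjusted and equals
    \<open>- R\<close>.\<close>
  define a where "a = (1/2) *\<^sub>R (G (B 0) u (G (B 0) u w) - G p u w)"
  define b where "b = G (B 0) v (G (B 0) u w) - G p v w"
  define c where "c = (1/2) *\<^sub>R (G (B 0) v (G (B 0) v w) - G q v w)"
  define W where "W = (\<lambda>z. w - fst z *\<^sub>R G (B 0) u w - snd z *\<^sub>R G (B 0) v w +
     (fst z)\<^sup>2 *\<^sub>R a + (fst z * snd z) *\<^sub>R b + (snd z)\<^sup>2 *\<^sub>R c)"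
  define R where "R = (p \<bullet> v - q \<bullet> u) *\<^sub>R w + (p \<bullet> w - (B 0 \<bullet> u) * (B 0 \<bullet> w)) *\<^sub>R v -
     (q \<bullet> w - (B 0 \<bullet> v) * (B 0 \<bullet> w)) *\<^sub>R u"
  have R: "R = projective_curvature A x u v w"
    by (simp add: R_def projective_curvature_def p_def q_def B_def P0)
  define D1 where "D1 z = - G (B 0) u w + (2 * fst z) *\<^sub>R a + snd z *\<^sub>R b" for z
  define D2 where "D2 z = - G (B 0) v w + fst z *\<^sub>R b + (2 * snd z) *\<^sub>R c" for z
  note cf = comparison_field[OF dB G_def a_def b_def c_def W_def R_def]
  have dN1: "((\<lambda>z. D1 z + G (B z) u (W z)) has_derivative (\<lambda>h. - snd h *\<^sub>R R)) (at 0)"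
    and dN2: "((\<lambda>z. D2 z + G (B z) v (W z)) has_derivative (\<lambda>h. 0)) (at 0)"
    using cf(1,2) by (simp_all add: D1_def D2_def)
  have W0: "W 0 = w" by (simp add: W_def)
  have N0: "D1 0 + G (B 0) u (W 0) = 0" "D2 0 + G (B 0) v (W 0) = 0"
    by (simp_all add: D1_def D2_def W0)
  have dW: "((\<lambda>t. W (z + t *\<^sub>R \<zeta>)) has_vector_derivative
      fst \<zeta> *\<^sub>R D1 (z + t *\<^sub>R \<zeta>) + snd \<zeta> *\<^sub>R D2 (z + t *\<^sub>R \<zeta>)) (at t)" for z \<zeta> t
    using cf(3)[of z \<zeta> t] unfolding D1_def D2_def .
  obtain d where d: "d > 0" "cball x d \<subseteq> U" using U x open_contains_cball by blast
  have "bounded (A ` cball x d)"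
    by (intro compact_imp_bounded compact_continuous_image compact_cball
        continuous_on_subset[OF smooth_on_continuous[OF A] d(2)])
  then obtain b0 where b0: "\<And>y. y \<in> cball x d \<Longrightarrow> norm (A y) \<le> b0"
    unfolding bounded_iff by blast
  define C where "C = max b0 0"
  have C: "0 \<le> C" "\<And>y. y \<in> cball x d \<Longrightarrow> norm (A y) \<le> C" using b0 by (fastforce simp: C_def)+
  define K where "K = norm u + norm v + 1"
  have K: "K > 0" by (simp add: K_def add_nonneg_pos)
  have comp: "\<bar>fst z\<bar> \<le> norm z" "\<bar>snd z\<bar> \<le> norm z" for z :: "real \<times> real"
    by (cases z; simp add: norm_Pair real_le_rsqrt)+
  have inball: "P z \<in> cball x d" if "norm z \<le> d / K" for z
  proof -
    have "norm (fst z *\<^sub>R u + snd z *\<^sub>R v) \<le> \<bar>fst z\<bar> * norm u + \<bar>snd z\<bar> * norm v"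
      using norm_triangle_ineq[of "fst z *\<^sub>R u" "snd z *\<^sub>R v"] by simp
    also have "\<dots> \<le> norm z * norm u + norm z * norm v" by (intro add_mono mult_right_mono comp) auto
    also have "\<dots> \<le> norm z * K" by (simp add: K_def algebra_simps)
    also have "\<dots> \<le> d" using that K by (simp add: field_simps)
    finally have "norm (P z - x) \<le> d" by (simp add: P_def)
    then show ?thesis by (simp add: dist_norm norm_minus_commute)
  qed
  show ?thesis
  proof (rule tendstoI)
    fix e :: real assume e: "e > 0"
    \<comment> \<open>The four edges contribute
      \<open>4 * \<eta> = 8 * \<delta> * \<epsilon>^2\<close>, a quarter of the tolerance; the cubic
      terms get another half.\<close>
    define \<delta> where "\<delta> = e / 32"
    have \<delta>: "\<delta> > 0" using e by (simp add: \<delta>_def)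
    obtain \<rho>1 where \<rho>1: "\<rho>1 > 0" "\<And>z. norm z < \<rho>1 \<Longrightarrow> norm (D1 z + G (B z) u (W z) + snd z *\<^sub>R R) \<le> \<delta> * norm z"
      using dN1[unfolded has_derivative_at_alt] \<delta> unfolding N0 by auto
    obtain \<rho>2 where \<rho>2: "\<rho>2 > 0" "\<And>z. norm z < \<rho>2 \<Longrightarrow> norm (D2 z + G (B z) v (W z)) \<le> \<delta> * norm z"
      using dN2[unfolded has_derivative_at_alt] \<delta> unfolding N0 by auto
    \<comment> \<open>The first summand is the coefficient of the cubic error
      \<open>74 * \<kappa> * M\<close>; the second ensures
      \<open>2 * \<kappa> \<le> \<epsilon> * S\<close>, hence \<open>\<kappa> \<le> 1/2\<close>; the
      last keeps \<open>S\<close> positive.\<close>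
    define S where "S = 74 * (2 * C * K) * (norm R + 2 * \<delta>) + 4 * C * K + 1"
    have S: "S > 0" using C(1) K \<delta> by (simp add: S_def add_nonneg_pos)
    define \<epsilon>0 where "\<epsilon>0 = min (min (\<rho>1 / 2) (\<rho>2 / 2)) (min (d / K / 2) (min (1 / S) (e / 2 / S)))"
    have \<epsilon>0: "\<epsilon>0 > 0" using \<rho>1 \<rho>2 d K S e by (simp add: \<epsilon>0_def)
    have "dist ((holonomy nabla (rectangle_loop x (\<epsilon> *\<^sub>R u) (\<epsilon> *\<^sub>R v)) w - w) /\<^sub>R \<epsilon>\<^sup>2) (- projective_curvature A x u v w) < e"
      if \<epsilon>: "0 < \<epsilon>" "\<epsilon> < \<epsilon>0" for \<epsilon>
    proof -
      have \<epsilon>': "2 * \<epsilon> < \<rho>1" "2 * \<epsilon> < \<rho>2" "2 * \<epsilon> \<le> d / K" "\<epsilon> * S < 1" "\<epsilon> * S < e / 2"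
        using \<epsilon> S by (auto simp: \<epsilon>0_def pos_less_divide_eq)
      \<comment> \<open>\<kappa> bounds the Christoffel operator along one edge, \<eta> the
        deviation of the covariant derivative of \<open>W\<close> from its linear part, and
        \<open>M\<close> that deviation together with the curvature term.\<close>
      define \<kappa> where "\<kappa> = 2 * C * (\<epsilon> * K)"
      define \<eta> where "\<eta> = 2 * \<delta> * \<epsilon>\<^sup>2"
      define M where "M = \<epsilon>\<^sup>2 * norm R + \<eta>"
      have \<eta>: "\<eta> \<ge> 0" using \<delta> by (simp add: \<eta>_def)
      have M: "M \<ge> 0" "\<eta> \<le> M" using \<eta> by (simp_all add: M_def)
      have \<kappa>: "0 \<le> \<kappa>" using C K \<epsilon> by (simp add: \<kappa>_def)
      have "2 * \<kappa> \<le> \<epsilon> * S"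
        using mult_left_mono[of "4 * C * K" S \<epsilon>] C K \<epsilon> \<delta> by (simp add: \<kappa>_def S_def algebra_simps)
      then have \<kappa>1: "\<kappa> \<le> 1/2" using \<epsilon>' by simp
      have seg: "linepath (P z) (P (z + \<zeta>)) t = P (z + t *\<^sub>R \<zeta>)"
        "P (z + \<zeta>) - P z = fst \<zeta> *\<^sub>R u + snd \<zeta> *\<^sub>R v" for z \<zeta> t
        by (simp_all add: linepath_def P_def algebra_simps)
      have segU: "closed_segment (P z) (P (z + \<zeta>)) \<subseteq> U"
        and bound: "\<And>t y. t \<in> {0..1} \<Longrightarrow>
          norm (christoffel nabla (linepath (P z) (P (z + \<zeta>)) t) (P (z + \<zeta>) - P z) y) \<le> \<kappa> * norm y"
        if z: "\<And>t. t \<in> {0..1} \<Longrightarrow> norm (z + t *\<^sub>R \<zeta>) \<le> 2 * \<epsilon>" and \<zeta>: "\<bar>fst \<zeta>\<bar> + \<bar>snd \<zeta>\<bar> \<le> \<epsilon>"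
        for z \<zeta>
      proof -
        have inb: "P (z + t *\<^sub>R \<zeta>) \<in> cball x d" if "t \<in> {0..1}" for t
          using z[OF that] \<epsilon>'(3) by (intro inball) simp
        then show "closed_segment (P z) (P (z + \<zeta>)) \<subseteq> U"
          using d(2) by (auto simp: linepath_image_01[symmetric] seg)
        fix t :: real and y assume t: "t \<in> {0..1}"
        have inU: "P (z + t *\<^sub>R \<zeta>) \<in> U" using inb[OF t] d(2) by blast
        define f where "f = fst \<zeta> *\<^sub>R u + snd \<zeta> *\<^sub>R v"
        have "norm f \<le> \<bar>fst \<zeta>\<bar> * norm u + \<bar>snd \<zeta>\<bar> * norm v"
          using norm_triangle_ineq[of "fst \<zeta> *\<^sub>R u" "snd \<zeta> *\<^sub>R v"] by (simp add: f_def)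
        also have "\<dots> \<le> \<epsilon> * norm u + \<epsilon> * norm v" using \<zeta> by (intro add_mono mult_right_mono) auto
        also have "\<dots> \<le> \<epsilon> * K" using \<epsilon> by (simp add: K_def algebra_simps)
        finally have f: "norm f \<le> \<epsilon> * K" .
        define \<alpha> where "\<alpha> = A (P (z + t *\<^sub>R \<zeta>))"
        have \<alpha>: "norm \<alpha> \<le> C" using C(2) inb[OF t] by (simp add: \<alpha>_def)
        have "norm ((\<alpha> \<bullet> f) *\<^sub>R y + (\<alpha> \<bullet> y) *\<^sub>R f) \<le> \<bar>\<alpha> \<bullet> f\<bar> * norm y + \<bar>\<alpha> \<bullet> y\<bar> * norm f"
          using norm_triangle_ineq[of "(\<alpha> \<bullet> f) *\<^sub>R y" "(\<alpha> \<bullet> y) *\<^sub>R f"] by simp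
        also have "\<dots> \<le> (norm \<alpha> * norm f) * norm y + (norm \<alpha> * norm y) * norm f"
          by (intro add_mono mult_right_mono Cauchy_Schwarz_ineq2) auto
        also have "\<dots> = 2 * (norm \<alpha> * norm f) * norm y" by simp
        also have "\<dots> \<le> 2 * (C * (\<epsilon> * K)) * norm y"
          using \<alpha> f C(1) by (intro mult_right_mono mult_left_mono mult_mono) auto
        finally show "norm (christoffel nabla (linepath (P z) (P (z + \<zeta>)) t) (P (z + \<zeta>) - P z) y) \<le> \<kappa> * norm y"
          by (simp add: seg projective_onD[OF pr inU] f_def \<alpha>_def \<kappa>_def mult.assoc)
      qed
      \<comment> \<open>The condition \<open>fst \<zeta> * snd \<zeta> = 0\<close> says that the
        edge is parallel to an axis; while \<open>fst\<close> varies, \<open>snd\<close> is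
        constant, so the drift \<open>r\<close> does not depend on time.\<close>
      have edge: "norm ((w1 - W (z + \<zeta>)) - (w0 - W z) - (fst \<zeta> * snd z) *\<^sub>R R) \<le>
          \<eta> + 2 * \<kappa> * (norm (w0 - W z) + M)"
        if z: "\<And>t. t \<in> {0..1} \<Longrightarrow> norm (z + t *\<^sub>R \<zeta>) \<le> 2 * \<epsilon>" and \<zeta>: "\<bar>fst \<zeta>\<bar> + \<bar>snd \<zeta>\<bar> \<le> \<epsilon>"
          and sz: "\<bar>snd z\<bar> \<le> \<epsilon>" and \<zeta>0: "fst \<zeta> * snd \<zeta> = 0"
          and w: "parallel_transport nabla (linepath (P z) (P (z + \<zeta>))) w0 w1" for z \<zeta> w0 w1
      proof -
        define r where "r = - ((fst \<zeta> * snd z) *\<^sub>R R)"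
        have "norm ((w1 - W (z + 1 *\<^sub>R \<zeta>)) - (w0 - W (z + 0 *\<^sub>R \<zeta>)) + r) \<le>
            \<eta> + 2 * \<kappa> * (norm (w0 - W (z + 0 *\<^sub>R \<zeta>)) + norm r + \<eta>)"
        proof (rule parallel_transport_segment_estimate[OF pr segU[OF z \<zeta>] bound[OF z \<zeta>] \<kappa> \<kappa>1 _ finite.emptyI _ _ \<eta> w])
          show "continuous_on {0..1} (\<lambda>t. W (z + t *\<^sub>R \<zeta>))"
            using dW by (meson continuous_at_imp_continuous_on has_vector_derivative_continuous)
          show "((\<lambda>t. W (z + t *\<^sub>R \<zeta>)) has_vector_derivative
              fst \<zeta> *\<^sub>R D1 (z + t *\<^sub>R \<zeta>) + snd \<zeta> *\<^sub>R D2 (z + t *\<^sub>R \<zeta>)) (at t)" for t by (rule dW)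
          fix t :: real assume "t \<in> {0..1} - {}"
          then have t: "t \<in> {0..1}" by simp
          define y where "y = z + t *\<^sub>R \<zeta>"
          have ny: "norm y \<le> 2 * \<epsilon>" using z[OF t] by (simp add: y_def)
          have Py: "P y \<in> U" using inball[of y] ny \<epsilon>'(3) d(2) by auto
          have n1: "norm (D1 y + G (B y) u (W y) + snd y *\<^sub>R R) \<le> \<delta> * (2 * \<epsilon>)"
            using \<rho>1(2)[of y] ny \<epsilon>'(1) \<delta> mult_left_mono[OF ny, of \<delta>] by linarith
          have n2: "norm (D2 y + G (B y) v (W y)) \<le> \<delta> * (2 * \<epsilon>)"
            using \<rho>2(2)[of y] ny \<epsilon>'(2) \<delta> mult_left_mono[OF ny, of \<delta>] by linarith
          have sy: "fst \<zeta> * snd y = fst \<zeta> * snd z" using \<zeta>0 by (auto simp: y_def)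
          have "fst \<zeta> *\<^sub>R D1 y + snd \<zeta> *\<^sub>R D2 y +
              christoffel nabla (linepath (P z) (P (z + \<zeta>)) t) (P (z + \<zeta>) - P z) (W y) - r
            = fst \<zeta> *\<^sub>R (D1 y + G (B y) u (W y) + snd y *\<^sub>R R) + snd \<zeta> *\<^sub>R (D2 y + G (B y) v (W y))"
            unfolding seg y_def[symmetric] projective_onD[OF pr Py]
            by (simp add: r_def G_def B_def inner_add_right sy[symmetric] algebra_simps)
          also have "norm \<dots> \<le> \<bar>fst \<zeta>\<bar> * (\<delta> * (2 * \<epsilon>)) + \<bar>snd \<zeta>\<bar> * (\<delta> * (2 * \<epsilon>))"
            using n1 n2 by (intro norm_triangle_le add_mono) (auto intro: mult_left_mono)
          also have "\<dots> = (\<bar>fst \<zeta>\<bar> + \<bar>snd \<zeta>\<bar>) * (\<delta> * (2 * \<epsilon>))" by (simp add: algebra_simps)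
          also have "\<dots> \<le> \<epsilon> * (\<delta> * (2 * \<epsilon>))" using \<zeta> \<delta> \<epsilon> by (intro mult_right_mono) auto
          also have "\<dots> = \<eta>" by (simp add: \<eta>_def power2_eq_square)
          finally show "norm (fst \<zeta> *\<^sub>R D1 (z + t *\<^sub>R \<zeta>) + snd \<zeta> *\<^sub>R D2 (z + t *\<^sub>R \<zeta>) +
              christoffel nabla (linepath (P z) (P (z + \<zeta>)) t) (P (z + \<zeta>) - P z) (W (z + t *\<^sub>R \<zeta>)) - r) \<le> \<eta>"
            unfolding y_def .
        qed
        moreover have "norm r \<le> \<epsilon>\<^sup>2 * norm R"
          using mult_mono[of "\<bar>fst \<zeta>\<bar>" \<epsilon> "\<bar>snd z\<bar>" \<epsilon>] \<zeta> sz \<epsilon>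
          by (auto simp: r_def power2_eq_square abs_mult intro!: mult_right_mono)
        then have "\<eta> + 2 * \<kappa> * (norm (w0 - W z) + norm r + \<eta>) \<le> \<eta> + 2 * \<kappa> * (norm (w0 - W z) + M)"
          using \<kappa> by (intro add_left_mono mult_left_mono) (auto simp: M_def)
        ultimately show ?thesis by (simp add: r_def)
      qed
      define z0 z1 z2 z3 :: "real \<times> real" where z: "z0 = (0,0)" "z1 = (\<epsilon>,0)" "z2 = (\<epsilon>,\<epsilon>)" "z3 = (0,\<epsilon>)"
      define \<zeta>1 \<zeta>2 \<zeta>3 \<zeta>4 :: "real \<times> real" where
        \<zeta>: "\<zeta>1 = (\<epsilon>,0)" "\<zeta>2 = (0,\<epsilon>)" "\<zeta>3 = (-\<epsilon>,0)" "\<zeta>4 = (0,-\<epsilon>)"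
      have zz: "z0 + \<zeta>1 = z1" "z1 + \<zeta>2 = z2" "z2 + \<zeta>3 = z3" "z3 + \<zeta>4 = z0" by (simp_all add: z \<zeta>)
      have nz: "norm (s, r) \<le> 2 * \<epsilon>" if "\<bar>s\<bar> \<le> \<epsilon>" "\<bar>r\<bar> \<le> \<epsilon>" for s r :: real
        using norm_Pair_le[of s r] that by simp
      have le\<epsilon>: "\<bar>t * \<epsilon>\<bar> \<le> \<epsilon>" "\<bar>\<epsilon> - t * \<epsilon>\<bar> \<le> \<epsilon>" if "t \<in> {0..1}" for t
        using that \<epsilon> by (auto simp: abs_mult mult_left_le_one_le abs_le_iff)
      have zb: "norm (z0 + t *\<^sub>R \<zeta>1) \<le> 2 * \<epsilon>" "norm (z1 + t *\<^sub>R \<zeta>2) \<le> 2 * \<epsilon>"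
          "norm (z2 + t *\<^sub>R \<zeta>3) \<le> 2 * \<epsilon>" "norm (z3 + t *\<^sub>R \<zeta>4) \<le> 2 * \<epsilon>" if "t \<in> {0..1}" for t
        using le\<epsilon>[OF that] \<epsilon> by (auto simp: z \<zeta> intro!: nz)
      have \<zeta>b: "\<bar>fst \<zeta>1\<bar> + \<bar>snd \<zeta>1\<bar> \<le> \<epsilon>" "\<bar>fst \<zeta>2\<bar> + \<bar>snd \<zeta>2\<bar> \<le> \<epsilon>"
          "\<bar>fst \<zeta>3\<bar> + \<bar>snd \<zeta>3\<bar> \<le> \<epsilon>" "\<bar>fst \<zeta>4\<bar> + \<bar>snd \<zeta>4\<bar> \<le> \<epsilon>" using \<epsilon> by (simp_all add: \<zeta>)
      have Pz: "P z0 = x" "P z1 = x + \<epsilon> *\<^sub>R u" "P z2 = x + \<epsilon> *\<^sub>R u + \<epsilon> *\<^sub>R v" "P z3 = x + \<epsilon> *\<^sub>R v"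
        by (simp_all add: P_def z)
      note sU = segU[OF zb(1) \<zeta>b(1), unfolded zz] segU[OF zb(2) \<zeta>b(2), unfolded zz]
        segU[OF zb(3) \<zeta>b(3), unfolded zz] segU[OF zb(4) \<zeta>b(4), unfolded zz]
      note bd = bound[OF zb(1) \<zeta>b(1), unfolded zz] bound[OF zb(2) \<zeta>b(2), unfolded zz]
        bound[OF zb(3) \<zeta>b(3), unfolded zz] bound[OF zb(4) \<zeta>b(4), unfolded zz]
      note ex = parallel_transport_segment[OF pr smooth_on_continuous[OF A]]
      obtain w1 where w1: "parallel_transport nabla (linepath (P z0) (P z1)) w w1" using ex[OF sU(1)] by blast
      obtain w2 where w2: "parallel_transport nabla (linepath (P z1) (P z2)) w1 w2" using ex[OF sU(2)] by blast
      obtain w3 where w3: "parallel_transport nabla (linepath (P z2) (P z3)) w2 w3" using ex[OF sU(3)] by blast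
      obtain w4 where w4: "parallel_transport nabla (linepath (P z3) (P z0)) w3 w4" using ex[OF sU(4)] by blast
      note rect = parallel_transport_rectangle[OF pr, of x "\<epsilon> *\<^sub>R u" "\<epsilon> *\<^sub>R v", folded Pz, OF sU]
      \<comment> \<open>The definite description is resolved edge by edge: each edge is short enough
        for uniqueness of its transport.\<close>
      have hol: "holonomy nabla (rectangle_loop x (\<epsilon> *\<^sub>R u) (\<epsilon> *\<^sub>R v)) w = w4"
        unfolding holonomy_def
      proof (rule the_equality)
        show "parallel_transport nabla (rectangle_loop x (\<epsilon> *\<^sub>R u) (\<epsilon> *\<^sub>R v)) w w4"
          using rect w1 w2 w3 w4 by (auto simp: Pz)
        fix w' assume "parallel_transport nabla (rectangle_loop x (\<epsilon> *\<^sub>R u) (\<epsilon> *\<^sub>R v)) w w'"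
        then obtain w1' w2' w3' where w':
          "parallel_transport nabla (linepath (P z0) (P z1)) w w1'"
          "parallel_transport nabla (linepath (P z1) (P z2)) w1' w2'"
          "parallel_transport nabla (linepath (P z2) (P z3)) w2' w3'"
          "parallel_transport nabla (linepath (P z3) (P z0)) w3' w'" using rect by (auto simp: Pz)
        have "w1' = w1" by (rule parallel_transport_segment_unique[OF pr sU(1) bd(1) \<kappa> \<kappa>1 w'(1) w1])
        then have "w2' = w2"
          using parallel_transport_segment_unique[OF pr sU(2) bd(2) \<kappa> \<kappa>1 w'(2)] w2 by blast
        then have "w3' = w3"
          using parallel_transport_segment_unique[OF pr sU(3) bd(3) \<kappa> \<kappa>1 w'(3)] w3 by blast
        then show "w' = w4"
          using parallel_transport_segment_unique[OF pr sU(4) bd(4) \<kappa> \<kappa>1 w'(4)] w4 by blast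
      qed
      define d1 d2 d3 d4 where dd: "d1 = w1 - W z1" "d2 = w2 - W z2" "d3 = w3 - W z3" "d4 = w4 - W z0"
      have Wz0: "W z0 = w" using W0 by (simp add: z zero_prod_def)
      have e1: "norm d1 \<le> \<eta> + 2 * \<kappa> * M"
        using edge[OF zb(1) \<zeta>b(1), unfolded zz, OF _ _ _ w1] \<epsilon> by (simp add: z \<zeta> dd Wz0[unfolded z])
      have e2: "norm (d2 - d1) \<le> \<eta> + 2 * \<kappa> * (norm d1 + M)"
        using edge[OF zb(2) \<zeta>b(2), unfolded zz, OF _ _ _ w2] \<epsilon> by (simp add: z \<zeta> dd)
      have e3: "norm (d3 - d2 + \<epsilon>\<^sup>2 *\<^sub>R R) \<le> \<eta> + 2 * \<kappa> * (norm d2 + M)"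
        using edge[OF zb(3) \<zeta>b(3), unfolded zz, OF _ _ _ w3] \<epsilon> by (simp add: z \<zeta> dd power2_eq_square)
      have e4: "norm (d4 - d3) \<le> \<eta> + 2 * \<kappa> * (norm d3 + M)"
        using edge[OF zb(4) \<zeta>b(4), unfolded zz, OF _ _ _ w4] \<epsilon> by (simp add: z \<zeta> dd)
      have half: "2 * \<kappa> * y \<le> y" if "0 \<le> y" for y
        using mult_right_mono[OF \<kappa>1 that] by simp
      \<comment> \<open>Crude bounds from \<open>2 * \<kappa> \<le> 1\<close> suffice, because they
        are multiplied by \<kappa> again. They yield the constant
        \<open>74 = 2 * (1 + 4 + 10 + 22)\<close>.\<close>
      have s1: "norm d1 \<le> 3 * M" using e1 half[OF M(1)] M by simp
      have s2: "norm d2 \<le> 9 * M"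
        using e2 half[of "norm d1 + M"] s1 M norm_triangle_ineq2[of d2 d1] by simp
      have s3: "norm d3 \<le> 21 * M"
      proof -
        have "d3 = d2 + ((d3 - d2 + \<epsilon>\<^sup>2 *\<^sub>R R) - \<epsilon>\<^sup>2 *\<^sub>R R)" by simp
        also have "norm \<dots> \<le> norm d2 + (norm (d3 - d2 + \<epsilon>\<^sup>2 *\<^sub>R R) + norm (\<epsilon>\<^sup>2 *\<^sub>R R))"
          by (rule norm_triangle_mono[OF order_refl norm_triangle_ineq4])
        also have "norm (\<epsilon>\<^sup>2 *\<^sub>R R) = \<epsilon>\<^sup>2 * norm R" by simp
        finally have "norm d3 \<le> norm d2 + (norm (d3 - d2 + \<epsilon>\<^sup>2 *\<^sub>R R) + \<epsilon>\<^sup>2 * norm R)" .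
        then show ?thesis using e3 half[of "norm d2 + M"] s2 M unfolding M_def by simp
      qed
      have m: "2 * \<kappa> * (norm d1 + M) \<le> 2 * \<kappa> * (4 * M)" "2 * \<kappa> * (norm d2 + M) \<le> 2 * \<kappa> * (10 * M)"
         "2 * \<kappa> * (norm d3 + M) \<le> 2 * \<kappa> * (22 * M)"
        by (rule mult_left_mono; use s1 s2 s3 \<kappa> in linarith)+
      have "w4 - w + \<epsilon>\<^sup>2 *\<^sub>R R = d1 + (d2 - d1) + (d3 - d2 + \<epsilon>\<^sup>2 *\<^sub>R R) + (d4 - d3)"
        by (simp add: dd Wz0)
      also have "norm \<dots> \<le> norm d1 + norm (d2 - d1) + norm (d3 - d2 + \<epsilon>\<^sup>2 *\<^sub>R R) + norm (d4 - d3)"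
        by (intro norm_triangle_le add_mono order_refl)
      also have "\<dots> \<le> 4 * \<eta> + 74 * \<kappa> * M"
        using e1 e2 e3 e4 m by (simp add: algebra_simps)
      also have "\<dots> = \<epsilon>\<^sup>2 * (8 * \<delta> + \<epsilon> * (74 * (2 * C * K) * (norm R + 2 * \<delta>)))"
        by (simp add: \<eta>_def \<kappa>_def M_def algebra_simps)
      also have "\<dots> < \<epsilon>\<^sup>2 * e"
      proof (intro mult_strict_left_mono)
        have "\<epsilon> * (74 * (2 * C * K) * (norm R + 2 * \<delta>)) \<le> \<epsilon> * S"
          using C K \<epsilon> by (intro mult_left_mono) (auto simp: S_def)
        then show "8 * \<delta> + \<epsilon> * (74 * (2 * C * K) * (norm R + 2 * \<delta>)) < e"
          using \<epsilon>'(5) e by (simp add: \<delta>_def)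
      qed (use \<epsilon> in simp)
      finally have lt: "norm (w4 - w + \<epsilon>\<^sup>2 *\<^sub>R R) < \<epsilon>\<^sup>2 * e" .
      have "(w4 - w) /\<^sub>R \<epsilon>\<^sup>2 - (- R) = (w4 - w + \<epsilon>\<^sup>2 *\<^sub>R R) /\<^sub>R \<epsilon>\<^sup>2"
        using \<epsilon> by (simp add: scaleR_add_right)
      then have "norm ((w4 - w) /\<^sub>R \<epsilon>\<^sup>2 - (- R)) < e"
        using lt \<epsilon> by (simp add: inverse_eq_divide pos_divide_less_eq mult.commute)
      then show ?thesis unfolding hol R dist_norm .
    qed
    then show "\<forall>\<^sub>F \<epsilon> in at_right 0. dist ((holonomy nabla (rectangle_loop x (\<epsilon> *\<^sub>R u) (\<epsilon> *\<^sub>R v)) w - w) /\<^sub>R \<epsilon>\<^sup>2)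
        (- projective_curvature A x u v w) < e"
      using \<epsilon>0 unfolding eventually_at_right_field by blast
  qed
qed

section \<open>Invariant volume forms\<close>

lemma has_real_derivative_det:
  fixes E :: "real \<Rightarrow> real ^ 'n::finite ^ 'n"
  assumes "\<And>i. ((\<lambda>t. E t $ i) has_vector_derivative E' $ i) (at t)"
  shows "((\<lambda>t. det (E t)) has_real_derivative
     (\<Sum>k\<in>UNIV. det (\<chi> i. if i = k then E' $ i else E t $ i))) (at t)"
proof -
  have comp: "((\<lambda>t. E t $ i $ j) has_real_derivative E' $ i $ j) (at t)" for i j
    using bounded_linear.has_vector_derivative[OF bounded_linear_vec_nth assms]
    by (simp add: has_real_derivative_iff_has_vector_derivative)
  have "((\<lambda>t. det (E t)) has_real_derivative
     (\<Sum>p | p permutes (UNIV :: 'n set). of_int (sign p) *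
        (\<Sum>k\<in>UNIV. E' $ k $ p k * (\<Prod>i\<in>UNIV - {k}. E t $ i $ p i)))) (at t)"
    unfolding det_def
    by (intro DERIV_sum DERIV_cmult has_field_derivative_prod comp)
  also have "(\<Sum>p | p permutes (UNIV :: 'n set). of_int (sign p) *
        (\<Sum>k\<in>UNIV. E' $ k $ p k * (\<Prod>i\<in>UNIV - {k}. E t $ i $ p i))) =
     (\<Sum>k\<in>UNIV. det (\<chi> i. if i = k then E' $ i else E t $ i))"
  proof -
    have "(\<Prod>i\<in>UNIV. (\<chi> i. if i = k then E' $ i else E t $ i) $ i $ p i) =
        E' $ k $ p k * (\<Prod>i\<in>UNIV - {k}. E t $ i $ p i)" for k :: 'n and p
      by (subst prod.remove[of UNIV k]) (auto intro!: prod.cong)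
    then show ?thesis
      unfolding det_def sum_distrib_left by (subst sum.swap) simp
  qed
  finally show ?thesis .
qed

text \<open>Both sides are the derivative at 0 of \<open>det (E ** (mat 1 + t N))\<close>, computed
  row by row and by multiplicativity. In this way \<open>E\<close> may be singular.\<close>

lemma sum_det_replace_row:
  fixes E N :: "real ^ 'n::finite ^ 'n"
  shows "(\<Sum>k\<in>UNIV. det (\<chi> i. if i = k then (E ** N) $ i else E $ i)) = trace N * det E"
proof -
  have tr: "(\<Sum>k\<in>UNIV. det (\<chi> i. if i = k then N $ i else mat 1 $ i)) = trace N"
  proof -
    have "det (\<chi> i. if i = k then N $ i else (mat 1 :: real ^ 'n ^ 'n) $ i) = N $ k $ k" for k
    proof -
      have "(\<Sum>i\<in>UNIV. N $ k $ i *s row i (mat 1 :: real ^ 'n ^ 'n)) = N $ k"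
        by (simp add: vec_eq_iff row_def mat_def if_distrib cong: if_cong)
      then have "(\<chi> i. if i = k then N $ i else (mat 1 :: real ^ 'n ^ 'n) $ i) =
          (\<chi> i. if i = k then \<Sum>i\<in>UNIV. N $ k $ i *s row i (mat 1) else row i (mat 1))"
        by (simp add: vec_eq_iff row_def)
      then show ?thesis using cramer_lemma_transpose[of k "N $ k" "mat 1"] by simp
    qed
    then show ?thesis by (simp add: trace_def)
  qed
  have rows: "((\<lambda>t. (P + t *\<^sub>R Q) $ i) has_vector_derivative Q $ i) (at 0)" for P Q :: "real ^ 'n ^ 'n" and i
    unfolding vector_add_component vector_scaleR_component
    by (auto intro!: derivative_eq_intros)
  have 1: "((\<lambda>t. det (mat 1 + t *\<^sub>R N)) has_real_derivative trace N) (at 0)"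
    using has_real_derivative_det[OF rows, of "mat 1" N] tr
    unfolding scaleR_zero_left add_0_right by simp
  have "E ** (mat 1 + t *\<^sub>R N) = E + t *\<^sub>R (E ** N)" for t
    by (simp add: matrix_add_ldistrib matrix_scalar_ac scalar_matrix_assoc)
  then have 2: "((\<lambda>t. det (E ** (mat 1 + t *\<^sub>R N))) has_real_derivative
      (\<Sum>k\<in>UNIV. det (\<chi> i. if i = k then (E ** N) $ i else E $ i))) (at 0)"
    using has_real_derivative_det[OF rows, of E "E ** N"]
    unfolding scaleR_zero_left add_0_right by simp
  have "((\<lambda>t. det (E ** (mat 1 + t *\<^sub>R N))) has_real_derivative det E * trace N) (at 0)"
    unfolding det_mul by (rule DERIV_cmult[OF 1])
  then show ?thesis using DERIV_unique[OF 2] by (simp add: mult.commute)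
qed

text \<open>A parallel frame satisfies \<open>E' = E ** N\<close>, where \<open>- N\<close> is
  \<open>(A \<bullet> c')\<close> times the identity plus a rank-one matrix of trace
  \<open>A \<bullet> c'\<close>. The two traces add up to the factor \<open>d + 1\<close>.\<close>

lemma has_real_derivative_det_parallel:
  fixes E :: "real \<Rightarrow> real ^ 'n::finite ^ 'n"
  assumes "projective_on U A nabla" "c t \<in> U" "\<And>i. parallel_at nabla c (\<lambda>s. E s $ i) t"
  shows "((\<lambda>s. det (E s)) has_real_derivative
     - (real CARD('n) + 1) * (A (c t) \<bullet> vector_derivative c (at t)) * det (E t)) (at t)"
proof -
  define a where "a = A (c t)"
  define e where "e = vector_derivative c (at t)"
  define N :: "real ^ 'n ^ 'n" where "N = (\<chi> j l. - ((if j = l then a \<bullet> e else 0) + a $ j * e $ l))"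
  have "(E t ** N) $ i = - ((a \<bullet> e) *\<^sub>R (E t $ i) + (a \<bullet> E t $ i) *\<^sub>R e)" for i
  proof -
    have "(\<Sum>k\<in>UNIV. E t $ i $ k * - ((if k = l then a \<bullet> e else 0) + a $ k * e $ l)) =
        - ((a \<bullet> e) * E t $ i $ l + (\<Sum>k\<in>UNIV. a $ k * E t $ i $ k) * e $ l)" for l
    proof -
      have "E t $ i $ k * - ((if k = l then a \<bullet> e else 0) + a $ k * e $ l) =
          (if k = l then - ((a \<bullet> e) * E t $ i $ l) else 0) - (a $ k * E t $ i $ k) * e $ l" for k
        by (simp add: algebra_simps)
      then show ?thesis by (simp add: sum_subtractf sum_distrib_right)
    qed
    then show ?thesis
      by (simp add: vec_eq_iff matrix_matrix_mult_def N_def inner_vec_def[of a "E t $ i"])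
  qed
  then have "((\<lambda>s. E s $ i) has_vector_derivative (E t ** N) $ i) (at t)" for i
    using assms(3)[of i] unfolding parallel_at_def projective_onD[OF assms(1,2)] a_def e_def by simp
  from has_real_derivative_det[OF this]
  have "((\<lambda>s. det (E s)) has_real_derivative trace N * det (E t)) (at t)"
    unfolding sum_det_replace_row .
  moreover have "trace N = - (real CARD('n) + 1) * (a \<bullet> e)"
  proof -
    have "(\<Sum>i\<in>UNIV. a $ i * e $ i) = a \<bullet> e" by (simp add: inner_vec_def)
    then show ?thesis by (simp add: trace_def N_def sum.distrib sum_negf sum_subtractf algebra_simps)
  qed
  ultimately show ?thesis by (simp add: a_def e_def)
qed

text \<open>The logarithmic derivative of \<rho> along \<open>c\<close> is
  \<open>(d + 1) (A \<bullet> c')\<close>, the opposite of that of the determinant of a parallel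
  frame, so the product is constant off a finite set of times and, by continuity,
  throughout.\<close>

lemma incompressible_of_density:
  fixes A :: "'n::finite field"
  assumes U: "open U" and pr: "projective_on U A nabla" and \<rho>: "smooth_on U \<rho>" "\<And>x. x \<in> U \<Longrightarrow> \<rho> x \<noteq> 0"
    and d\<rho>: "\<And>x u. x \<in> U \<Longrightarrow> frechet_derivative \<rho> (at x) u = (real CARD('n) + 1) * \<rho> x * (A x \<bullet> u)"
  shows "incompressible U nabla"
  unfolding incompressible_def
proof (intro ballI exI[of _ U] exI[of _ \<rho>] conjI allI impI)
  fix c and E F :: "real ^ 'n ^ 'n"
  assume c: "valid_path c" "path_image c \<subseteq> U" and EF: "\<forall>i. parallel_transport nabla c (E $ i) (F $ i)"
  have "\<forall>i. \<exists>V S. continuous_on {0..1} V \<and> finite S \<and> (\<forall>t\<in>{0..1} - S. parallel_at nabla c V t) \<and>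
      V 0 = E $ i \<and> V 1 = F $ i"
    using EF unfolding parallel_transport_def by blast
  then obtain V S where V: "\<And>i. continuous_on {0..1} (V i)" "\<And>i. finite (S i)"
      "\<And>i t. t \<in> {0..1} - S i \<Longrightarrow> parallel_at nabla c (V i) t" "\<And>i. V i 0 = E $ i" "\<And>i. V i 1 = F $ i"
    by metis
  obtain S0 where S0: "finite S0" "continuous_on {0..1} c"
    "\<And>t. t \<in> {0..1} - S0 \<Longrightarrow> (c has_vector_derivative vector_derivative c (at t)) (at t)"
    using c(1) unfolding valid_path_def piecewise_C1_differentiable_on_def C1_differentiable_on_eq
    by (auto simp: vector_derivative_works)
  define M where "M t = (\<chi> i. V i t)" for t
  define T where "T = S0 \<union> (\<Union>i\<in>UNIV. S i)"
  have cU: "c t \<in> U" if "t \<in> {0..1}" for t using c(2) that by (auto simp: path_image_def)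
  have "((\<lambda>t. \<rho> (c t) * det (M t)) has_vector_derivative 0) (at t)" if t: "t \<in> {0..1} - T" for t
  proof -
    have ct: "c t \<in> U" using cU t by blast
    have "((\<lambda>t. \<rho> (c t)) has_vector_derivative frechet_derivative \<rho> (at (c t)) (vector_derivative c (at t))) (at t)"
      using vector_derivative_diff_chain_within[of c "vector_derivative c (at t)" t UNIV \<rho> "frechet_derivative \<rho> (at (c t))"]
        S0(3)[of t] t has_derivative_at_withinI[OF smooth_on_has_derivative[OF \<rho>(1) ct]]
      by (auto simp: T_def o_def)
    then have 1: "((\<lambda>t. \<rho> (c t)) has_real_derivative frechet_derivative \<rho> (at (c t)) (vector_derivative c (at t))) (at t)"
      by (simp add: has_real_derivative_iff_has_vector_derivative)
    have 2: "((\<lambda>t. det (M t)) has_real_derivative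
       - (real CARD('n) + 1) * (A (c t) \<bullet> vector_derivative c (at t)) * det (M t)) (at t)"
      by (rule has_real_derivative_det_parallel[OF pr, where c = c]) (use ct V(3) t in \<open>auto simp: M_def T_def\<close>)
    show ?thesis
      using DERIV_mult[OF 1 2] d\<rho>[OF ct]
      by (simp add: has_real_derivative_iff_has_vector_derivative algebra_simps)
  qed
  moreover have "continuous_on {0..1} (\<lambda>t. \<rho> (c t) * det (M t))"
    unfolding det_def M_def
    by (intro continuous_intros continuous_on_compose2[OF smooth_on_continuous[OF \<rho>(1)] S0(2)])
       (use cU V(1) in \<open>auto intro!: continuous_intros\<close>)
  ultimately have "norm (\<rho> (c 1) * det (M 1) - \<rho> (c 0) * det (M 0)) \<le> 0"
    using S0(1) V(2)
    by (intro norm_diff_le_of_derivative_bound[where S = T and f' = "\<lambda>_. 0"]) (auto simp: T_def)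
  then show "\<rho> (pathfinish c) * det F = \<rho> (pathstart c) * det E"
    by (simp add: M_def V pathfinish_def pathstart_def)
qed (use U \<rho> in auto)

text \<open>The standard frame is transported along a short segment centred at \<open>y\<close>, and
  the invariant \<open>\<rho> * det\<close> is differentiated at the midpoint, where two-sided
  derivatives are available.\<close>

lemma incompressible_density:
  fixes A :: "'n::finite field"
  assumes inc: "incompressible U nabla" and U: "open U" and A: "smooth_on U A"
    and pr: "projective_on U A nabla" and "x \<in> U"
  obtains V \<rho> where "open V" "x \<in> V" "V \<subseteq> U" "smooth_on V (\<rho> :: real ^ 'n \<Rightarrow> real)" "\<And>y. y \<in> V \<Longrightarrow> \<rho> y \<noteq> 0"
    "\<And>y u. y \<in> V \<Longrightarrow> frechet_derivative \<rho> (at y) u = (real CARD('n) + 1) * \<rho> y * (A y \<bullet> u)"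
proof -
  obtain V and \<rho> :: "real ^ 'n \<Rightarrow> real"
    where V: "open V" "x \<in> V" "V \<subseteq> U" and \<rho>: "smooth_on V \<rho>" "\<And>y. y \<in> V \<Longrightarrow> \<rho> y \<noteq> 0"
    and tr: "\<And>c (E :: real ^ 'n ^ 'n) F. valid_path c \<Longrightarrow> path_image c \<subseteq> V \<Longrightarrow>
           (\<And>i. parallel_transport nabla c (E $ i) (F $ i)) \<Longrightarrow>
           \<rho> (pathfinish c) * det F = \<rho> (pathstart c) * det E"
    using inc \<open>x \<in> U\<close> unfolding incompressible_def by metis
  have "frechet_derivative \<rho> (at y) u = (real CARD('n) + 1) * \<rho> y * (A y \<bullet> u)" if y: "y \<in> V" for y u
  proof -
    obtain r where r: "r > 0" "ball y r \<subseteq> V" using V(1) y open_contains_ball by blast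
    define s where "s = r / (norm u + 1)"
    have s: "s > 0" "s * norm u < r"
    proof -
      have n: "norm u + 1 > 0" by (simp add: add_nonneg_pos)
      then show "s > 0" using r by (simp add: s_def)
      show "s * norm u < r" using r n by (simp add: s_def pos_divide_less_eq distrib_left)
    qed
    define p where "p = y - s *\<^sub>R u"
    define q where "q = y + s *\<^sub>R u"
    have pq: "p \<in> ball y r" "q \<in> ball y r" using s by (auto simp: p_def q_def dist_norm)
    have segV: "closed_segment p q \<subseteq> V"
      using closed_segment_subset[OF pq convex_ball] r by blast
    then have segU: "closed_segment p q \<subseteq> U" using V by blast
    have "\<forall>i. \<exists>X. continuous_on {0..1} X \<and> X 0 = axis i 1 \<and> (\<forall>t\<in>{0<..<1}. parallel_at nabla (linepath p q) X t)"
      using parallel_transport_segment_exists[OF pr smooth_on_continuous[OF A] segU] by metis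
    then obtain X where X: "\<And>i. continuous_on {0..1} (X i)" "\<And>i. X i 0 = axis i 1"
      "\<And>i t. t \<in> {0<..<1} \<Longrightarrow> parallel_at nabla (linepath p q) (X i) t" by metis
    define E :: "real \<Rightarrow> real ^ 'n ^ 'n" where "E t = (\<chi> i. X i t)" for t
    have inV: "linepath p q t \<in> V" if "t \<in> {0..1}" for t
      using segV that by (auto simp: linepath_in_path)
    have mat1: "(mat 1 :: real ^ 'n ^ 'n) $ i = axis i 1" for i by (auto simp: vec_eq_iff mat_def axis_def)
    \<comment> \<open>Invariance concerns whole paths, so it is applied to the initial piece of the
      segment up to time \<open>t\<close>, rescaled to the unit interval.\<close>
    have const: "\<rho> (linepath p q t) * det (E t) = \<rho> p" if t: "t \<in> {0<..<1}" for t
    proof -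
      have lp: "linepath p (linepath p q t) = (\<lambda>s. linepath p q (t * s + 0))"
        by (auto simp: linepath_def algebra_simps)
      have "parallel_transport nabla (linepath p (linepath p q t)) (axis i 1) (X i t)" for i
        unfolding parallel_transport_def
      proof (intro exI[of _ "\<lambda>s. X i (t * s + 0)"] conjI exI[of _ "{0,1}"] ballI)
        have ts: "t * s \<in> {0..1}" if "s \<in> {0..1}" for s using t that by (auto intro: mult_le_one)
        show "continuous_on {0..1} (\<lambda>s. X i (t * s + 0))"
          by (intro continuous_on_compose2[OF X(1)] continuous_intros) (use ts in auto)
        fix s :: real assume s: "s \<in> {0..1} - {0,1}"
        have "t * s + 0 \<in> {0<..<1}"
          using t s mult_strict_mono[of t 1 s 1] by auto
        then show "parallel_at nabla (linepath p (linepath p q t)) (\<lambda>s. X i (t * s + 0)) s"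
          unfolding lp
          by (intro parallel_at_affine[OF pr _ differentiable_linepath X(3)]) (use inV V(3) in auto)
      qed (use X(2) in auto)
      moreover have "path_image (linepath p (linepath p q t)) \<subseteq> V"
      proof -
        have "linepath p q t \<in> closed_segment p q" using t by (auto simp: linepath_in_path)
        then have "linepath p q t \<in> ball y r" using closed_segment_subset[OF pq convex_ball] by blast
        then show ?thesis using closed_segment_subset[OF pq(1) _ convex_ball] r(2) by auto
      qed
      ultimately have "\<rho> (linepath p q t) * det (E t) = \<rho> p * det (mat 1 :: real ^ 'n ^ 'n)"
        using tr[of "linepath p (linepath p q t)" "mat 1" "E t"] by (simp add: E_def mat1)
      then show ?thesis by simp
    qed
    have y2: "linepath p q (1/2) = y" by (simp add: linepath_def p_def q_def algebra_simps flip: scaleR_add_left)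
    have e: "vector_derivative (linepath p q) (at t) = (2 * s) *\<^sub>R u" for t
      by (simp add: vector_derivative_linepath_at p_def q_def flip: scaleR_add_left)
    have "((\<lambda>t. \<rho> (linepath p q t)) has_vector_derivative frechet_derivative \<rho> (at y) ((2 * s) *\<^sub>R u)) (at (1/2))"
      using vector_derivative_diff_chain_within[of "linepath p q" "(2 * s) *\<^sub>R u" "1/2" UNIV \<rho> "frechet_derivative \<rho> (at y)"]
        differentiable_linepath[of p q "1/2"] has_derivative_at_withinI[OF smooth_on_has_derivative[OF \<rho>(1) y]]
      unfolding vector_derivative_works e y2 by (simp add: o_def)
    then have 1: "((\<lambda>t. \<rho> (linepath p q t)) has_real_derivative frechet_derivative \<rho> (at y) ((2 * s) *\<^sub>R u)) (at (1/2))"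
      by (simp add: has_real_derivative_iff_has_vector_derivative)
    have 2: "((\<lambda>t. det (E t)) has_real_derivative
       - (real CARD('n) + 1) * (A y \<bullet> (2 * s) *\<^sub>R u) * det (E (1/2))) (at (1/2))"
      using has_real_derivative_det_parallel[OF pr, of "linepath p q" "1/2" E] X(3)[of "1/2"] V(3) y
      unfolding y2 e by (auto simp: E_def)
    have 3: "((\<lambda>t. \<rho> (linepath p q t) * det (E t)) has_real_derivative 0) (at (1/2))"
    proof (rule has_field_derivative_transform_within_open[OF DERIV_const open_greaterThanLessThan[of 0 1]])
      show "\<rho> p = \<rho> (linepath p q t) * det (E t)" if "t \<in> {0<..<1}" for t using const[OF that] by simp
    qed auto
    have "frechet_derivative \<rho> (at y) ((2 * s) *\<^sub>R u) * det (E (1/2)) =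
       (real CARD('n) + 1) * \<rho> y * (A y \<bullet> (2 * s) *\<^sub>R u) * det (E (1/2))"
      using DERIV_unique[OF DERIV_mult[OF 1 2] 3] unfolding y2 by (simp add: algebra_simps)
    \<comment> \<open>Transport preserves independence of the frame here because the conserved
      quantity \<open>\<rho> p\<close> is nonzero.\<close>
    moreover have "det (E (1/2)) \<noteq> 0"
    proof
      assume "det (E (1/2)) = 0"
      then have "\<rho> p = 0" using const[of "1/2"] by simp
      then show False using \<rho>(2)[of p] pq r by blast
    qed
    ultimately show ?thesis
      using s(1) by (simp add: linear_cmul[OF frechet_linear[OF \<rho>(1) y]])
  qed
  then show ?thesis using that V \<rho> by blast
qed

text \<open>Locally \<open>(d + 1) A\<close> is the gradient of the logarithm of
  \<open>|\<rho>|\<close>. The second derivatives of \<rho> itself are compared, which avoids the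
  logarithm: their part quadratic in \<open>A\<close> is symmetric and cancels.\<close>

lemma incompressible_imp_closed:
  assumes inc: "incompressible U nabla" and U: "open U" and A: "smooth_on U A"
    and pr: "projective_on U A nabla" and x: "x \<in> U"
  shows "frechet_derivative A (at x) u \<bullet> v = frechet_derivative A (at x) v \<bullet> u"
proof -
  obtain V \<rho> where V: "open V" "x \<in> V" "V \<subseteq> U" and \<rho>: "smooth_on V (\<rho> :: real ^ 'a \<Rightarrow> real)" "\<And>y. y \<in> V \<Longrightarrow> \<rho> y \<noteq> 0"
    and d\<rho>: "\<And>y u. y \<in> V \<Longrightarrow> frechet_derivative \<rho> (at y) u = (real CARD('a) + 1) * \<rho> y * (A y \<bullet> u)"
    using incompressible_density[OF assms] by blast
  define k where "k = real CARD('a) + 1"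
  have k: "k \<noteq> 0" by (simp add: k_def add_nonneg_eq_0_iff)
  have "frechet_derivative (\<lambda>y. frechet_derivative \<rho> (at y) b) (at x) a =
     k * (\<rho> x * (frechet_derivative A (at x) a \<bullet> b) + (k * \<rho> x * (A x \<bullet> a)) * (A x \<bullet> b))" for a b
  proof -
    have "((\<lambda>y. k * (\<rho> y * (A y \<bullet> b))) has_derivative
        (\<lambda>h. k * (\<rho> x * (frechet_derivative A (at x) h \<bullet> b) + frechet_derivative \<rho> (at x) h * (A x \<bullet> b)))) (at x)"
      by (intro has_derivative_mult_right has_derivative_mult has_derivative_inner_left
          smooth_on_has_derivative[OF A x] smooth_on_has_derivative[OF \<rho>(1) V(2)])
    then have "((\<lambda>y. frechet_derivative \<rho> (at y) b) has_derivative
        (\<lambda>h. k * (\<rho> x * (frechet_derivative A (at x) h \<bullet> b) + frechet_derivative \<rho> (at x) h * (A x \<bullet> b)))) (at x)"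
      by (rule has_derivative_transform_within_open[OF _ V(1,2)]) (simp add: d\<rho> k_def)
    from frechet_derivative_eqI[OF this] show ?thesis by (simp add: d\<rho>[OF V(2)] k_def)
  qed
  then show ?thesis
    using frechet_derivative_commute[OF V(1) \<rho>(1) V(2), of v u] k \<rho>(2)[OF V(2)] by auto
qed

section \<open>Curvature\<close>

text \<open>Identifies the tensor of the non-vanishing condition, defined by covariant derivatives,
  with the expression found in the holonomy expansion.\<close>

lemma curvature_tensor_projective:
  assumes "affine_connection U nabla" "open U" "smooth_on U A" "projective_on U A nabla" "x \<in> U"
  shows "curvature_tensor nabla x u v w = projective_curvature A x u v w"
proof -
  have c: "smooth_on U (\<lambda>_. e)" for e :: "real ^ 'a" by (rule smooth_on_const[OF assms(2)])
  have ac: "smooth_on U (nabla (\<lambda>_. v) (\<lambda>_. w))" for v w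
    using conjunct1[OF assms(1)[unfolded affine_connection_def]] c[of v] c[of w] by blast
  have Y: "nabla (\<lambda>_. v) (\<lambda>_. w) y = (A y \<bullet> v) *\<^sub>R w + (A y \<bullet> w) *\<^sub>R v" if "y \<in> U" for y v w
    using projective_onD[OF assms(4) that] by (simp add: christoffel_def)
  have dY: "frechet_derivative (nabla (\<lambda>_. v) (\<lambda>_. w)) (at x) u =
      (frechet_derivative A (at x) u \<bullet> v) *\<^sub>R w + (frechet_derivative A (at x) u \<bullet> w) *\<^sub>R v" for u v w
  proof -
    have "((\<lambda>y. (A y \<bullet> v) *\<^sub>R w + (A y \<bullet> w) *\<^sub>R v) has_derivative
       (\<lambda>h. (frechet_derivative A (at x) h \<bullet> v) *\<^sub>R w + (frechet_derivative A (at x) h \<bullet> w) *\<^sub>R v)) (at x)"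
      by (intro has_derivative_add has_derivative_scaleR_left has_derivative_inner_left
          smooth_on_has_derivative[OF assms(3,5)])
    then have "(nabla (\<lambda>_. v) (\<lambda>_. w) has_derivative
       (\<lambda>h. (frechet_derivative A (at x) h \<bullet> v) *\<^sub>R w + (frechet_derivative A (at x) h \<bullet> w) *\<^sub>R v)) (at x)"
      by (rule has_derivative_transform_within_open[OF _ assms(2,5)]) (simp add: Y)
    then show ?thesis by (simp add: frechet_derivative_eqI)
  qed
  have "nabla (\<lambda>_. u) (nabla (\<lambda>_. v) (\<lambda>_. w)) x =
     (frechet_derivative A (at x) u \<bullet> v) *\<^sub>R w + (frechet_derivative A (at x) u \<bullet> w) *\<^sub>R v +
     ((A x \<bullet> u) *\<^sub>R ((A x \<bullet> v) *\<^sub>R w + (A x \<bullet> w) *\<^sub>R v) + (A x \<bullet> ((A x \<bullet> v) *\<^sub>R w + (A x \<bullet> w) *\<^sub>R v)) *\<^sub>R u)" for u v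
    unfolding affine_connection_christoffel[OF assms(1,2) c ac assms(5)] dY projective_onD[OF assms(4,5)] Y[OF assms(5)] ..
  moreover have "lie_bracket (\<lambda>_. u) (\<lambda>_. v) = (\<lambda>_. 0)"
    by (simp add: lie_bracket_def fun_eq_iff)
  moreover have "nabla (\<lambda>_. 0) (\<lambda>_. w) x = 0"
    using Y[OF assms(5), of 0 w] by simp
  ultimately show ?thesis
    by (simp add: curvature_tensor_def curvature_def projective_curvature_def inner_add_right vec_mult_2 algebra_simps)
qed

section \<open>Fields whose curvature is of constant type\<close>

lemma standard_metric_inner: "standard_metric x u v = u \<bullet> v"
  by (simp add: standard_metric_def inner_vec_def)

text \<open>The tensor \<open>DA - A \<otimes> A\<close> is a multiple \<open>l\<close> of the
  metric. The curvature at each point is then that of a space of constant sectional curvature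
  \<open>- l x\<close>.\<close>

definition constant_type :: "(real ^ 'n::finite) set \<Rightarrow> 'n field \<Rightarrow> (real ^ 'n \<Rightarrow> real) \<Rightarrow> bool" where
  "constant_type U A l \<longleftrightarrow>
     (\<forall>x\<in>U. \<forall>u. frechet_derivative A (at x) u = (A x \<bullet> u) *\<^sub>R A x + l x *\<^sub>R u)"

lemma projective_curvature_constant_type:
  assumes "constant_type U A l" "x \<in> U"
  shows "projective_curvature A x u v w = l x *\<^sub>R ((u \<bullet> w) *\<^sub>R v - (v \<bullet> w) *\<^sub>R u)"
  using assms by (simp add: projective_curvature_def constant_type_def inner_add_left inner_commute algebra_simps)

text \<open>The generator is skew for the Euclidean metric, hence an infinitesimal isometry: a
  similarity with constant 0.\<close>

lemma infinitesimally_conformal_of_constant_type: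
  assumes "open U" "smooth_on U A" "projective_on U A nabla" "constant_type U A l"
  shows "infinitesimally_conformal U standard_metric nabla"
  unfolding infinitesimally_conformal_def
proof (intro ballI allI impI exI conjI)
  fix x u v w assume x: "x \<in> U"
  show "((\<lambda>\<epsilon>. (holonomy nabla (rectangle_loop x (\<epsilon> *\<^sub>R u) (\<epsilon> *\<^sub>R v)) w - w) /\<^sub>R \<epsilon>\<^sup>2)
     \<longlongrightarrow> - projective_curvature A x u v w) (at_right 0)"
    by (rule holonomy_rectangle_limit[OF assms(1-3) x])
  show "infinitesimal_similarity (standard_metric x) (\<lambda>w. - projective_curvature A x u v w)"
    unfolding infinitesimal_similarity_def projective_curvature_constant_type[OF assms(4) x]
    by (auto intro!: exI[of _ 0] linearI
        simp: standard_metric_inner inner_add_right inner_diff_right inner_diff_left inner_commute algebra_simps)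
qed

text \<open>For basis vectors \<open>a\<close>, \<open>b\<close>, testing the similarity on
  \<open>(a, a)\<close> and \<open>(b, b)\<close> gives
  \<open>2 (L b \<bullet> a) = c = - 2 (L a \<bullet> b)\<close>, so symmetry of \<open>L\<close>
  forces both to vanish; testing on \<open>(a, b)\<close> gives
  \<open>L a \<bullet> a = L b \<bullet> b\<close>. Thus \<open>L\<close> is scalar.\<close>

lemma constant_type_of_infinitesimally_conformal:
  assumes U: "open U" and A: "smooth_on U A" and pr: "projective_on U A nabla"
    and closed: "\<And>x u v. x \<in> U \<Longrightarrow> frechet_derivative A (at x) u \<bullet> v = frechet_derivative A (at x) v \<bullet> u"
    and conf: "infinitesimally_conformal U standard_metric nabla"
  shows "\<exists>l. constant_type U A l"
proof -
  have "\<exists>l. \<forall>u. frechet_derivative A (at x) u = (A x \<bullet> u) *\<^sub>R A x + l *\<^sub>R u" if x: "x \<in> U" for x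
  proof -
    define L where "L u = frechet_derivative A (at x) u - (A x \<bullet> u) *\<^sub>R A x" for u
    have lin: "linear L"
      unfolding L_def
      by (intro linearI) (simp_all add: linear_add[OF frechet_linear[OF A x]] linear_cmul[OF frechet_linear[OF A x]]
          inner_add_right algebra_simps)
    have symL: "L u \<bullet> v = L v \<bullet> u" for u v
      unfolding L_def inner_diff_left inner_scaleR_left closed[OF x, of u v] by (simp only: mult.commute)
    have pair: "L a \<bullet> b = 0 \<and> L a \<bullet> a = L b \<bullet> b" if ab: "a \<in> Basis" "b \<in> Basis" "a \<noteq> b" for a b
    proof -
      have "independent {a, b}" by (rule independent_mono[OF independent_Basis]) (use ab in auto)
      then obtain M where M: "infinitesimal_similarity (standard_metric x) M"
        and lim: "\<And>w. ((\<lambda>\<epsilon>. (holonomy nabla (rectangle_loop x (\<epsilon> *\<^sub>R a) (\<epsilon> *\<^sub>R b)) w - w) /\<^sub>R \<epsilon>\<^sup>2) \<longlongrightarrow> M w) (at_right 0)"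
        using conf x ab(3) unfolding infinitesimally_conformal_def by blast
      have 1: "M w = - projective_curvature A x a b w" for w
        by (rule tendsto_unique[OF _ lim holonomy_rectangle_limit[OF U A pr x]]) simp
      have 2: "projective_curvature A x a b w = (L a \<bullet> w) *\<^sub>R b - (L b \<bullet> w) *\<^sub>R a" for w
        unfolding projective_curvature_def L_def inner_diff_left closed[OF x, of a b] by simp
      have Mw: "M w = (L b \<bullet> w) *\<^sub>R a - (L a \<bullet> w) *\<^sub>R b" for w
        unfolding 1 2 by simp
      obtain c where c: "\<And>v w. M v \<bullet> w + v \<bullet> M w = c * (v \<bullet> w)"
        using M unfolding infinitesimal_similarity_def standard_metric_inner by blast
      note on = inner_same_Basis[OF ab(1)] inner_same_Basis[OF ab(2)]
        inner_not_same_Basis[OF ab] inner_not_same_Basis[OF ab(2,1) ab(3)[symmetric]]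
      have "2 * (L b \<bullet> a) = c" "- 2 * (L a \<bullet> b) = c" "- (L a \<bullet> a) + L b \<bullet> b = 0"
        using c[of a a] c[of b b] c[of a b] by (simp_all add: Mw inner_diff_left inner_diff_right on)
      then show ?thesis using symL[of a b] by simp
    qed
    obtain b0 :: "real ^ 'a" where b0: "b0 \<in> Basis" using nonempty_Basis by blast
    define l where "l = L b0 \<bullet> b0"
    have "L b = l *\<^sub>R b" if b: "b \<in> Basis" for b
    proof (rule euclidean_eqI)
      fix b' :: "real ^ 'a" assume b': "b' \<in> Basis"
      show "L b \<bullet> b' = l *\<^sub>R b \<bullet> b'"
        using pair[of b b'] pair[of b b0] b b' b0
        by (cases "b = b'"; cases "b = b0") (auto simp: l_def inner_not_same_Basis)
    qed
    then have "L = (\<lambda>u. l *\<^sub>R u)"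
      by (rule linear_eq_stdbasis[OF lin linear_scale_self[of l]])
    then have "L u = l *\<^sub>R u" for u by simp
    then show ?thesis unfolding L_def by (intro exI[of _ l]) (simp add: diff_eq_eq add.commute)
  qed
  then show ?thesis unfolding constant_type_def by metis
qed

text \<open>The symmetry of the second derivatives of \<open>A\<close> yields \<open>d\<lambda> = \<lambda> A\<close>, as soon as the dimension is at least \<open>2\<close>.\<close>

lemma constant_type_derivative:
  fixes A :: "'n::finite field"
  assumes U: "open U" and A: "smooth_on U A" and ct: "constant_type U A l" and d: "CARD('n) \<ge> 2"
  shows "smooth_on U l" "x \<in> U \<Longrightarrow> frechet_derivative l (at x) u = l x * (A x \<bullet> u)"
proof -
  obtain b0 :: "real ^ 'n" where b0: "b0 \<in> Basis" using nonempty_Basis by blast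
  have sA: "smooth_on U (\<lambda>y. A y \<bullet> e)" for e
    by (rule smooth_on_inner[OF U A smooth_on_const[OF U]])
  have sf: "smooth_on U (\<lambda>y. frechet_derivative A (at y) u \<bullet> e)" for u e
    by (rule smooth_on_inner[OF U smooth_on_frechet[OF A] smooth_on_const[OF U]])
  \<comment> \<open>\<open>l\<close> is a single diagonal entry of
    \<open>DA - A \<otimes> A\<close>, and inherits smoothness from it.\<close>
  have "smooth_on U (\<lambda>y. frechet_derivative A (at y) b0 \<bullet> b0 - (A y \<bullet> b0) * (A y \<bullet> b0))"
    by (rule smooth_on_diff[OF U sf smooth_on_mult[OF U sA sA]])
  then show l: "smooth_on U l"
    by (rule smooth_on_cong[OF U])
       (use ct b0 in \<open>simp add: constant_type_def inner_add_left inner_diff_left\<close>)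
  assume x: "x \<in> U"
  have dA: "frechet_derivative A (at y) u = (A y \<bullet> u) *\<^sub>R A y + l y *\<^sub>R u" if "y \<in> U" for y u
    using ct that by (simp add: constant_type_def)
  have hA: "((\<lambda>y. A y \<bullet> e) has_derivative (\<lambda>h. frechet_derivative A (at y) h \<bullet> e)) (at y)" if "y \<in> U" for e y
    by (intro has_derivative_inner_left smooth_on_has_derivative[OF A that])
  have second: "frechet_derivative (\<lambda>y. frechet_derivative (\<lambda>y. A y \<bullet> w) (at y) u) (at x) z =
      (A x \<bullet> u) * (frechet_derivative A (at x) z \<bullet> w) + (frechet_derivative A (at x) z \<bullet> u) * (A x \<bullet> w) +
      frechet_derivative l (at x) z * (u \<bullet> w)" for u w z
  proof -
    have "((\<lambda>y. (A y \<bullet> u) * (A y \<bullet> w) + l y * (u \<bullet> w)) has_derivative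
      (\<lambda>z. (A x \<bullet> u) * (frechet_derivative A (at x) z \<bullet> w) + (frechet_derivative A (at x) z \<bullet> u) * (A x \<bullet> w) +
      frechet_derivative l (at x) z * (u \<bullet> w))) (at x)"
      by (intro has_derivative_add has_derivative_mult hA[OF x] has_derivative_mult_left smooth_on_has_derivative[OF l x])
    then have "((\<lambda>y. frechet_derivative (\<lambda>y. A y \<bullet> w) (at y) u) has_derivative
      (\<lambda>z. (A x \<bullet> u) * (frechet_derivative A (at x) z \<bullet> w) + (frechet_derivative A (at x) z \<bullet> u) * (A x \<bullet> w) +
      frechet_derivative l (at x) z * (u \<bullet> w))) (at x)"
      by (rule has_derivative_transform_within_open[OF _ U x])
         (simp add: frechet_derivative_eqI[OF hA] dA inner_add_left)
    then show ?thesis by (simp add: frechet_derivative_eqI)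
  qed
  have "frechet_derivative l (at x) z = l x * (A x \<bullet> z)" if z: "z \<in> Basis" for z
  proof -
    have "\<not> (Basis :: (real ^ 'n) set) \<subseteq> {z}"
    proof
      assume "(Basis :: (real ^ 'n) set) \<subseteq> {z}"
      then have "card (Basis :: (real ^ 'n) set) \<le> 1" using card_mono[of "{z}" Basis] by simp
      then show False using d by simp
    qed
    \<comment> \<open>A second basis vector \<open>b\<close> is where the dimension is used. In the
      mixed derivatives of \<open>A \<bullet> b\<close> along \<open>b\<close> and \<open>z\<close>,
      one order produces \<open>dl(z)\<close>, the other \<open>l (A \<bullet> z)\<close>, and the
      remaining terms agree.\<close>
    then obtain b where b: "b \<in> Basis" "b \<noteq> z" by blast
    show ?thesis
      using frechet_derivative_commute[OF U sA x, of b b z]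
      by (simp add: second dA[OF x] inner_add_left inner_same_Basis[OF b(1)] inner_not_same_Basis[OF b(1) z b(2)]
          inner_not_same_Basis[OF z b(1) b(2)[symmetric]] algebra_simps)
  qed
  moreover have "linear (\<lambda>z. l x * (A x \<bullet> z))"
    by (intro linearI) (simp_all add: inner_add_right algebra_simps)
  ultimately have "frechet_derivative l (at x) = (\<lambda>z. l x * (A x \<bullet> z))"
    by (intro linear_eq_stdbasis[OF frechet_linear[OF l x]])
  then show "frechet_derivative l (at x) u = l x * (A x \<bullet> u)" by simp
qed

text \<open>Two integrations on a convex set. The field \<open>- \<psi> A\<close>, which is the
  gradient of \<psi>, has the identity as derivative and hence equals \<open>x + b\<close>;
  integrating this gives \<psi> up to the constant \<open>c\<close>.\<close>

lemma constant_type_potential: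
  fixes A :: "'n::finite field"
  assumes U: "open U" "convex U" and A: "smooth_on U A" and ct: "constant_type U A l" and d: "CARD('n) \<ge> 2"
    and l0: "\<And>x. x \<in> U \<Longrightarrow> l x \<noteq> 0"
  obtains b c where "\<And>x. x \<in> U \<Longrightarrow> (x \<bullet> x) / 2 + b \<bullet> x + c \<noteq> 0"
    "\<And>x. x \<in> U \<Longrightarrow> A x = - (x + b) /\<^sub>R ((x \<bullet> x) / 2 + b \<bullet> x + c)"
proof -
  note l = constant_type_derivative[OF U(1) A ct d]
  define \<psi> where "\<psi> x = - inverse (l x)" for x
  have dpsi: "(\<psi> has_derivative (\<lambda>h. - \<psi> x * (A x \<bullet> h))) (at x)" if x: "x \<in> U" for x
  proof -
    have "(\<psi> has_derivative (\<lambda>h. - (- (inverse (l x) * frechet_derivative l (at x) h * inverse (l x))))) (at x)"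
      unfolding \<psi>_def
      by (intro has_derivative_minus Deriv.has_derivative_inverse[where f = l, OF l0[OF x]] smooth_on_has_derivative[OF l(1) x])
    then show ?thesis
      by (rule has_derivative_eq_rhs) (use l0[OF x] in \<open>simp add: fun_eq_iff l(2)[OF x] \<psi>_def\<close>)
  qed
  have dX: "((\<lambda>x. - \<psi> x *\<^sub>R A x - x) has_derivative (\<lambda>h. 0)) (at x)" if x: "x \<in> U" for x
  proof -
    have "((\<lambda>x. - \<psi> x *\<^sub>R A x - x) has_derivative
       (\<lambda>h. - \<psi> x *\<^sub>R frechet_derivative A (at x) h + (- (- \<psi> x * (A x \<bullet> h))) *\<^sub>R A x - h)) (at x)"
      by (intro has_derivative_diff has_derivative_scaleR has_derivative_minus dpsi[OF x]
          smooth_on_has_derivative[OF A x] has_derivative_ident)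
    moreover have "frechet_derivative A (at x) h = (A x \<bullet> h) *\<^sub>R A x + l x *\<^sub>R h" for h
      using ct x by (simp add: constant_type_def)
    ultimately show ?thesis using l0[OF x] by (simp add: \<psi>_def algebra_simps)
  qed
  obtain b where b: "\<And>x. x \<in> U \<Longrightarrow> - \<psi> x *\<^sub>R A x - x = b"
    using has_derivative_zero_constant[OF U(2) has_derivative_at_withinI[OF dX]] by blast
  have dY: "((\<lambda>x. \<psi> x - ((x \<bullet> x) / 2 + b \<bullet> x)) has_derivative (\<lambda>h. 0)) (at x)" if x: "x \<in> U" for x
  proof -
    have "((\<lambda>x. \<psi> x - ((x \<bullet> x) / 2 + b \<bullet> x)) has_derivative
       (\<lambda>h. - \<psi> x * (A x \<bullet> h) - (x \<bullet> h + b \<bullet> h))) (at x)"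
      by (rule has_derivative_diff[OF dpsi[OF x]]) (auto intro!: derivative_eq_intros simp: inner_commute)
    moreover have "- \<psi> x * (A x \<bullet> h) = (x + b) \<bullet> h" for h
      unfolding b[OF x, symmetric] by simp
    ultimately show ?thesis by (simp add: inner_add_left)
  qed
  obtain c where c: "\<And>x. x \<in> U \<Longrightarrow> \<psi> x - ((x \<bullet> x) / 2 + b \<bullet> x) = c"
    using has_derivative_zero_constant[OF U(2) has_derivative_at_withinI[OF dY]] by blast
  show ?thesis
  proof (rule that[of b c])
    fix x assume x: "x \<in> U"
    have \<psi>: "\<psi> x = (x \<bullet> x) / 2 + b \<bullet> x + c" using c[OF x] by simp
    have n: "\<psi> x \<noteq> 0" using l0[OF x] by (simp add: \<psi>_def)
    show "(x \<bullet> x) / 2 + b \<bullet> x + c \<noteq> 0" using n \<psi> by simp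
    have "\<psi> x *\<^sub>R A x = - (x + (- \<psi> x *\<^sub>R A x - x))" by simp
    also have "\<dots> = - (x + b)" unfolding b[OF x] ..
    finally have "inverse (\<psi> x) *\<^sub>R (\<psi> x *\<^sub>R A x) = inverse (\<psi> x) *\<^sub>R (- (x + b))" by simp
    then have "A x = - (x + b) /\<^sub>R \<psi> x" using n by simp
    then show "A x = - (x + b) /\<^sub>R ((x \<bullet> x) / 2 + b \<bullet> x + c)" unfolding \<psi> .
  qed
qed

section \<open>Geodesics\<close>

text \<open>Bootstrapping: if the derivative is as smooth as the function, as in an autonomous
  equation \<open>F' = H(F)\<close>, each order of smoothness yields the next.\<close>

lemma smooth_on_of_derivative:
  fixes F h :: "real \<Rightarrow> real"
  assumes "open J" "\<And>t. t \<in> J \<Longrightarrow> (F has_real_derivative h t) (at t)"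
    and "\<And>k. Ck_on k J F \<Longrightarrow> Ck_on k J h"
  shows "smooth_on J F"
proof -
  have "Ck_on k J F" for k
  proof (induction k)
    case 0
    show ?case using assms(2) by (auto intro!: continuous_at_imp_continuous_on DERIV_isCont)
  next
    case (Suc k)
    show ?case
    proof (rule Ck_on_Suc_I[OF assms(1)])
      show "(F has_derivative (\<lambda>v. h t * v)) (at t)" if "t \<in> J" for t
        using assms(2)[OF that] by (simp add: has_field_derivative_def)
      show "Ck_on k J (\<lambda>t. h t * v)" for v
        by (rule Ck_on_bounded_bilinear[OF assms(1) bounded_bilinear_mult assms(3)[OF Suc] Ck_on_const[OF assms(1)]])
    qed
  qed
  then show ?thesis by (simp add: smooth_on_def)
qed

text \<open>Passes from elapsed time as a function of position to position as a function of time,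
  and back.\<close>

lemma increasing_inverse:
  fixes G g :: "real \<Rightarrow> real"
  assumes I: "open I" "is_interval I"
    and G: "\<And>s. s \<in> I \<Longrightarrow> (G has_real_derivative g s) (at s)" and g: "\<And>s. s \<in> I \<Longrightarrow> g s > 0"
  obtains F where "open (G ` I)" "is_interval (G ` I)" "bij_betw F (G ` I) I"
    "\<And>t. t \<in> G ` I \<Longrightarrow> G (F t) = t" "\<And>s. s \<in> I \<Longrightarrow> F (G s) = s"
    "\<And>t. t \<in> G ` I \<Longrightarrow> (F has_real_derivative inverse (g (F t))) (at t)"
    "strict_mono_on I G"
proof -
  have mono: "G s < G s'" if "s \<in> I" "s' \<in> I" "s < s'" for s s'
  proof (rule DERIV_pos_imp_increasing[OF that(3)])
    fix r assume "s \<le> r" "r \<le> s'"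
    then have "r \<in> I" using I(2) that unfolding is_interval_1 by blast
    then show "\<exists>y. (G has_real_derivative y) (at r) \<and> y > 0" using G g by blast
  qed
  then have sm: "strict_mono_on I G" by (simp add: strict_mono_onI)
  then have inj: "inj_on G I" by (rule strict_mono_on_imp_inj_on)
  have cont: "continuous_on I G" using G by (auto intro!: continuous_at_imp_continuous_on DERIV_isCont)
  define F where "F = inv_into I G"
  have FG: "F (G s) = s" if "s \<in> I" for s using inj that by (simp add: F_def)
  show ?thesis
  proof (rule that[of F])
    show "open (G ` I)" by (rule invariance_of_domain[OF cont I(1) inj])
    show "is_interval (G ` I)"
      using connected_continuous_image[OF cont] I(2) by (simp add: is_interval_connected_1)
    show "bij_betw F (G ` I) I" unfolding F_def by (rule bij_betw_inv_into) (simp add: bij_betw_def inj)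
    show "G (F t) = t" if "t \<in> G ` I" for t using FG that by auto
    show "F (G s) = s" if "s \<in> I" for s using FG that .
    show "(F has_real_derivative inverse (g (F t))) (at t)" if t: "t \<in> G ` I" for t
    proof -
      obtain s where s: "s \<in> I" "t = G s" using t by blast
      have "(F has_derivative (\<lambda>h. inverse (g s) * h)) (at (G s))"
      proof (rule has_derivative_inverse_strong[OF I(1) s(1) cont FG])
        show "(G has_derivative (\<lambda>h. g s * h)) (at s)" using G[OF s(1)] by (simp add: has_field_derivative_def)
        show "(\<lambda>h. g s * h) \<circ> (\<lambda>h. inverse (g s) * h) = id" using g[OF s(1)] by (auto simp: fun_eq_iff)
      qed
      then show ?thesis by (simp add: s(2) FG[OF s(1)] has_field_derivative_def)
    qed
  qed (rule sm)
qed

text \<open>\<open>f\<close> plays the role of \<psi> on the line. For the velocity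
  \<open>v = f^2 q\<close> one finds \<open>v' = - 2 (A \<bullet> v) v\<close>, which is the
  geodesic equation for this \<Gamma>.\<close>

lemma geodesic_on_line:
  assumes pr: "projective_on U A nabla" and J: "open J" "is_interval J" "J \<noteq> {}"
    and F: "\<And>t. t \<in> J \<Longrightarrow> (F has_real_derivative (f (F t))\<^sup>2) (at t)"
    and inU: "\<And>t. t \<in> J \<Longrightarrow> p + F t *\<^sub>R q \<in> U"
    and f: "\<And>t. t \<in> J \<Longrightarrow> (f has_real_derivative - f (F t) * (A (p + F t *\<^sub>R q) \<bullet> q)) (at (F t))"
  shows "geodesic_on U nabla J (\<lambda>t. p + F t *\<^sub>R q)"
proof -
  define k where "k t = p + F t *\<^sub>R q" for t
  have k: "(k has_vector_derivative (f (F t))\<^sup>2 *\<^sub>R q) (at t)" if "t \<in> J" for t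
    unfolding k_def using F[OF that] by (auto intro!: derivative_eq_intros)
  have par: "parallel_at nabla k (\<lambda>s. vector_derivative k (at s)) t" if t: "t \<in> J" for t
  proof -
    have "((\<lambda>s. f (F s)) has_real_derivative - f (F t) * (A (k t) \<bullet> q) * (f (F t))\<^sup>2) (at t)"
      using DERIV_chain2[OF f[OF t] F[OF t]] by (simp add: k_def)
    then have "((\<lambda>s. (f (F s))\<^sup>2) has_real_derivative 2 * f (F t) * (- f (F t) * (A (k t) \<bullet> q) * (f (F t))\<^sup>2)) (at t)"
      by (auto intro!: derivative_eq_intros)
    then have "((\<lambda>s. (f (F s))\<^sup>2 *\<^sub>R q) has_vector_derivative
       (2 * f (F t) * (- f (F t) * (A (k t) \<bullet> q) * (f (F t))\<^sup>2)) *\<^sub>R q) (at t)"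
      by (rule has_vector_derivative_eq_rhs[OF has_vector_derivative_scaleR[OF _ has_vector_derivative_const]]) simp
    then have "((\<lambda>s. vector_derivative k (at s)) has_vector_derivative
       (2 * f (F t) * (- f (F t) * (A (k t) \<bullet> q) * (f (F t))\<^sup>2)) *\<^sub>R q) (at t)"
      by (rule has_vector_derivative_transform_within_open[OF _ J(1) t]) (simp add: vector_derivative_at[OF k])
    moreover have "k t \<in> U" using inU[OF t] by (simp add: k_def)
    ultimately show ?thesis
      unfolding parallel_at_def vector_derivative_at[OF k[OF t]]
      by (simp add: projective_onD[OF pr] power2_eq_square algebra_simps flip: scaleR_add_left)
  qed
  show ?thesis
    unfolding geodesic_on_def k_def[symmetric, abs_def]
    using J inU par differentiableI_vector[OF k] by (auto simp: k_def)
qed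

text \<open>The velocity divided by \<open>\<psi>^2\<close> is a first integral: the logarithmic
  derivative \<open>- 2 (A \<bullet> c')\<close> of \<open>\<psi>^2\<close> along the curve matches
  the rate at which the geodesic equation changes the velocity.\<close>

lemma geodesic_velocity:
  assumes pr: "projective_on U A nabla" and c: "geodesic_on U nabla I c"
    and \<psi>: "\<And>x. x \<in> U \<Longrightarrow> \<psi> x \<noteq> 0" "\<And>x. x \<in> U \<Longrightarrow> (\<psi> has_derivative (\<lambda>h. - \<psi> x * (A x \<bullet> h))) (at x)"
  obtains q where "\<And>t. t \<in> I \<Longrightarrow> (c has_vector_derivative (\<psi> (c t))\<^sup>2 *\<^sub>R q) (at t)"
proof -
  define z where "z t = inverse ((\<psi> (c t))\<^sup>2) *\<^sub>R vector_derivative c (at t)" for t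
  have I: "convex I" using c by (simp add: geodesic_on_def is_interval_convex_1)
  have cd: "(c has_vector_derivative vector_derivative c (at t)) (at t)" if "t \<in> I" for t
    using c that by (simp add: geodesic_on_def vector_derivative_works)
  have z: "(z has_derivative (\<lambda>h. 0)) (at t)" if t: "t \<in> I" for t
  proof -
    have ct: "c t \<in> U" using c t by (auto simp: geodesic_on_def)
    define v where "v = vector_derivative c (at t)"
    define a where "a = A (c t) \<bullet> v"
    have "((\<lambda>s. \<psi> (c s)) has_derivative (\<lambda>h. - \<psi> (c t) * (A (c t) \<bullet> (h *\<^sub>R v)))) (at t)"
      by (rule has_derivative_compose[where f = c, OF cd[OF t, unfolded has_vector_derivative_def v_def[symmetric]] \<psi>(2)[OF ct]])
    then have d1: "((\<lambda>s. \<psi> (c s)) has_real_derivative - \<psi> (c t) * a) (at t)"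
      unfolding has_field_derivative_def by (rule has_derivative_eq_rhs) (simp add: fun_eq_iff a_def)
    have d2: "((\<lambda>s. inverse ((\<psi> (c s))\<^sup>2)) has_real_derivative 2 * inverse ((\<psi> (c t))\<^sup>2) * a) (at t)"
      using \<psi>(1)[OF ct] by (auto intro!: derivative_eq_intros d1 simp: power2_eq_square field_simps)
    have d3: "((\<lambda>s. vector_derivative c (at s)) has_vector_derivative - ((2 * a) *\<^sub>R v)) (at t)"
      using c t unfolding geodesic_on_def parallel_at_def projective_onD[OF pr ct] v_def[symmetric]
      by (auto simp: projective_onD[OF pr ct] a_def v_def simp flip: scaleR_add_left)
    have "(z has_vector_derivative 0) (at t)"
      unfolding z_def
      by (rule has_vector_derivative_eq_rhs[OF has_vector_derivative_scaleR[OF d2 d3]]) (simp add: v_def)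
    then show ?thesis by (simp add: has_vector_derivative_def)
  qed
  obtain q where q: "\<And>t. t \<in> I \<Longrightarrow> z t = q"
    using has_derivative_zero_constant[OF I has_derivative_at_withinI[OF z]] by blast
  show ?thesis
  proof (rule that[of q])
    fix t assume t: "t \<in> I"
    then have "\<psi> (c t) \<noteq> 0" using \<psi>(1) c by (auto simp: geodesic_on_def)
    then have "vector_derivative c (at t) = (\<psi> (c t))\<^sup>2 *\<^sub>R q"
      using q[OF t] by (auto simp: z_def)
    then show "(c has_vector_derivative (\<psi> (c t))\<^sup>2 *\<^sub>R q) (at t)" using cd[OF t] by simp
  qed
qed

lemma geodesic_line_form:
  assumes pr: "projective_on U A nabla" and c: "geodesic_on U nabla I c"
    and \<psi>: "\<And>x. x \<in> U \<Longrightarrow> \<psi> x \<noteq> 0" "\<And>x. x \<in> U \<Longrightarrow> (\<psi> has_derivative (\<lambda>h. - \<psi> x * (A x \<bullet> h))) (at x)"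
  obtains p q h where "\<And>t. t \<in> I \<Longrightarrow> c t = p + h t *\<^sub>R q"
    "\<And>t. q \<noteq> 0 \<Longrightarrow> t \<in> I \<Longrightarrow> (h has_real_derivative (\<psi> (p + h t *\<^sub>R q))\<^sup>2) (at t)"
proof -
  obtain q where q: "\<And>t. t \<in> I \<Longrightarrow> (c has_vector_derivative (\<psi> (c t))\<^sup>2 *\<^sub>R q) (at t)"
    using geodesic_velocity[OF assms] by blast
  have I: "convex I" using c by (simp add: geodesic_on_def is_interval_convex_1)
  \<comment> \<open>The coordinate of \<open>c\<close> along \<open>q\<close>. For
    \<open>q = 0\<close> it is 0 by the convention on division and the curve is constant, which is
    why the equation for \<open>h\<close> is claimed for \<open>q \<noteq> 0\<close> only.\<close>
  define h where "h t = (c t \<bullet> q) / (q \<bullet> q)" for t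
  have h: "(h has_vector_derivative ((\<psi> (c t))\<^sup>2 *\<^sub>R q \<bullet> q) / (q \<bullet> q)) (at t)" if "t \<in> I" for t
    unfolding h_def
    using bounded_linear.has_vector_derivative[OF bounded_linear_divide
        bounded_linear.has_vector_derivative[OF bounded_linear_inner_left q[OF that]]] .
  have z: "((\<lambda>t. c t - h t *\<^sub>R q) has_derivative (\<lambda>_. 0)) (at t)" if t: "t \<in> I" for t
  proof -
    have "((\<lambda>t. c t - h t *\<^sub>R q) has_vector_derivative
        (\<psi> (c t))\<^sup>2 *\<^sub>R q - (((\<psi> (c t))\<^sup>2 *\<^sub>R q \<bullet> q) / (q \<bullet> q)) *\<^sub>R q) (at t)"
      by (rule has_vector_derivative_diff[OF q[OF t]
            bounded_linear.has_vector_derivative[OF bounded_linear_scaleR_left h[OF t]]])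
    then show ?thesis by (cases "q = 0") (simp_all add: has_vector_derivative_def)
  qed
  obtain p where p: "\<And>t. t \<in> I \<Longrightarrow> c t - h t *\<^sub>R q = p"
    using has_derivative_zero_constant[OF I has_derivative_at_withinI[OF z]] by blast
  have cp: "c t = p + h t *\<^sub>R q" if "t \<in> I" for t using p[OF that] by (simp add: algebra_simps)
  show ?thesis
  proof (rule that[of p h q])
    show "(h has_real_derivative (\<psi> (p + h t *\<^sub>R q))\<^sup>2) (at t)" if "q \<noteq> 0" "t \<in> I" for t
      using h[OF that(2)] that cp[OF that(2)] by (simp add: has_real_derivative_iff_has_vector_derivative)
  qed (rule cp)
qed

section \<open>The connection of the unit ball\<close>

definition ball_potential :: "real ^ 'n::finite \<Rightarrow> real" where
  "ball_potential x = (x \<bullet> x - 1) / 2"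

text \<open>The field \<open>- d\<psi> / \<psi>\<close> of the ball potential, equal to
  \<open>2 x / (1 - |x|^2)\<close>: twice the field of the Levi-Civita connection in the
  Beltrami-Klein model.\<close>

definition ball_field :: "('n::finite) field" where
  "ball_field x = - x /\<^sub>R ball_potential x"

lemma ball_potential_neg: "x \<in> ball 0 1 \<Longrightarrow> ball_potential x < 0"
  using abs_square_less_1[of "norm x"] by (simp add: ball_potential_def dot_square_norm)

lemma ball_potential_has_derivative: "(ball_potential has_derivative (\<lambda>h. x \<bullet> h)) (at x)"
  unfolding ball_potential_def by (auto intro!: derivative_eq_intros simp: inner_commute)

lemma ball_field_inner: "x \<in> ball 0 1 \<Longrightarrow> ball_potential x * (ball_field x \<bullet> h) = - (x \<bullet> h)"
  using ball_potential_neg[of x] by (simp add: ball_field_def)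

lemma ball_potential_has_derivative_field:
  assumes "x \<in> ball 0 1"
  shows "(ball_potential has_derivative (\<lambda>h. - ball_potential x * (ball_field x \<bullet> h))) (at x)"
  by (rule has_derivative_eq_rhs[OF ball_potential_has_derivative])
     (simp add: fun_eq_iff ball_field_inner[OF assms])

lemma smooth_on_ball_potential: "smooth_on (ball 0 1) ball_potential"
proof -
  have "smooth_on (ball 0 1) (\<lambda>x :: real ^ 'a. (x \<bullet> x) * (1/2) - 1/2)"
    by (intro smooth_on_diff smooth_on_mult smooth_on_inner smooth_on_ident smooth_on_const open_ball)
  then show ?thesis by (simp add: ball_potential_def[abs_def] diff_divide_distrib)
qed

lemma smooth_on_ball_field: "smooth_on (ball 0 1) (ball_field :: 'n::finite field)"
proof -
  have "smooth_on (ball 0 1) (\<lambda>x :: real ^ 'n. inverse (ball_potential x) *\<^sub>R (- x))"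
    by (rule smooth_on_scaleR[OF open_ball smooth_on_inverse[OF open_ball smooth_on_ball_potential]
          smooth_on_minus[OF open_ball smooth_on_ident[OF open_ball]]])
       (use ball_potential_neg in force)
  then show ?thesis by (simp add: ball_field_def[abs_def])
qed

text \<open>The time that a geodesic needs along a chord is the integral of \<open>1 / \<psi>\<^sup>2\<close>, which diverges at
  both ends because \<open>\<psi>\<close> vanishes there. After normalization the integrand is \<open>1 / (1 - \<tau>\<^sup>2)\<^sup>2\<close>.\<close>

lemma chord_time_normalized:
  defines "g \<equiv> \<lambda>\<tau> :: real. \<tau> / (2 * (1 - \<tau>\<^sup>2)) + (ln (1 + \<tau>) - ln (1 - \<tau>)) / 4"
  shows "\<bar>\<tau>\<bar> < 1 \<Longrightarrow> (g has_real_derivative 1 / (1 - \<tau>\<^sup>2)\<^sup>2) (at \<tau>)"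
    and "\<exists>\<tau>. \<bar>\<tau>\<bar> < 1 \<and> g \<tau> = y"
proof -
  have d: "(g has_real_derivative 1 / (1 - \<tau>\<^sup>2)\<^sup>2) (at \<tau>)" if "\<bar>\<tau>\<bar> < 1" for \<tau>
  proof -
    have p: "1 + \<tau> > 0" "1 - \<tau> > 0" using that by auto
    have e: "1 - \<tau>\<^sup>2 = (1 + \<tau>) * (1 - \<tau>)" by (simp add: power2_eq_square algebra_simps)
    have n: "1 - \<tau>\<^sup>2 \<noteq> 0" unfolding e using p by simp
    have "(g has_real_derivative
       (1 * (2 * (1 - \<tau>\<^sup>2)) - \<tau> * (2 * (0 - 2 * \<tau>))) / (2 * (1 - \<tau>\<^sup>2))\<^sup>2 + (1 / (1 + \<tau>) - - 1 / (1 - \<tau>)) / 4) (at \<tau>)"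
      unfolding g_def using p n by (auto intro!: derivative_eq_intros simp: power2_eq_square)
    also have "1 / (1 + \<tau>) - - 1 / (1 - \<tau>) = 2 / (1 - \<tau>\<^sup>2)"
      unfolding e using p by (simp add: field_simps)
    also have "(1 * (2 * (1 - \<tau>\<^sup>2)) - \<tau> * (2 * (0 - 2 * \<tau>))) / (2 * (1 - \<tau>\<^sup>2))\<^sup>2 + 2 / (1 - \<tau>\<^sup>2) / 4 = 1 / (1 - \<tau>\<^sup>2)\<^sup>2"
      using n by (simp add: divide_simps) (simp add: power2_eq_square algebra_simps)
    finally show ?thesis .
  qed
  then show "\<bar>\<tau>\<bar> < 1 \<Longrightarrow> (g has_real_derivative 1 / (1 - \<tau>\<^sup>2)\<^sup>2) (at \<tau>)" .
  have odd: "g (- \<tau>) = - g \<tau>" for \<tau> by (simp add: g_def algebra_simps diff_divide_distrib)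
  have pos: "\<exists>\<tau>. \<bar>\<tau>\<bar> < 1 \<and> g \<tau> = y" if y: "y \<ge> 0" for y
  proof -
    \<comment> \<open>Solution of \<open>r / (4 * (1 - r)) = y\<close>. The left side is a lower
      bound for the rational part of \<open>g\<close>, as \<open>1 - r^2 \<le> 2 (1 - r)\<close>,
      and the logarithmic part is nonnegative for \<open>r \<ge> 0\<close>.\<close>
    define r where "r = 4 * y / (1 + 4 * y)"
    have r: "0 \<le> r" "r < 1" using y by (simp_all add: r_def)
    have "y = r / (4 * (1 - r))" using y by (simp add: r_def field_simps)
    also have "\<dots> \<le> r / (2 * (1 - r\<^sup>2))"
    proof (intro divide_left_mono)
      have "(1 + r) * (1 - r) \<le> 2 * (1 - r)" using r by (intro mult_right_mono) auto
      then show "2 * (1 - r\<^sup>2) \<le> 4 * (1 - r)" by (simp add: power2_eq_square algebra_simps)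
      have "r\<^sup>2 < 1" using r by (simp add: abs_square_less_1)
      then show "0 < 4 * (1 - r) * (2 * (1 - r\<^sup>2))" using r by simp
    qed (use r in simp)
    also have "\<dots> \<le> g r" using r by (simp add: g_def)
    finally have "y \<le> g r" .
    moreover have "g 0 = 0" by (simp add: g_def)
    ultimately obtain \<tau> where "0 \<le> \<tau>" "\<tau> \<le> r" "g \<tau> = y"
      using IVT[of g 0 y r] y r DERIV_isCont[OF d] by fastforce
    then show ?thesis using r by (intro exI[of _ \<tau>]) auto
  qed
  show "\<exists>\<tau>. \<bar>\<tau>\<bar> < 1 \<and> g \<tau> = y"
  proof (cases "y \<ge> 0")
    case True
    then show ?thesis by (rule pos)
  next
    case False
    then obtain \<tau> where "\<bar>\<tau>\<bar> < 1" "g \<tau> = - y" using pos[of "- y"] by auto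
    then show ?thesis using odd by (intro exI[of _ "- \<tau>"]) auto
  qed
qed

text \<open>Completing the square around the point of the line closest to the origin turns the
  potential into \<open>- \<kappa> (1 - \<tau>^2) / 2\<close>, where \<tau> is affine in
  \<open>s\<close> and maps the chord onto \<open>(-1, 1)\<close>.\<close>

lemma chord_time:
  fixes p q :: "real ^ 'n::finite"
  assumes "p + s0 *\<^sub>R q \<in> ball 0 1" "q \<noteq> 0"
  obtains G where
    "\<And>s. p + s *\<^sub>R q \<in> ball 0 1 \<Longrightarrow> (G has_real_derivative 1 / (ball_potential (p + s *\<^sub>R q))\<^sup>2) (at s)"
    "\<And>y. \<exists>s. p + s *\<^sub>R q \<in> ball 0 1 \<and> G s = y"
proof -
  define Q where "Q = q \<bullet> q"
  have Q: "Q > 0" using assms(2) by (simp add: Q_def)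
  define \<sigma> where "\<sigma> = (p \<bullet> q) / Q"
  define a where "a = p - \<sigma> *\<^sub>R q"
  have aq: "a \<bullet> q = 0" using Q by (simp add: a_def \<sigma>_def inner_diff_left Q_def)
  have nrm: "(p + s *\<^sub>R q) \<bullet> (p + s *\<^sub>R q) = a \<bullet> a + Q * (s + \<sigma>)\<^sup>2" for s
  proof -
    have "p + s *\<^sub>R q = a + (s + \<sigma>) *\<^sub>R q" by (simp add: a_def algebra_simps)
    then show ?thesis using aq
      by (simp add: inner_add_left inner_add_right inner_commute Q_def power2_eq_square)
  qed
  have ball: "x \<in> ball 0 1 \<longleftrightarrow> x \<bullet> x < 1" for x :: "real ^ 'n"
    using abs_square_less_1[of "norm x"] by (simp add: dot_square_norm)
  define \<kappa> where "\<kappa> = 1 - a \<bullet> a"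
  have "a \<bullet> a \<le> a \<bullet> a + Q * (s0 + \<sigma>)\<^sup>2" using Q by simp
  also have "\<dots> < 1" using assms(1) unfolding ball nrm .
  finally have \<kappa>: "\<kappa> > 0" by (simp add: \<kappa>_def)
  define m where "m = sqrt (\<kappa> / Q)"
  have m: "m > 0" "m\<^sup>2 = \<kappa> / Q" using \<kappa> Q by (simp_all add: m_def)
  have nrm': "(p + s *\<^sub>R q) \<bullet> (p + s *\<^sub>R q) = 1 - \<kappa> * (1 - ((s + \<sigma>) / m)\<^sup>2)" for s
  proof -
    have "\<kappa> * ((s + \<sigma>) / m)\<^sup>2 = Q * (s + \<sigma>)\<^sup>2"
      unfolding power_divide m(2) using \<kappa> Q by simp
    then show ?thesis unfolding nrm by (simp add: \<kappa>_def right_diff_distrib)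
  qed
  have inball: "p + s *\<^sub>R q \<in> ball 0 1 \<longleftrightarrow> \<bar>(s + \<sigma>) / m\<bar> < 1" for s
    unfolding ball nrm' using \<kappa> abs_square_less_1[of "(s + \<sigma>) / m"] by (simp add: zero_less_mult_iff)
  define g where "g \<tau> = \<tau> / (2 * (1 - \<tau>\<^sup>2)) + (ln (1 + \<tau>) - ln (1 - \<tau>)) / 4" for \<tau> :: real
  note g = chord_time_normalized[folded g_def]
  \<comment> \<open>The factor \<open>4 / \<kappa>^2\<close> comes from the square of the potential,
    \<open>m\<close> from \<open>ds = m d\<tau>\<close>.\<close>
  define C where "C = 4 * m / \<kappa>\<^sup>2"
  have C: "C > 0" using m \<kappa> by (simp add: C_def)
  show ?thesis
  proof (rule that[of "\<lambda>s. C * g ((s + \<sigma>) / m)"])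
    fix s assume s: "p + s *\<^sub>R q \<in> ball 0 1"
    define \<tau> where "\<tau> = (s + \<sigma>) / m"
    have "((\<lambda>s. (s + \<sigma>) / m) has_real_derivative 1 / m) (at s)"
      using m by (auto intro!: derivative_eq_intros)
    then have "((\<lambda>s. C * g ((s + \<sigma>) / m)) has_real_derivative C * (1 / (1 - \<tau>\<^sup>2)\<^sup>2 * (1 / m))) (at s)"
      unfolding \<tau>_def by (intro DERIV_cmult DERIV_chain2[where f = g] g(1)) (use s inball in auto)
    also have "C * (1 / (1 - \<tau>\<^sup>2)\<^sup>2 * (1 / m)) = 1 / (ball_potential (p + s *\<^sub>R q))\<^sup>2"
      unfolding ball_potential_def nrm' \<tau>_def[symmetric] C_def using m
      by (simp add: power_mult_distrib power_divide)
    finally show "((\<lambda>s. C * g ((s + \<sigma>) / m)) has_real_derivative 1 / (ball_potential (p + s *\<^sub>R q))\<^sup>2) (at s)" .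
  next
    fix y
    obtain \<tau> where "\<bar>\<tau>\<bar> < 1" "g \<tau> = y / C" using g(2) by blast
    then show "\<exists>s. p + s *\<^sub>R q \<in> ball 0 1 \<and> C * g ((s + \<sigma>) / m) = y"
      unfolding inball using C m by (intro exI[of _ "m * \<tau> - \<sigma>"]) auto
  qed
qed

section \<open>The ball connection satisfies the defining conditions\<close>

lemma hessian_ball_potential: "hessian ball_potential x u v = u \<bullet> v"
proof -
  have "frechet_derivative ball_potential (at y) v = y \<bullet> v" for y
    by (simp add: frechet_derivative_eqI[OF ball_potential_has_derivative])
  moreover have "frechet_derivative (\<lambda>y. y \<bullet> v) (at x) = (\<lambda>u. u \<bullet> v)"
    by (rule frechet_derivative_eqI) (auto intro!: derivative_eq_intros)
  ultimately show ?thesis by (simp add: hessian_def)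
qed

lemma hessian_manifold_ball:
  assumes "CARD('n::finite) \<ge> 2"
  shows "hessian_manifold (ball 0 1 :: (real ^ 'n) set) standard_metric"
  unfolding hessian_manifold_def pseudo_riemannian_def
proof (intro conjI ballI allI impI)
  show "smooth_on (ball 0 1) (\<lambda>x. standard_metric x u v)" for u v :: "real ^ 'n"
    unfolding standard_metric_inner by (rule smooth_on_const[OF open_ball])
  show "bilinear (standard_metric x)" for x :: "real ^ 'n"
    unfolding bilinear_def standard_metric_inner
    by (auto intro!: linearI simp: inner_add_left inner_add_right)
  show "u = 0" if "\<forall>v. standard_metric x u v = 0" for x u :: "real ^ 'n"
    using that[unfolded standard_metric_inner, rule_format, of u] by simp
  show "\<exists>V \<psi>. open V \<and> x \<in> V \<and> V \<subseteq> ball 0 1 \<and> smooth_on V \<psi> \<and>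
        (\<forall>y\<in>V. \<forall>u v. hessian \<psi> y u v = standard_metric y u v)"
    if "x \<in> ball 0 1" for x :: "real ^ 'n"
    using that smooth_on_ball_potential
    by (intro exI[of _ "ball 0 1"] exI[of _ ball_potential])
       (auto simp: hessian_ball_potential standard_metric_inner)
qed (use assms in \<open>auto simp: standard_metric_inner inner_commute\<close>)

lemma constant_type_ball: "constant_type (ball 0 1) ball_field (\<lambda>x. - inverse (ball_potential x))"
  unfolding constant_type_def
proof (intro ballI allI)
  fix x u :: "real ^ 'a" assume x: "x \<in> ball 0 1"
  have n: "ball_potential x \<noteq> 0" using ball_potential_neg[OF x] by simp
  have "((\<lambda>y. inverse (ball_potential y) *\<^sub>R (- y)) has_derivative
     (\<lambda>h. inverse (ball_potential x) *\<^sub>R (- h) +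
        (- (inverse (ball_potential x) * (x \<bullet> h) * inverse (ball_potential x))) *\<^sub>R (- x))) (at x)"
    by (intro has_derivative_scaleR has_derivative_minus has_derivative_ident
        Deriv.has_derivative_inverse[where f = ball_potential, OF n] ball_potential_has_derivative)
  then have "(ball_field has_derivative
     (\<lambda>h. inverse (ball_potential x) *\<^sub>R (- h) +
        (- (inverse (ball_potential x) * (x \<bullet> h) * inverse (ball_potential x))) *\<^sub>R (- x))) (at x)"
    by (simp add: ball_field_def[abs_def])
  from frechet_derivative_eqI[OF this]
  show "frechet_derivative ball_field (at x) u = (ball_field x \<bullet> u) *\<^sub>R ball_field x + - inverse (ball_potential x) *\<^sub>R u"
    by (simp add: ball_field_def)
qed

lemma incompressible_ball: "incompressible (ball 0 1) (projective_connection (ball_field :: 'n::finite field))"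
proof (rule incompressible_of_density[OF open_ball projective_on_projective_connection])
  define n where "n = CARD('n)"
  \<comment> \<open>The density must satisfy
    \<open>d log |\<rho>| = (d + 1) A = - (d + 1) d\<psi> / \<psi>\<close>, whence the power
    \<open>- (d + 1)\<close> of \<psi>.\<close>
  show "smooth_on (ball 0 1) (\<lambda>x :: real ^ 'n. inverse (ball_potential x) ^ Suc n)"
    by (intro smooth_on_power[OF open_ball] smooth_on_inverse[OF open_ball] smooth_on_ball_potential)
       (use ball_potential_neg in force)
  fix x u :: "real ^ 'n" assume x: "x \<in> ball 0 1"
  have n0: "ball_potential x \<noteq> 0" using ball_potential_neg[OF x] by simp
  then show "inverse (ball_potential x) ^ Suc n \<noteq> 0" by simp
  have "((\<lambda>y. inverse (ball_potential y)) has_derivative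
      (\<lambda>h. - (inverse (ball_potential x) * (x \<bullet> h) * inverse (ball_potential x)))) (at x)"
    by (intro Deriv.has_derivative_inverse[where f = ball_potential, OF n0] ball_potential_has_derivative)
  from has_derivative_power[OF this, of "Suc n"]
  have "frechet_derivative (\<lambda>y. inverse (ball_potential y) ^ Suc n) (at x) u =
      of_nat (Suc n) * (- (inverse (ball_potential x) * (x \<bullet> u) * inverse (ball_potential x))) * inverse (ball_potential x) ^ n"
    by (simp add: frechet_derivative_eqI)
  then show "frechet_derivative (\<lambda>y. inverse (ball_potential y) ^ Suc n) (at x) u =
      (real CARD('n) + 1) * inverse (ball_potential x) ^ Suc n * (ball_field x \<bullet> u)"
    by (simp add: ball_field_def n_def algebra_simps)
qed

text \<open>Constant curves count as geodesics, so each argument on geodesics has a separate case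
  \<open>q = 0\<close>.\<close>

lemma geodesic_on_point:
  assumes "projective_on U A nabla" "open J" "is_interval J" "J \<noteq> {}" "p \<in> U"
  shows "geodesic_on U nabla J (\<lambda>t. p)"
  using geodesic_on_line[OF assms(1-4), of "\<lambda>_. 0" "\<lambda>_. 0" p 0] assms(5) by simp

lemma reparametrization_id:
  "open I \<Longrightarrow> (\<And>t. t \<in> I \<Longrightarrow> k t = c t) \<Longrightarrow> reparametrization I c I k"
  unfolding reparametrization_def
  by (intro exI[of _ "\<lambda>t. t"]) (auto intro: smooth_on_ident simp: bij_betw_def)

lemma projective_on_standard_connection: "projective_on U (\<lambda>_. 0) standard_connection"
  by (simp add: projective_on_def christoffel_def standard_connection_def)

text \<open>\<open>D\<close> is the case \<open>A = 0\<close>, for which the constant function 1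
  serves as potential; the coordinate along the line then has derivative 1.\<close>

lemma standard_geodesic_line:
  assumes "geodesic_on U standard_connection I c"
  obtains p q where "\<And>t. t \<in> I \<Longrightarrow> c t = p + t *\<^sub>R q"
proof -
  obtain p q h where c: "\<And>t. t \<in> I \<Longrightarrow> c t = p + h t *\<^sub>R q"
    and h: "\<And>t. q \<noteq> 0 \<Longrightarrow> t \<in> I \<Longrightarrow> (h has_real_derivative 1) (at t)"
    by (rule geodesic_line_form[OF projective_on_standard_connection assms, of "\<lambda>_. 1"]) auto
  show ?thesis
  proof (cases "q = 0")
    case True
    then show ?thesis using that[of p 0] c by simp
  next
    case False
    have I: "convex I" using assms by (simp add: geodesic_on_def is_interval_convex_1)
    have d: "((\<lambda>t. h t - t) has_derivative (\<lambda>_. 0)) (at t)" if "t \<in> I" for t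
      using DERIV_diff[OF h[OF False that] DERIV_ident] by (simp add: has_field_derivative_def lambda_zero)
    obtain r where "\<And>t. t \<in> I \<Longrightarrow> h t - t = r"
      using has_derivative_zero_constant[OF I has_derivative_at_withinI[OF d]] by blast
    then have "h t = r + t" if "t \<in> I" for t using that by (metis diff_eq_eq)
    then show ?thesis using that[of "p + r *\<^sub>R q" q] c by (simp add: algebra_simps)
  qed
qed

lemma ball_potential_line_has_derivative:
  assumes "p + s *\<^sub>R q \<in> ball 0 1"
  shows "((\<lambda>s. ball_potential (p + s *\<^sub>R q)) has_real_derivative
     - ball_potential (p + s *\<^sub>R q) * (ball_field (p + s *\<^sub>R q) \<bullet> q)) (at s)"
proof -
  have "((\<lambda>s. p + s *\<^sub>R q) has_derivative (\<lambda>h. h *\<^sub>R q)) (at s)" by (auto intro!: derivative_eq_intros)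
  then have "((\<lambda>s. ball_potential (p + s *\<^sub>R q)) has_derivative
      (\<lambda>h. - ball_potential (p + s *\<^sub>R q) * (ball_field (p + s *\<^sub>R q) \<bullet> (h *\<^sub>R q)))) (at s)"
    by (rule has_derivative_compose[where f = "\<lambda>s. p + s *\<^sub>R q" and g = ball_potential, OF _ ball_potential_has_derivative_field[OF assms]])
  then show ?thesis
    unfolding has_field_derivative_def by (rule has_derivative_eq_rhs) (simp add: fun_eq_iff)
qed

lemma Ck_on_ball_potential_line:
  assumes "open J" "Ck_on k J F"
  shows "Ck_on k J (\<lambda>t. (ball_potential (p + F t *\<^sub>R q))\<^sup>2)"
proof -
  note c = Ck_on_const[OF assms(1)] and s = Ck_on_bounded_bilinear[OF assms(1)]
  have 1: "Ck_on k J (\<lambda>t. p + F t *\<^sub>R q)"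
    by (rule Ck_on_add[OF assms(1) c], rule s[OF bounded_bilinear_scaleR assms(2) c])
  have 2: "Ck_on k J (\<lambda>t. (p + F t *\<^sub>R q) \<bullet> (p + F t *\<^sub>R q))"
    by (rule s[OF bounded_bilinear_inner 1 1])
  have 3: "Ck_on k J (\<lambda>t. ((p + F t *\<^sub>R q) \<bullet> (p + F t *\<^sub>R q) + - 1) * (1/2))"
    by (rule s[OF bounded_bilinear_mult], rule Ck_on_add[OF assms(1) 2 c], rule c)
  have "Ck_on k J (\<lambda>t. (((p + F t *\<^sub>R q) \<bullet> (p + F t *\<^sub>R q) + - 1) * (1/2)) *
      (((p + F t *\<^sub>R q) \<bullet> (p + F t *\<^sub>R q) + - 1) * (1/2)))"
    by (rule s[OF bounded_bilinear_mult 3 3])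
  then show ?thesis
    by (rule Ck_on_cong[OF assms(1), rotated]) (simp add: ball_potential_def power2_eq_square)
qed

lemma ball_geodesic_line:
  assumes "geodesic_on (ball 0 1) (projective_connection ball_field) I c"
  obtains p q h where "\<And>t. t \<in> I \<Longrightarrow> c t = p + h t *\<^sub>R q"
    "\<And>t. q \<noteq> 0 \<Longrightarrow> t \<in> I \<Longrightarrow> (h has_real_derivative (ball_potential (p + h t *\<^sub>R q))\<^sup>2) (at t)"
proof (rule geodesic_line_form[OF projective_on_projective_connection assms, of ball_potential])
  show "ball_potential x \<noteq> 0" if "x \<in> ball 0 1" for x :: "real ^ 'a" using ball_potential_neg[OF that] by simp
qed (rule ball_potential_has_derivative_field that; assumption)+

text \<open>A geodesic of one connection is turned into one of the other by the correspondence
  between time and position on a chord. From the ball connection to \<open>D\<close> the change of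
  parameter is time as a function of position; conversely it is position as a function of
  time.\<close>

lemma same_unparameterized_geodesics_ball:
  "same_unparameterized_geodesics (ball 0 1) (projective_connection (ball_field :: 'n::finite field)) standard_connection"
  unfolding same_unparameterized_geodesics_def
proof (intro conjI allI impI)
  let ?U = "ball 0 1 :: (real ^ 'n) set" and ?N = "projective_connection (ball_field :: 'n field)"
  note pr = projective_on_projective_connection[of ?U ball_field]
  have nz: "ball_potential x \<noteq> 0" if "x \<in> ?U" for x using ball_potential_neg[OF that] by simp
  fix I and c :: "real \<Rightarrow> real ^ 'n"
  {
    assume geo: "geodesic_on ?U ?N I c"
    then have I: "open I" "is_interval I" "I \<noteq> {}" and cU: "\<And>t. t \<in> I \<Longrightarrow> c t \<in> ?U" by (auto simp: geodesic_on_def)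
    obtain p q h where c: "\<And>t. t \<in> I \<Longrightarrow> c t = p + h t *\<^sub>R q"
      and h: "\<And>t. q \<noteq> 0 \<Longrightarrow> t \<in> I \<Longrightarrow> (h has_real_derivative (ball_potential (p + h t *\<^sub>R q))\<^sup>2) (at t)"
      by (rule ball_geodesic_line[OF geo]) (rule that)
    show "\<exists>J k. geodesic_on ?U standard_connection J k \<and> reparametrization I c J k"
    proof (cases "q = 0")
      case True
      then have "p \<in> ?U" using c cU I(3) by fastforce
      then have "geodesic_on ?U standard_connection I (\<lambda>t. p)"
        by (rule geodesic_on_point[OF projective_on_standard_connection I])
      moreover have "reparametrization I c I (\<lambda>t. p)"
        using c True by (intro reparametrization_id I) simp
      ultimately show ?thesis by blast
    next
      case False
      have pos: "(ball_potential (p + h t *\<^sub>R q))\<^sup>2 > 0" if "t \<in> I" for t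
        using nz[OF cU[OF that]] c[OF that] by simp
      obtain F where F: "open (h ` I)" "is_interval (h ` I)" "bij_betw F (h ` I) I"
        "\<And>t. t \<in> h ` I \<Longrightarrow> h (F t) = t" "\<And>s. s \<in> I \<Longrightarrow> F (h s) = s"
        "\<And>t. t \<in> h ` I \<Longrightarrow> (F has_real_derivative inverse ((ball_potential (p + h (F t) *\<^sub>R q))\<^sup>2)) (at t)"
        using increasing_inverse[OF I(1,2) h[OF False] pos] by metis
      have FI: "F t \<in> I" if "t \<in> h ` I" for t using F(5) that by auto
      have line: "p + t *\<^sub>R q = c (F t)" if "t \<in> h ` I" for t
        using c[OF FI[OF that]] F(4)[OF that] by simp
      have pos': "(ball_potential (p + t *\<^sub>R q))\<^sup>2 \<noteq> 0" if "t \<in> h ` I" for t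
        using nz[OF cU[OF FI[OF that]]] line[OF that] by simp
      have dF: "(F has_real_derivative inverse ((ball_potential (p + t *\<^sub>R q))\<^sup>2)) (at t)" if "t \<in> h ` I" for t
        using F(6)[OF that] F(4)[OF that] by simp
      \<comment> \<open>The derivative of \<open>F\<close> is an explicit function of the position
        \<open>t\<close>, so its smoothness does not depend on that of \<open>F\<close>.\<close>
      have "Ck_on k (h ` I) (\<lambda>t. inverse ((ball_potential (p + t *\<^sub>R q))\<^sup>2))" for k
        by (intro Ck_on_inverse[OF F(1)] Ck_on_ball_potential_line[OF F(1)] Ck_on_linear[OF F(1)] pos') auto
      then have sm: "smooth_on (h ` I) F" by (intro smooth_on_of_derivative[OF F(1) dF])
      have "geodesic_on ?U standard_connection (h ` I) (\<lambda>t. p + t *\<^sub>R q)"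
        by (rule geodesic_on_standard_line[OF F(1,2)]) (use I(3) line cU FI in auto)
      moreover have "reparametrization I c (h ` I) (\<lambda>t. p + t *\<^sub>R q)"
        unfolding reparametrization_def
        using F(3) sm line pos' by (intro exI[of _ F]) (auto simp: DERIV_imp_deriv[OF dF])
      ultimately show ?thesis by blast
    qed
  next
    assume geo: "geodesic_on ?U standard_connection I c"
    then have I: "open I" "is_interval I" "I \<noteq> {}" and cU: "\<And>t. t \<in> I \<Longrightarrow> c t \<in> ?U" by (auto simp: geodesic_on_def)
    obtain p q where c: "\<And>t. t \<in> I \<Longrightarrow> c t = p + t *\<^sub>R q"
      using standard_geodesic_line[OF geo] by blast
    show "\<exists>J k. geodesic_on ?U ?N J k \<and> reparametrization I c J k"
    proof (cases "q = 0")
      case True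
      then have "p \<in> ?U" using c cU I(3) by fastforce
      then have "geodesic_on ?U ?N I (\<lambda>t. p)"
        by (rule geodesic_on_point[OF pr I])
      moreover have "reparametrization I c I (\<lambda>t. p)"
        using c True by (intro reparametrization_id I) simp
      ultimately show ?thesis by blast
    next
      case False
      have inU: "p + t *\<^sub>R q \<in> ?U" if "t \<in> I" for t using c cU that by metis
      obtain t0 where t0: "t0 \<in> I" using I(3) by blast
      obtain G where G: "\<And>s. p + s *\<^sub>R q \<in> ?U \<Longrightarrow> (G has_real_derivative 1 / (ball_potential (p + s *\<^sub>R q))\<^sup>2) (at s)"
        using chord_time[OF inU[OF t0] False] by metis
      have pos: "1 / (ball_potential (p + t *\<^sub>R q))\<^sup>2 > 0" if "t \<in> I" for t
        using nz[OF inU[OF that]] by simp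
      obtain F where F: "open (G ` I)" "is_interval (G ` I)" "bij_betw F (G ` I) I"
        "\<And>s. s \<in> I \<Longrightarrow> F (G s) = s"
        "\<And>t. t \<in> G ` I \<Longrightarrow> (F has_real_derivative inverse (1 / (ball_potential (p + F t *\<^sub>R q))\<^sup>2)) (at t)"
        using increasing_inverse[OF I(1,2) G[OF inU] pos] by metis
      have FI: "F t \<in> I" if "t \<in> G ` I" for t using F(4) that by auto
      have dF: "(F has_real_derivative (ball_potential (p + F t *\<^sub>R q))\<^sup>2) (at t)" if "t \<in> G ` I" for t
        using F(5)[OF that] by simp
      have "geodesic_on ?U ?N (G ` I) (\<lambda>t. p + F t *\<^sub>R q)"
        by (rule geodesic_on_line[OF pr F(1,2) _ dF inU[OF FI] ball_potential_line_has_derivative[OF inU[OF FI]]])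
           (use I(3) in auto)
      moreover have sm: "smooth_on (G ` I) F"
        by (rule smooth_on_of_derivative[OF F(1) dF], assumption) (rule Ck_on_ball_potential_line[OF F(1)])
      have "reparametrization I c (G ` I) (\<lambda>t. p + F t *\<^sub>R q)"
        unfolding reparametrization_def
        using F(3) sm c[OF FI] nz[OF inU[OF FI]]
        by (intro exI[of _ F]) (auto simp: DERIV_imp_deriv[OF dF])
      ultimately show ?thesis by blast
    qed
  }
qed

text \<open>The elapsed time along the full chord takes every real value, so its inverse gives a
  geodesic on the whole line. The given geodesic is a translate in time of a piece of it, and
  maximality does the rest.\<close>

lemma geodesically_complete_ball:
  "geodesically_complete (ball 0 1) (projective_connection (ball_field :: 'n::finite field))"
  unfolding geodesically_complete_def
proof (intro allI impI)
  let ?U = "ball 0 1 :: (real ^ 'n) set" and ?N = "projective_connection (ball_field :: 'n field)"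
  note pr = projective_on_projective_connection[of ?U ball_field]
  have nz: "ball_potential x \<noteq> 0" if "x \<in> ?U" for x using ball_potential_neg[OF that] by simp
  fix I and c :: "real \<Rightarrow> real ^ 'n"
  assume max: "maximal_geodesic ?U ?N I c"
  then have geo: "geodesic_on ?U ?N I c" by (simp add: maximal_geodesic_def)
  then have I: "open I" "is_interval I" "I \<noteq> {}" and cU: "\<And>t. t \<in> I \<Longrightarrow> c t \<in> ?U" by (auto simp: geodesic_on_def)
  have extend: "I = UNIV" if "geodesic_on ?U ?N UNIV k" "\<And>t. t \<in> I \<Longrightarrow> k t = c t" for k
    using max that unfolding maximal_geodesic_def by blast
  obtain p q h where c: "\<And>t. t \<in> I \<Longrightarrow> c t = p + h t *\<^sub>R q"
    and h: "\<And>t. q \<noteq> 0 \<Longrightarrow> t \<in> I \<Longrightarrow> (h has_real_derivative (ball_potential (p + h t *\<^sub>R q))\<^sup>2) (at t)"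
    by (rule ball_geodesic_line[OF geo]) (rule that)
  show "I = UNIV"
  proof (cases "q = 0")
    case True
    then have "p \<in> ?U" using c cU I(3) by fastforce
    then have "geodesic_on ?U ?N UNIV (\<lambda>t. p)"
      by (intro geodesic_on_point[OF pr]) auto
    then show ?thesis by (rule extend) (use c True in simp)
  next
    case False
    have inU: "p + h t *\<^sub>R q \<in> ?U" if "t \<in> I" for t using c cU that by metis
    obtain t0 where t0: "t0 \<in> I" using I(3) by blast
    obtain G where G: "\<And>s. p + s *\<^sub>R q \<in> ?U \<Longrightarrow> (G has_real_derivative 1 / (ball_potential (p + s *\<^sub>R q))\<^sup>2) (at s)"
      and surj: "\<And>y. \<exists>s. p + s *\<^sub>R q \<in> ?U \<and> G s = y"
      using chord_time[OF inU[OF t0] False] by metis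
    define L where "L = {s. p + s *\<^sub>R q \<in> ?U}"
    have "open ((\<lambda>s. p + s *\<^sub>R q) -` ?U)"
      by (intro open_vimage open_ball continuous_intros)
    then have oL: "open L" by (simp add: L_def vimage_def)
    have "convex L"
    proof (rule convexI)
      fix x y u v :: real assume xy: "x \<in> L" "y \<in> L" "0 \<le> u" "0 \<le> v" "u + v = 1"
      have "u *\<^sub>R (p + x *\<^sub>R q) + v *\<^sub>R (p + y *\<^sub>R q) \<in> ?U"
        by (rule convexD[OF convex_ball]) (use xy in \<open>auto simp: L_def\<close>)
      also have "u *\<^sub>R (p + x *\<^sub>R q) + v *\<^sub>R (p + y *\<^sub>R q) = (u + v) *\<^sub>R p + (u *\<^sub>R x + v *\<^sub>R y) *\<^sub>R q"
        by (simp add: algebra_simps)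
      finally show "u *\<^sub>R x + v *\<^sub>R y \<in> L" using xy by (simp add: L_def)
    qed
    then have iL: "is_interval L" by (simp add: is_interval_convex_1)
    have GL: "(G has_real_derivative 1 / (ball_potential (p + s *\<^sub>R q))\<^sup>2) (at s)"
      and pos: "1 / (ball_potential (p + s *\<^sub>R q))\<^sup>2 > 0" if "s \<in> L" for s
      using that G nz by (auto simp: L_def)
    obtain F where F: "bij_betw F (G ` L) L" "\<And>s. s \<in> L \<Longrightarrow> F (G s) = s"
      "\<And>t. t \<in> G ` L \<Longrightarrow> (F has_real_derivative inverse (1 / (ball_potential (p + F t *\<^sub>R q))\<^sup>2)) (at t)"
      using increasing_inverse[OF oL iL GL pos] by metis
    have UN: "G ` L = UNIV"
    proof (rule UNIV_eq_I[symmetric])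
      fix y
      obtain s where "p + s *\<^sub>R q \<in> ?U" "G s = y" using surj by blast
      then show "y \<in> G ` L" unfolding L_def by blast
    qed
    have FL: "F t \<in> L" for t using F(1) UN by (auto simp: bij_betw_def)
    then have FU: "p + F t *\<^sub>R q \<in> ?U" for t by (simp add: L_def)
    have hL: "h t \<in> L" if "t \<in> I" for t using inU[OF that] by (simp add: L_def)
    have d: "((\<lambda>t. G (h t) - t) has_derivative (\<lambda>_. 0)) (at t)" if t: "t \<in> I" for t
    proof -
      have "((\<lambda>t. G (h t) - t) has_real_derivative
          1 / (ball_potential (p + h t *\<^sub>R q))\<^sup>2 * (ball_potential (p + h t *\<^sub>R q))\<^sup>2 - 1) (at t)"
        by (intro DERIV_diff DERIV_chain2[where f = G] GL hL t h[OF False t] DERIV_ident)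
      then show ?thesis using nz[OF inU[OF t]] by (simp add: has_field_derivative_def lambda_zero)
    qed
    have "convex I" using I by (simp add: is_interval_convex_1)
    \<comment> \<open>\<open>h\<close> moves at the speed that makes \<open>G (h t)\<close> advance
      like \<open>t\<close>; the constant \<open>r\<close> is the shift between the two
      clocks.\<close>
    then obtain r where r: "\<And>t. t \<in> I \<Longrightarrow> G (h t) - t = r"
      using has_derivative_zero_constant[OF _ has_derivative_at_withinI[OF d]] by blast
    have dF: "((\<lambda>t. F (t + r)) has_real_derivative (ball_potential (p + F (t + r) *\<^sub>R q))\<^sup>2) (at t)" for t
    proof -
      have "((\<lambda>t. F (t + r)) has_real_derivative inverse (1 / (ball_potential (p + F (t + r) *\<^sub>R q))\<^sup>2) * 1) (at t)"
        by (rule DERIV_chain2[where f = F, OF F(3)]) (auto simp: UN intro!: derivative_eq_intros)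
      then show ?thesis by simp
    qed
    have "geodesic_on ?U ?N UNIV (\<lambda>t. p + F (t + r) *\<^sub>R q)"
      by (rule geodesic_on_line[OF pr _ _ _ dF FU ball_potential_line_has_derivative[OF FU]]) auto
    then show ?thesis
    proof (rule extend)
      fix t assume t: "t \<in> I"
      have "G (h t) = t + r" using r[OF t] by simp
      then show "p + F (t + r) *\<^sub>R q = c t" using F(2)[OF hL[OF t]] c[OF t] by simp
    qed
  qed
qed

lemma hybrid_connection_ball:
  assumes "CARD('n::finite) \<ge> 2"
  shows "hybrid_connection (ball 0 1) standard_metric (projective_connection (ball_field :: 'n field))"
  unfolding hybrid_connection_def
proof (intro conjI ballI)
  note ac = affine_connection_projective[OF open_ball smooth_on_ball_field]
  show "infinitesimally_conformal (ball 0 1) standard_metric (projective_connection (ball_field :: 'n field))"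
    by (rule infinitesimally_conformal_of_constant_type[OF open_ball smooth_on_ball_field
          projective_on_projective_connection constant_type_ball])
  fix x :: "real ^ 'n" assume x: "x \<in> ball 0 1"
  obtain i :: 'n where True by blast
  have "\<exists>j. j \<noteq> i"
  proof (rule ccontr)
    assume "\<not> (\<exists>j. j \<noteq> i)"
    then have "(UNIV :: 'n set) = {i}" by auto
    then have "CARD('n) = card {i}" by (rule arg_cong)
    then show False using assms by simp
  qed
  then obtain j where j: "j \<noteq> i" by blast
  \<comment> \<open>For distinct axes the constant-type formula reduces to
    \<open>R(e_i, e_j) e_i = \<lambda> e_j\<close> with
    \<open>\<lambda> = - 1 / \<psi>\<close>.\<close>
  have "curvature_tensor (projective_connection ball_field) x (axis i 1) (axis j 1) (axis i 1) =
      - inverse (ball_potential x) *\<^sub>R axis j 1"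
    using j
    by (simp add: curvature_tensor_projective[OF ac open_ball smooth_on_ball_field projective_on_projective_connection x]
        projective_curvature_constant_type[OF constant_type_ball x] inner_axis_axis)
  also have "\<dots> \<noteq> 0"
    using ball_potential_neg[OF x] by (simp add: axis_eq_0_iff)
  finally show "\<exists>u v w. curvature_tensor (projective_connection ball_field) x u v w \<noteq> 0" by blast
qed (use assms in \<open>auto intro: hessian_manifold_ball torsion_free_projective same_unparameterized_geodesics_ball
      incompressible_ball affine_connection_projective smooth_on_ball_field\<close>)

text \<open>For uniqueness, the connection determines the logarithmic derivative,
  \<open>d\<phi> = - \<phi> A\<close>, leaving a scale. Differentiating once more along a unit
  vector gives Hessian \<open>\<phi> / \<psi>\<close>; as the metric prescribes the value 1, \<phi>
  and \<psi> agree pointwise.\<close>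

lemma is_hybrid_potential_ball:
  "is_hybrid_potential (ball 0 1) standard_metric (projective_connection (ball_field :: 'n::finite field)) ball_potential"
  unfolding is_hybrid_potential_def
proof (intro conjI allI impI ballI)
  let ?U = "ball 0 1 :: (real ^ 'n) set" and ?N = "projective_connection (ball_field :: 'n field)"
  have nz: "ball_potential x \<noteq> 0" if "x \<in> ?U" for x using ball_potential_neg[OF that] by simp
  show "potential_for ?U standard_metric ?N ball_potential"
    unfolding potential_for_def
    using smooth_on_ball_potential nz
    by (auto simp: hessian_ball_potential standard_metric_inner projective_connection_def standard_connection_def
        frechet_derivative_eqI[OF ball_potential_has_derivative] ball_field_def scaleR_add_right)
  fix \<phi> and x :: "real ^ 'n" assume \<phi>: "potential_for ?U standard_metric ?N \<phi>" and x: "x \<in> ?U"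
  have sm: "smooth_on ?U \<phi>" and n\<phi>: "\<And>y. y \<in> ?U \<Longrightarrow> \<phi> y \<noteq> 0"
    and h\<phi>: "\<And>y u v. y \<in> ?U \<Longrightarrow> hessian \<phi> y u v = u \<bullet> v"
    using \<phi> by (auto simp: potential_for_def standard_metric_inner)
  have d\<phi>: "frechet_derivative \<phi> (at y) u = - \<phi> y * (ball_field y \<bullet> u)" if y: "y \<in> ?U" for y u
  proof (cases "u = 0")
    case True
    then show ?thesis using linear_0[OF frechet_linear[OF sm y]] by simp
  next
    case False
    \<comment> \<open>With both arguments equal to the same constant field, all terms are multiples
      of \<open>u\<close> and the scalars can be compared.\<close>
    have "?N (\<lambda>_. u) (\<lambda>_. u) y = standard_connection (\<lambda>_. u) (\<lambda>_. u) y -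
       (frechet_derivative \<phi> (at y) u *\<^sub>R u + frechet_derivative \<phi> (at y) u *\<^sub>R u) /\<^sub>R \<phi> y"
      using \<phi> y smooth_on_const[OF open_ball, of 0 1 u] unfolding potential_for_def by blast
    then have "(2 * (ball_field y \<bullet> u)) *\<^sub>R u = (- 2 * frechet_derivative \<phi> (at y) u / \<phi> y) *\<^sub>R u"
      by (simp add: projective_connection_def standard_connection_def divide_inverse algebra_simps flip: scaleR_add_left scaleR_2)
    then have "2 * (ball_field y \<bullet> u) = - 2 * frechet_derivative \<phi> (at y) u / \<phi> y"
      using False by (simp only: scaleR_cancel_right simp_thms)
    moreover have "D = - f * X" if "2 * X = - 2 * D / f" "f \<noteq> 0" for X D f :: real
      using that by (simp add: field_simps)
    ultimately show ?thesis using n\<phi>[OF y] by blast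
  qed
  obtain u :: "real ^ 'n" where u: "u \<in> Basis" using nonempty_Basis by blast
  have "((\<lambda>y. - \<phi> y * (ball_field y \<bullet> u)) has_derivative
     (\<lambda>h. - \<phi> x * (frechet_derivative ball_field (at x) h \<bullet> u) + - frechet_derivative \<phi> (at x) h * (ball_field x \<bullet> u))) (at x)"
    by (intro has_derivative_mult has_derivative_minus smooth_on_has_derivative[OF sm x]
        has_derivative_inner_left smooth_on_has_derivative[OF smooth_on_ball_field x])
  then have "((\<lambda>y. frechet_derivative \<phi> (at y) u) has_derivative
     (\<lambda>h. - \<phi> x * (frechet_derivative ball_field (at x) h \<bullet> u) + - frechet_derivative \<phi> (at x) h * (ball_field x \<bullet> u))) (at x)"
    by (rule has_derivative_transform_within_open[OF _ open_ball x]) (simp add: d\<phi>)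
  from frechet_derivative_eqI[OF this]
  have "hessian \<phi> x u u = - \<phi> x * (frechet_derivative ball_field (at x) u \<bullet> u) + \<phi> x * (ball_field x \<bullet> u) * (ball_field x \<bullet> u)"
    by (simp add: hessian_def d\<phi>[OF x])
  also have "frechet_derivative ball_field (at x) u = (ball_field x \<bullet> u) *\<^sub>R ball_field x + - inverse (ball_potential x) *\<^sub>R u"
    using constant_type_ball x unfolding constant_type_def by blast
  finally have "1 = \<phi> x * inverse (ball_potential x)"
    using h\<phi>[OF x, of u u] u by (simp add: inner_add_left inner_diff_left algebra_simps)
  then show "\<phi> x = ball_potential x" using nz[OF x] by (simp add: field_simps)
qed

section \<open>Uniqueness\<close>

text \<open>If the potential did not vanish at \<open>z\<close>, the geodesic along the diameter through \<open>z\<close> would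
  arrive at \<open>z\<close> in finite time, and it could not be extended.\<close>

lemma potential_zero_on_sphere:
  fixes A :: "'n::finite field"
  assumes pr: "projective_on (ball 0 1) A nabla" and complete: "geodesically_complete (ball 0 1) nabla"
    and \<psi>: "\<And>x. x \<in> ball 0 1 \<Longrightarrow> (x \<bullet> x) / 2 + b \<bullet> x + c \<noteq> 0"
    and A: "\<And>x. x \<in> ball 0 1 \<Longrightarrow> A x = - (x + b) /\<^sub>R ((x \<bullet> x) / 2 + b \<bullet> x + c)"
    and z: "norm z = 1"
  shows "(z \<bullet> z) / 2 + b \<bullet> z + c = 0"
proof (rule ccontr)
  assume nz: "(z \<bullet> z) / 2 + b \<bullet> z + c \<noteq> 0"
  have zz: "z \<bullet> z = 1" using z by (simp add: dot_square_norm)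
  \<comment> \<open>The potential along the diameter through \<open>z\<close>, parametrized by
    \<open>s *\<^sub>R z\<close>.\<close>
  define f where "f s = s\<^sup>2 / 2 + s * (b \<bullet> z) + c" for s :: real
  have f: "(s *\<^sub>R z \<bullet> s *\<^sub>R z) / 2 + b \<bullet> s *\<^sub>R z + c = f s" for s
    by (simp add: f_def zz power2_eq_square)
  define I where "I = {-1 <..< 1 :: real}"
  have inU: "0 + s *\<^sub>R z \<in> ball 0 1" if "s \<in> I" for s using that z by (auto simp: I_def)
  have f0: "f s \<noteq> 0" if "s \<in> I" for s using \<psi>[OF inU[OF that]] f[of s] by simp
  have df: "(f has_real_derivative s + b \<bullet> z) (at s)" for s
    unfolding f_def by (auto intro!: derivative_eq_intros)
  have df': "(f has_real_derivative - f s * (A (0 + s *\<^sub>R z) \<bullet> z)) (at s)" if "s \<in> I" for s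
  proof -
    have As: "A (0 + s *\<^sub>R z) = - (s *\<^sub>R z + b) /\<^sub>R f s"
      using A[OF inU[OF that]] unfolding add_0 f .
    have "f s * (A (0 + s *\<^sub>R z) \<bullet> z) = - (s + b \<bullet> z)"
      unfolding As using f0[OF that] zz
      by (simp add: inner_add_left inner_diff_left)
    then show ?thesis using df[of s] by (simp add: add.commute)
  qed
  define g where "g s = 1 / (f s)\<^sup>2" for s
  have "isCont g s" if "s \<in> I" for s
    unfolding g_def using DERIV_isCont[OF df] f0[OF that] by (intro continuous_intros) auto
  then obtain G where G: "(G has_real_derivative g s) (at s)" if "s \<in> I" for s
    using einterval_antiderivative[of "ereal (-1)" "ereal 1" g]
    by (auto simp: I_def has_real_derivative_iff_has_vector_derivative)
  have I: "open I" "is_interval I" by (simp_all add: I_def is_interval_oo)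
  have gpos: "g s > 0" if "s \<in> I" for s using f0[OF that] by (simp add: g_def)
  obtain F where F: "open (G ` I)" "is_interval (G ` I)" "bij_betw F (G ` I) I"
    "\<And>t. t \<in> G ` I \<Longrightarrow> G (F t) = t"
    "\<And>t. t \<in> G ` I \<Longrightarrow> (F has_real_derivative inverse (g (F t))) (at t)" "strict_mono_on I G"
    using increasing_inverse[OF I G gpos] by metis
  have FI: "F t \<in> I" if "t \<in> G ` I" for t using F(3) that by (auto simp: bij_betw_def)
  have ne: "G ` I \<noteq> {}" by (auto simp: I_def)
  define k where "k t = 0 + F t *\<^sub>R z" for t
  have dF: "(F has_real_derivative (f (F t))\<^sup>2) (at t)" if "t \<in> G ` I" for t
    using F(5)[OF that] by (simp add: g_def)
  have geo: "geodesic_on (ball 0 1) nabla (G ` I) k"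
    unfolding k_def by (rule geodesic_on_line[OF pr F(1,2) ne dF inU[OF FI] df'[OF FI]])
  have "maximal_geodesic (ball 0 1) nabla (G ` I) k"
    unfolding maximal_geodesic_def
  proof (intro conjI allI impI geo)
    fix K l assume K: "geodesic_on (ball 0 1) nabla K l" "G ` I \<subseteq> K" "\<forall>t\<in>G ` I. l t = k t"
    \<comment> \<open>An extension is not known to stay on the diameter. Projecting it to the axis
      of \<open>z\<close> keeps the parameter in \<open>I\<close>, so \<open>G\<close> can still be
      applied.\<close>
    have lI: "l t \<bullet> z \<in> I" if "t \<in> K" for t
    proof -
      have "norm (l t) < 1" using K(1) that by (auto simp: geodesic_on_def)
      moreover have "\<bar>l t \<bullet> z\<bar> \<le> norm (l t) * norm z" by (rule Cauchy_Schwarz_ineq2)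
      ultimately show ?thesis using z by (auto simp: I_def)
    qed
    have lc: "continuous_on K l"
      using K(1) by (auto simp: geodesic_on_def intro!: continuous_at_imp_continuous_on differentiable_imp_continuous_within)
    have Gc: "continuous_on I G" using G by (auto intro!: continuous_at_imp_continuous_on DERIV_isCont)
    \<comment> \<open>The times at which the projected position has elapsed time \<open>t\<close>
      form a set closed in \<open>K\<close>, and this set is exactly \<open>G\<close> followed by
      the image of \<open>I\<close>. Being also open and nonempty in the connected \<open>K\<close>,
      it is all of \<open>K\<close>.\<close>
    have "continuous_on K (\<lambda>t. G (l t \<bullet> z) - t)"
      by (intro continuous_intros continuous_on_compose2[OF Gc] lc) (use lI in auto)
    then have "closedin (top_of_set K) {t \<in> K. G (l t \<bullet> z) - t = 0}"
      by (rule continuous_closedin_preimage_constant)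
    moreover have "{t \<in> K. G (l t \<bullet> z) - t = 0} = G ` I"
    proof
      show "{t \<in> K. G (l t \<bullet> z) - t = 0} \<subseteq> G ` I"
      proof
        fix t assume t: "t \<in> {t \<in> K. G (l t \<bullet> z) - t = 0}"
        then have "G (l t \<bullet> z) = t" by simp
        then show "t \<in> G ` I" using lI[of t] t by (metis (mono_tags, lifting) imageI mem_Collect_eq)
      qed
      show "G ` I \<subseteq> {t \<in> K. G (l t \<bullet> z) - t = 0}"
      proof
        fix t assume t: "t \<in> G ` I"
        then have "l t \<bullet> z = F t" using bspec[OF K(3) t] zz by (simp add: k_def)
        then show "t \<in> {t \<in> K. G (l t \<bullet> z) - t = 0}" using F(4)[OF t] K(2) t by auto
      qed
    qed
    ultimately have "closedin (top_of_set K) (G ` I)" by simp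
    moreover have "openin (top_of_set K) (G ` I)" using F(1) K(2) by (simp add: open_subset)
    moreover have "connected K" using K(1) by (simp add: geodesic_on_def is_interval_connected_1)
    ultimately show "K = G ` I" using ne unfolding connected_clopen by blast
  qed
  then have UN: "G ` I = UNIV" using complete unfolding geodesically_complete_def by blast
  \<comment> \<open>The assumption at \<open>z\<close> itself covers the end point
    \<open>s = 1\<close>, so compactness bounds \<open>g\<close> on the closed interval.\<close>
  have f0': "f s \<noteq> 0" if "s \<in> {0..1}" for s
    using that f0[of s] nz f[of 1] by (cases "s = 1") (auto simp: I_def)
  have "continuous_on {0..1} (\<lambda>s. \<bar>f s\<bar>)"
    by (intro continuous_on_rabs continuous_at_imp_continuous_on ballI DERIV_isCont[OF df])
  then obtain s1 where s1: "s1 \<in> {0..1}" "\<And>s. s \<in> {0..1} \<Longrightarrow> \<bar>f s1\<bar> \<le> \<bar>f s\<bar>"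
    using continuous_attains_inf[of "{0..1::real}" "\<lambda>s. \<bar>f s\<bar>"] by auto
  define B where "B = g s1"
  have B: "g s \<le> B" if "s \<in> {0..1}" for s
  proof -
    have "(f s1)\<^sup>2 \<le> (f s)\<^sup>2" using s1(2)[OF that] abs_le_square_iff by blast
    then show ?thesis
      unfolding B_def g_def using f0'[OF s1(1)] by (intro divide_left_mono) (auto simp: f0'[OF that])
  qed
  have B0: "B \<ge> 0" by (simp add: B_def g_def)
  \<comment> \<open>Completeness would make this time attainable, although reaching any point with
    \<open>0 < s < 1\<close> from the centre takes at most \<open>B\<close>.\<close>
  have "G 0 + B + 1 \<in> G ` I" using UN by simp
  then obtain s where s: "s \<in> I" "G s = G 0 + B + 1" by auto
  have "0 < s"
  proof (rule ccontr)
    assume "\<not> 0 < s"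
    then have "G s \<le> G 0"
      using strict_mono_onD[OF F(6), of s 0] s(1) by (cases "s = 0") (auto simp: I_def)
    then show False using s B0 by simp
  qed
  have "(G has_real_derivative g r) (at r)" if "0 \<le> r" "r \<le> s" for r
    using that s(1) by (intro G) (auto simp: I_def)
  then obtain r where r: "0 < r" "r < s" "G s - G 0 = (s - 0) * g r"
    using MVT2[OF \<open>0 < s\<close>, of G g] by blast
  have "(s - 0) * g r \<le> 1 * B"
    using r s(1) B[of r] B0 gpos[of r] by (intro mult_mono) (auto simp: I_def)
  then show False using r(3) s(2) by simp
qed

lemma complete_hybrid_connection_ball_field:
  fixes nabla :: "'n::finite connection"
  assumes hyb: "hybrid_connection (ball 0 1) standard_metric nabla"
    and complete: "geodesically_complete (ball 0 1) nabla"
  shows "projective_on (ball 0 1) ball_field nabla"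
proof -
  let ?U = "ball 0 1 :: (real ^ 'n) set"
  have d: "CARD('n) \<ge> 2" and ac: "affine_connection ?U nabla" and tf: "torsion_free ?U nabla"
    and sg: "same_unparameterized_geodesics ?U nabla standard_connection"
    and inc: "incompressible ?U nabla" and conf: "infinitesimally_conformal ?U standard_metric nabla"
    and curv: "\<And>x. x \<in> ?U \<Longrightarrow> \<exists>u v w. curvature_tensor nabla x u v w \<noteq> 0"
    using hyb by (auto simp: hybrid_connection_def hessian_manifold_def)
  obtain A where A: "smooth_on ?U A" and pr: "projective_on ?U A nabla"
    using projective_on_exists[OF ac open_ball tf sg] by blast
  obtain l where l: "constant_type ?U A l"
    using constant_type_of_infinitesimally_conformal[OF open_ball A pr
        incompressible_imp_closed[OF inc open_ball A pr] conf] by blast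
  have l0: "l x \<noteq> 0" if x: "x \<in> ?U" for x
  proof
    assume "l x = 0"
    then have "curvature_tensor nabla x u v w = 0" for u v w
      by (simp add: curvature_tensor_projective[OF ac open_ball A pr x] projective_curvature_constant_type[OF l x])
    then show False using curv[OF x] by blast
  qed
  obtain b c where \<psi>: "\<And>x. x \<in> ?U \<Longrightarrow> (x \<bullet> x) / 2 + b \<bullet> x + c \<noteq> 0"
    and Ax: "\<And>x. x \<in> ?U \<Longrightarrow> A x = - (x + b) /\<^sub>R ((x \<bullet> x) / 2 + b \<bullet> x + c)"
    using constant_type_potential[OF open_ball convex_ball A l d l0] by blast
  have sphere: "1 / 2 + b \<bullet> z + c = 0" if "norm z = 1" for z
    using potential_zero_on_sphere[OF pr complete \<psi> Ax that] that by (simp add: dot_square_norm)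
  \<comment> \<open>The condition at the antipodal points \<open>z\<close> and \<open>- z\<close>:
    the difference kills the linear part, the sum fixes the constant.\<close>
  have bz: "b \<bullet> z = 0 \<and> c = - 1 / 2" if "norm z = 1" for z
    using sphere[of z] sphere[of "- z"] that by simp
  have b: "b = 0"
  proof (rule euclidean_eqI)
    show "b \<bullet> i = 0 \<bullet> i" if "i \<in> Basis" for i using bz[of i] that by simp
  qed
  obtain i :: "real ^ 'n" where "i \<in> Basis" using nonempty_Basis by blast
  then have c: "c = - 1 / 2" using bz[of i] by simp
  have "A x = ball_field x" if "x \<in> ?U" for x
    using Ax[OF that] by (simp add: ball_field_def ball_potential_def b c diff_divide_distrib)
  then show ?thesis using pr by (simp add: projective_on_def)
qed

theorem theorem1p12:
  assumes "CARD('n::finite) \<ge> 2"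
  shows "\<exists>nabla :: 'n connection.
           hybrid_connection (ball 0 1) standard_metric nabla \<and>
           geodesically_complete (ball 0 1) nabla \<and>
           (\<forall>nabla'. hybrid_connection (ball 0 1) standard_metric nabla' \<longrightarrow>
              geodesically_complete (ball 0 1) nabla' \<longrightarrow>
              connection_eq_on (ball 0 1) nabla' nabla) \<and>
           is_hybrid_potential (ball 0 1) standard_metric nabla
             (\<lambda>x. ((norm x)\<^sup>2 - 1) / 2)"
proof (intro exI[of _ "projective_connection ball_field"] conjI allI impI)
  show "hybrid_connection (ball 0 1) standard_metric (projective_connection (ball_field :: 'n field))"
    by (rule hybrid_connection_ball[OF assms])
  show "geodesically_complete (ball 0 1) (projective_connection (ball_field :: 'n field))"
    by (rule geodesically_complete_ball)
  have "(\<lambda>x :: real ^ 'n. ((norm x)\<^sup>2 - 1) / 2) = ball_potential"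
    by (simp add: fun_eq_iff ball_potential_def dot_square_norm)
  then show "is_hybrid_potential (ball 0 1) standard_metric (projective_connection ball_field)
      (\<lambda>x :: real ^ 'n. ((norm x)\<^sup>2 - 1) / 2)"
    using is_hybrid_potential_ball by simp
  fix nabla' :: "'n connection"
  assume h: "hybrid_connection (ball 0 1) standard_metric nabla'" "geodesically_complete (ball 0 1) nabla'"
  have ac: "affine_connection (ball 0 1) nabla'" using h(1) by (simp add: hybrid_connection_def)
  show "connection_eq_on (ball 0 1) nabla' (projective_connection ball_field)"
    unfolding connection_eq_on_def
    by (simp add: affine_connection_christoffel[OF ac open_ball] projective_connection_def
        projective_onD[OF complete_hybrid_connection_ball_field[OF h]])
qed

end
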